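(* For every ideal $\mathcal I$ on $\omega$, $$c_{0,\mathcal I}^*\equiv \operatorname{ba}(\mathcal I)\equiv \ell_1\oplus_1 M(U_{\mathcal I}\setminus\omega)\equiv M(\omega)\oplus_1 M(U_{\mathcal I}\setminus\omega)\equiv \ell_1\oplus_1\operatorname{ba}_0(\mathcal I),$$ where $\equiv$ denotes isometric isomorphism of Banach spaces.
   Context: $\mathbb K$ is the scalar field. An ideal on $\omega$ is a collection of subsets of $\omega$ containing $\emptyset$, closed under subsets and finite unions; every ideal is assumed to contain all finite sets. $c_{0,\mathcal I}$ is the closed subspace of $\ell_\infty$ of all bounded sequences $(x_n)$ with $\{n:|x_n|\ge\varepsilon\}\in\mathcal I$ for every $\varepsilon>0$. $\operatorname{ba}(\mathcal I)$ is the Banach space of all $m\colon\mathcal I\to\mathbb K$ with $m(A\cup B)=m(A)+m(B)$ for disjoint $A,B\in\mathcal I$ and $\|m\|<\infty$, with norm $\|m\|=\sup\{\sum_{j=1}^n|m(A_j)|: A_1,\dots,A_n\in\mathcal I\text{ pairwise disjoint}\}$; $\operatorname{ba}_0(\mathcal I)=\{m\in\operatorname{ba}(\mathcal I): m(\{n\})=0\text{ for all }n\in\omega\}$. $\beta\omega$ is the space of ultrafilters on $\omega$ with basis $\widehat A=\{p\in\beta\omega:A\in p\}$, $A\subseteq\omega$; each $n\in\omega$ is identified with the corresponding principal ultrafilter. $U_{\mathcal I}=\bigcup\{\widehat A:A\in\mathcal I\}$ is an open subset of $\beta\omega$ containing $\omega$. For a locally compact Hausdorff space $L$, $M(L)$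 is the Banach space of finite scalar-valued Radon measures on $L$ with the total variation norm; $\omega$ carries the discrete topology. $\oplus_1$ denotes the direct sum with norm $\|(u,v)\|=\|u\|+\|v\|$. *)

theory Defs
  imports "HOL-Analysis.Analysis"
begin

section \<open>Normed spaces with an explicit carrier\<close>

text \<open>
  The spaces below depend on an ideal, hence on a term, so they are not types of a normed-space
  class. They are records over the scalars \<open>'k\<close> instead. The scalar field of the
  theorem ranges over the instances of \<open>real_normed_field\<close> and \<open>euclidean_space\<close>: these include
  \<open>real\<close> and \<open>complex\<close>, and each is isometrically isomorphic, as a field, to one of these two.
\<close>

record ('k, 'v) normed_space =
  vecs :: "'v set"
  vadd :: "'v \<Rightarrow> 'v \<Rightarrow> 'v"
  smul :: "'k \<Rightarrow> 'v \<Rightarrow> 'v"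
  vnorm :: "'v \<Rightarrow> real"

definition isometrically_isomorphic ::
    "('k, 'v) normed_space \<Rightarrow> ('k, 'w) normed_space \<Rightarrow> bool" (infix \<open>\<equiv>\<^sub>i\<close> 50) where
  "X \<equiv>\<^sub>i Y \<longleftrightarrow> (\<exists>T. bij_betw T (vecs X) (vecs Y) \<and>
     (\<forall>x\<in>vecs X. \<forall>y\<in>vecs X. T (vadd X x y) = vadd Y (T x) (T y)) \<and>
     (\<forall>c. \<forall>x\<in>vecs X. T (smul X c x) = smul Y c (T x)) \<and>
     (\<forall>x\<in>vecs X. vnorm Y (T x) = vnorm X x))"

definition function_space ::
    "('a \<Rightarrow> 'k) set \<Rightarrow> (('a \<Rightarrow> 'k) \<Rightarrow> real) \<Rightarrow> ('k::real_normed_field, 'a \<Rightarrow> 'k) normed_space" where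
  "function_space V N =
     \<lparr>vecs = V, vadd = (\<lambda>f g x. f x + g x), smul = (\<lambda>c f x. c * f x), vnorm = N\<rparr>"

definition direct_sum_1 ::
    "('k, 'v) normed_space \<Rightarrow> ('k, 'w) normed_space \<Rightarrow> ('k, 'v \<times> 'w) normed_space"
    (infixr \<open>\<oplus>\<^sub>1\<close> 65) where
  "X \<oplus>\<^sub>1 Y =
     \<lparr>vecs = vecs X \<times> vecs Y,
      vadd = (\<lambda>(u, v) (u', v'). (vadd X u u', vadd Y v v')),
      smul = (\<lambda>c (u, v). (smul X c u, smul Y c v)),
      vnorm = (\<lambda>(u, v). vnorm X u + vnorm Y v)\<rparr>"

text \<open>
  Here and below, a function that is only meaningful on a subset of its domain type is represented
  by its extension by zero; pointwise operations then preserve the representation.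
\<close>

definition dual :: "('k::real_normed_field, 'v) normed_space \<Rightarrow> ('k, 'v \<Rightarrow> 'k) normed_space" where
  "dual X = function_space
     {\<phi>. (\<forall>x. x \<notin> vecs X \<longrightarrow> \<phi> x = 0) \<and>
         (\<forall>x\<in>vecs X. \<forall>y\<in>vecs X. \<phi> (vadd X x y) = \<phi> x + \<phi> y) \<and>
         (\<forall>c. \<forall>x\<in>vecs X. \<phi> (smul X c x) = c * \<phi> x) \<and>
         (\<exists>C. \<forall>x\<in>vecs X. norm (\<phi> x) \<le> C * vnorm X x)}
     (\<lambda>\<phi>. Sup {norm (\<phi> x) |x. x \<in> vecs X \<and> vnorm X x \<le> 1})"

section \<open>Sequence spaces\<close>

definition ideal_on_omega :: "nat set set \<Rightarrow> bool" where
  "ideal_on_omega I \<longleftrightarrow> {} \<in> I \<and> (\<forall>A\<in>I. \<forall>B. B \<subseteq> A \<longrightarrow> B \<in> I) \<and>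
     (\<forall>A\<in>I. \<forall>B\<in>I. A \<union> B \<in> I) \<and> (\<forall>F. finite F \<longrightarrow> F \<in> I)"

definition ell_infty :: "('k::real_normed_field, nat \<Rightarrow> 'k) normed_space" where
  "ell_infty = function_space {x. bounded (range x)} (\<lambda>x. SUP n. norm (x n))"

definition c0_ideal :: "nat set set \<Rightarrow> ('k::real_normed_field, nat \<Rightarrow> 'k) normed_space" where
  "c0_ideal I = ell_infty\<lparr>vecs := {x \<in> vecs ell_infty. \<forall>\<epsilon>>0. {n. norm (x n) \<ge> \<epsilon>} \<in> I}\<rparr>"

definition ell1 :: "('k::real_normed_field, nat \<Rightarrow> 'k) normed_space" where
  "ell1 = function_space {x. summable (\<lambda>n. norm (x n))} (\<lambda>x. \<Sum>n. norm (x n))"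

section \<open>Spaces of measures\<close>

definition variation_sums :: "'a set set \<Rightarrow> ('a set \<Rightarrow> 'k::real_normed_field) \<Rightarrow> real set" where
  "variation_sums \<S> m = {\<Sum>j<n. norm (m (A j)) |(n::nat) A.
     (\<forall>j<n. A j \<in> \<S>) \<and> disjoint_family_on A {..<n}}"

text \<open>Since \<open>Sup\<close> on the reals is only meaningful for bounded sets, finiteness of a variation is
  always expressed by \<open>bdd_above\<close>. Finite disjoint families suffice also for countably additive
  measures: countable ones give the same supremum.\<close>

definition ba :: "nat set set \<Rightarrow> ('k::real_normed_field, nat set \<Rightarrow> 'k) normed_space" where
  "ba I = function_space
     {m. (\<forall>A. A \<notin> I \<longrightarrow> m A = 0) \<and>
         (\<forall>A\<in>I. \<forall>B\<in>I. A \<inter> B = {} \<longrightarrow> m (A \<union> B) = m A + m B) \<and>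
         bdd_above (variation_sums I m)}
     (\<lambda>m. Sup (variation_sums I m))"

definition ba0 :: "nat set set \<Rightarrow> ('k::real_normed_field, nat set \<Rightarrow> 'k) normed_space" where
  "ba0 I = (ba I)\<lparr>vecs := {m \<in> vecs (ba I). \<forall>n. m {n} = 0}\<rparr>"

definition borel_sets_of :: "'a topology \<Rightarrow> 'a set set" where
  "borel_sets_of L = sigma_sets (topspace L) {U. openin L U}"

definition total_variation ::
    "'a topology \<Rightarrow> ('a set \<Rightarrow> 'k::real_normed_field) \<Rightarrow> 'a set \<Rightarrow> real" where
  "total_variation L \<mu> E = Sup (variation_sums {B \<in> borel_sets_of L. B \<subseteq> E} \<mu>)"

text \<open>A finite scalar-valued Borel measure is Radon if its variation is: every Borel set is
  approximated in variation by compact sets from inside and by open sets from outside.\<close>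

definition radon_measures :: "'a topology \<Rightarrow> ('a set \<Rightarrow> 'k::real_normed_field) set" where
  "radon_measures L =
     {\<mu>. (\<forall>B. B \<notin> borel_sets_of L \<longrightarrow> \<mu> B = 0) \<and>
         (\<forall>A. range A \<subseteq> borel_sets_of L \<and> disjoint_family A \<longrightarrow>
              (\<lambda>n::nat. \<mu> (A n)) sums \<mu> (\<Union>n. A n)) \<and>
         bdd_above (variation_sums (borel_sets_of L) \<mu>) \<and>
         (\<forall>B\<in>borel_sets_of L. \<forall>\<epsilon>>0. \<exists>K U. compactin L K \<and> K \<in> borel_sets_of L \<and> openin L U \<and>
              K \<subseteq> B \<and> B \<subseteq> U \<and> total_variation L \<mu> (U - K) < \<epsilon>)}"

definition radon_space ::
    "'a topology \<Rightarrow> ('k::real_normed_field, 'a set \<Rightarrow> 'k) normed_space" where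
  "radon_space L = function_space (radon_measures L) (\<lambda>\<mu>. total_variation L \<mu> (topspace L))"

section \<open>The space of ultrafilters on \<open>\<omega>\<close>\<close>

definition ultrafilter :: "'a filter \<Rightarrow> bool" where
  "ultrafilter p \<longleftrightarrow> p \<noteq> bot \<and> (\<forall>A. (\<forall>\<^sub>F n in p. n \<in> A) \<or> (\<forall>\<^sub>F n in p. n \<notin> A))"

definition hat :: "nat set \<Rightarrow> nat filter set" where
  "hat A = {p. ultrafilter p \<and> (\<forall>\<^sub>F n in p. n \<in> A)}"

lemma hat_Int: "hat (A \<inter> B) = hat A \<inter> hat B"
  by (auto simp: hat_def eventually_conj_iff)

lemma hat_UNIV: "hat UNIV = {p. ultrafilter p}"
  by (auto simp: hat_def)

text \<open>By \<open>hat_Int\<close> the generating sets form a basis, not merely a subbasis.\<close>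

definition beta_omega :: "nat filter topology" where
  "beta_omega = topology_generated_by (range hat)"

definition principal_points :: "nat filter set" where
  "principal_points = range (\<lambda>n. principal {n})"

definition U_ideal :: "nat set set \<Rightarrow> nat filter set" where
  "U_ideal I = (\<Union>A\<in>I. hat A)"

lemma principal_points_subset_U_ideal:
  assumes "ideal_on_omega I" shows "principal_points \<subseteq> U_ideal I"
proof
  fix p assume "p \<in> principal_points"
  then obtain n where p: "p = principal {n}" by (auto simp: principal_points_def)
  have "p \<in> hat {n}"
    by (auto simp: p hat_def ultrafilter_def eventually_principal principal_eq_bot_iff)
  moreover have "{n} \<in> I" using assms by (auto simp: ideal_on_omega_def)
  ultimately show "p \<in> U_ideal I" by (auto simp: U_ideal_def)
qed

end

theory Submission
  imports Defs
begin

text \<open>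
  A functional on \<open>c\<^sub>0\<close> is determined by its values on indicators of members of \<open>I\<close>, since step
  sequences are dense; conversely an element of \<open>ba(I)\<close> is integrated by uniform approximation with
  step sequences. Subtracting from \<open>m\<close> the purely atomic part \<open>A \<mapsto> \<Sum>n\<in>A. m {n}\<close> leaves an element of
  \<open>ba\<^sub>0(I)\<close>, and the norms add up because the two parts can be tested on nearly disjoint families.
  An element of \<open>ba\<^sub>0(I)\<close> vanishes on finite sets, hence is an additive function of the sets
  \<open>hat A - \<omega>\<close> with \<open>A \<in> I\<close>. These are compact open and form a base of the Hausdorff space
  \<open>U - \<omega>\<close>, so Caratheodory's construction, applied to the outer measure that is inner approximated on
  open sets by the ring, extends the function to a Radon measure; regularity shows that the total
  variation may be computed on the ring. The same extension principle, for the ring of finite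
  subsets of \<open>\<omega>\<close>, identifies \<open>\<ell>\<^sub>1\<close> with \<open>M(\<omega>)\<close>.
\<close>

section \<open>Isometric isomorphisms\<close>

text \<open>On a ring of compact open sets finite additivity is already enough for a countably
  additive extension: a countable open cover of a member of the ring has a finite subcover, and this
  turns finite into countable subadditivity. The obstacle is that \<open>U_ideal I\<close> is in
  general only locally compact, so the ring need not have a largest member. Finiteness of the
  extension and its inner regularity on large sets therefore rest on the bounded variation and not
  on a value at the whole space. Scalar-valued functions are reduced to nonnegative contents one
  coordinate at a time, with respect to the \<open>Basis\<close> of the scalar field as a Euclidean
  space. The same class of scalars supplies the other two ingredients of the duality: bounded sets
  of scalars are totally bounded, which makes step sequences dense, and the field is complete, which
  makes the integral exist.\<close>

definition closed_under_operations :: "('k, 'v) normed_space \<Rightarrow> bool" where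
  "closed_under_operations X \<longleftrightarrow>
     (\<forall>x\<in>vecs X. \<forall>y\<in>vecs X. vadd X x y \<in> vecs X) \<and> (\<forall>c. \<forall>x\<in>vecs X. smul X c x \<in> vecs X)"

lemma isometrically_isomorphicI:
  assumes "bij_betw T (vecs X) (vecs Y)"
    and "\<And>x y. x \<in> vecs X \<Longrightarrow> y \<in> vecs X \<Longrightarrow> T (vadd X x y) = vadd Y (T x) (T y)"
    and "\<And>c x. x \<in> vecs X \<Longrightarrow> T (smul X c x) = smul Y c (T x)"
    and "\<And>x. x \<in> vecs X \<Longrightarrow> vnorm Y (T x) = vnorm X x"
  shows "X \<equiv>\<^sub>i Y"
  using assms unfolding isometrically_isomorphic_def by blast

lemma isometrically_isomorphic_refl: "X \<equiv>\<^sub>i X"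
  by (rule isometrically_isomorphicI[where T = id]) auto

lemma isometrically_isomorphic_trans:
  assumes "X \<equiv>\<^sub>i Y" "Y \<equiv>\<^sub>i Z"
  shows "X \<equiv>\<^sub>i Z"
proof -
  obtain S T where S: "bij_betw S (vecs X) (vecs Y)"
      "\<forall>x\<in>vecs X. \<forall>y\<in>vecs X. S (vadd X x y) = vadd Y (S x) (S y)"
      "\<forall>c. \<forall>x\<in>vecs X. S (smul X c x) = smul Y c (S x)"
      "\<forall>x\<in>vecs X. vnorm Y (S x) = vnorm X x"
    and T: "bij_betw T (vecs Y) (vecs Z)"
      "\<forall>x\<in>vecs Y. \<forall>y\<in>vecs Y. T (vadd Y x y) = vadd Z (T x) (T y)"
      "\<forall>c. \<forall>x\<in>vecs Y. T (smul Y c x) = smul Z c (T x)"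
      "\<forall>x\<in>vecs Y. vnorm Z (T x) = vnorm Y x"
    using assms unfolding isometrically_isomorphic_def by blast
  have mem: "S x \<in> vecs Y" if "x \<in> vecs X" for x
    using S(1) that by (rule bij_betwE[rule_format])
  show ?thesis
    by (rule isometrically_isomorphicI[where T = "T \<circ> S"])
       (use S T mem bij_betw_trans[OF S(1) T(1)] in auto)
qed

text \<open>The records carry no vector space axioms. The inverse \<open>S\<close> of
  \<open>T\<close> commutes with the operations because \<open>vadd X (S u) (S v)\<close> and
  \<open>smul X c (S u)\<close> lie in the carrier, where \<open>S\<close> undoes \<open>T\<close>;
  this is what \<open>closed_under_operations\<close> is for.\<close>

lemma isometrically_isomorphic_sym:
  assumes "X \<equiv>\<^sub>i Y" "closed_under_operations X"
  shows "Y \<equiv>\<^sub>i X"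
proof -
  obtain T where bij: "bij_betw T (vecs X) (vecs Y)"
    and add: "\<forall>x\<in>vecs X. \<forall>y\<in>vecs X. T (vadd X x y) = vadd Y (T x) (T y)"
    and smul: "\<forall>c. \<forall>x\<in>vecs X. T (smul X c x) = smul Y c (T x)"
    and norm: "\<forall>x\<in>vecs X. vnorm Y (T x) = vnorm X x"
    using assms(1) unfolding isometrically_isomorphic_def by blast
  define S where "S = inv_into (vecs X) T"
  have S: "S u \<in> vecs X" "T (S u) = u" if "u \<in> vecs Y" for u
    using bij that unfolding S_def bij_betw_def
    by (auto intro: inv_into_into f_inv_into_f)
  have ST: "S (T x) = x" if "x \<in> vecs X" for x
    using bij that unfolding S_def bij_betw_def by (auto intro: inv_into_f_f)
  show ?thesis
  proof (rule isometrically_isomorphicI[where T = S])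
    show "bij_betw S (vecs Y) (vecs X)"
      unfolding S_def by (rule bij_betw_inv_into[OF bij])
    show "S (vadd Y u v) = vadd X (S u) (S v)" if "u \<in> vecs Y" "v \<in> vecs Y" for u v
      using assms(2) add S(1)[OF that(1)] S(1)[OF that(2)] S(2)[OF that(1)] S(2)[OF that(2)]
        ST[of "vadd X (S u) (S v)"]
      by (simp add: closed_under_operations_def)
    show "S (smul Y c u) = smul X c (S u)" if "u \<in> vecs Y" for c u
      using assms(2) smul S[OF that] ST[of "smul X c (S u)"]
      by (simp add: closed_under_operations_def)
    show "vnorm X (S u) = vnorm Y u" if "u \<in> vecs Y" for u
      using norm S[OF that] by metis
  qed
qed

lemma isometrically_isomorphic_direct_sum_1:
  assumes "X \<equiv>\<^sub>i X'" "Y \<equiv>\<^sub>i Y'"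
  shows "X \<oplus>\<^sub>1 Y \<equiv>\<^sub>i X' \<oplus>\<^sub>1 Y'"
proof -
  obtain S T where S: "bij_betw S (vecs X) (vecs X')"
      "\<forall>x\<in>vecs X. \<forall>y\<in>vecs X. S (vadd X x y) = vadd X' (S x) (S y)"
      "\<forall>c. \<forall>x\<in>vecs X. S (smul X c x) = smul X' c (S x)"
      "\<forall>x\<in>vecs X. vnorm X' (S x) = vnorm X x"
    and T: "bij_betw T (vecs Y) (vecs Y')"
      "\<forall>x\<in>vecs Y. \<forall>y\<in>vecs Y. T (vadd Y x y) = vadd Y' (T x) (T y)"
      "\<forall>c. \<forall>x\<in>vecs Y. T (smul Y c x) = smul Y' c (T x)"
      "\<forall>x\<in>vecs Y. vnorm Y' (T x) = vnorm Y x"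
    using assms unfolding isometrically_isomorphic_def by blast
  show ?thesis
    by (rule isometrically_isomorphicI[where T = "map_prod S T"])
       (use S T bij_betw_map_prod[OF S(1) T(1)] in \<open>auto simp: direct_sum_1_def\<close>)
qed

lemma function_space_simps [simp]:
  "vecs (function_space V N) = V"
  "vadd (function_space V N) f g = (\<lambda>x. f x + g x)"
  "smul (function_space V N) c f = (\<lambda>x. c * f x)"
  "vnorm (function_space V N) = N"
  by (simp_all add: function_space_def)

lemma direct_sum_1_simps [simp]:
  "vecs (X \<oplus>\<^sub>1 Y) = vecs X \<times> vecs Y"
  "vadd (X \<oplus>\<^sub>1 Y) (u, v) (u', v') = (vadd X u u', vadd Y v v')"
  "smul (X \<oplus>\<^sub>1 Y) c (u, v) = (smul X c u, smul Y c v)"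
  "vnorm (X \<oplus>\<^sub>1 Y) (u, v) = vnorm X u + vnorm Y v"
  by (simp_all add: direct_sum_1_def)

section \<open>Variation of set functions\<close>

lemma variation_sums_iff:
  "s \<in> variation_sums S m \<longleftrightarrow>
     (\<exists>(n::nat) A. s = (\<Sum>j<n. norm (m (A j))) \<and> (\<forall>j<n. A j \<in> S) \<and> disjoint_family_on A {..<n})"
  by (auto simp: variation_sums_def)

lemma zero_in_variation_sums: "0 \<in> variation_sums S m"
  unfolding variation_sums_iff by (intro exI[of _ 0]) (auto simp: disjoint_family_on_def)

text \<open>Frees the variation from families indexed by initial segments: below, families are
  indexed by disjoint sums of two index sets, by truth values and by the values of a step
  sequence.\<close>

lemma sum_norm_in_variation_sums:
  assumes "finite F" "\<And>i. i \<in> F \<Longrightarrow> A i \<in> S" "disjoint_family_on A F"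
  shows "(\<Sum>i\<in>F. norm (m (A i))) \<in> variation_sums S m"
proof -
  obtain h where h: "bij_betw h {..<card F} F"
    using ex_bij_betw_nat_finite[OF assms(1)] by (auto simp: atLeast0LessThan)
  have "(\<Sum>i\<in>F. norm (m (A i))) = (\<Sum>j<card F. norm (m (A (h j))))"
    by (rule sum.reindex_bij_betw[OF h, symmetric])
  moreover have "\<forall>j<card F. A (h j) \<in> S"
    using h assms(2) by (auto simp: bij_betw_def)
  moreover have "disjoint_family_on (\<lambda>j. A (h j)) {..<card F}"
    using h assms(3) unfolding disjoint_family_on_def bij_betw_def inj_on_def by blast
  ultimately show ?thesis
    unfolding variation_sums_iff by (intro exI[of _ "card F"] exI[of _ "\<lambda>j. A (h j)"] conjI)
qed

lemma variation_sums_cong: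
  assumes "\<And>A. A \<in> S \<Longrightarrow> m A = m' A"
  shows "variation_sums S m = variation_sums S m'"
proof -
  have *: "(\<Sum>j<n. norm (m (A j))) = (\<Sum>j<n. norm (m' (A j)))" if "\<forall>j<n. A j \<in> S" for n :: nat and A
    using that assms by (intro sum.cong) auto
  show ?thesis
    by (rule set_eqI, unfold variation_sums_iff, intro ex_cong1) (auto simp: *)
qed

lemma sum_norm_le_variation:
  assumes "bdd_above (variation_sums S m)"
    and "finite F" "\<And>i. i \<in> F \<Longrightarrow> A i \<in> S" "disjoint_family_on A F"
  shows "(\<Sum>i\<in>F. norm (m (A i))) \<le> Sup (variation_sums S m)"
  by (intro cSup_upper assms sum_norm_in_variation_sums)

lemma norm_le_variation:
  assumes "bdd_above (variation_sums S m)" "A \<in> S"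
  shows "norm (m A) \<le> Sup (variation_sums S m)"
  using sum_norm_le_variation[OF assms(1), of "{()}" "\<lambda>_. A"] assms(2)
  by (simp add: disjoint_family_on_def)

lemma variation_nonneg:
  assumes "bdd_above (variation_sums S m)"
  shows "0 \<le> Sup (variation_sums S m)"
  by (intro cSup_upper assms zero_in_variation_sums)

text \<open>A uniform bound on the sums has to yield boundedness together with the estimate, since
  \<open>Sup\<close> of an unbounded set says nothing. The empty family, with sum 0, makes the set
  of sums nonempty.\<close>

lemma variation_le:
  assumes "\<And>(n::nat) A. (\<And>j. j < n \<Longrightarrow> A j \<in> S) \<Longrightarrow> disjoint_family_on A {..<n} \<Longrightarrow>
              (\<Sum>j<n. norm (m (A j))) \<le> C"
  shows "bdd_above (variation_sums S m)" "Sup (variation_sums S m) \<le> C"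
proof -
  have *: "s \<le> C" if "s \<in> variation_sums S m" for s
    using that assms unfolding variation_sums_iff by blast
  show "bdd_above (variation_sums S m)"
    using * by (rule bdd_aboveI)
  show "Sup (variation_sums S m) \<le> C"
    by (rule cSup_least) (use * zero_in_variation_sums in auto)
qed

lemma variation_approx:
  assumes "bdd_above (variation_sums S m)" "e > 0"
  obtains n :: nat and A where "\<And>j. j < n \<Longrightarrow> A j \<in> S" "disjoint_family_on A {..<n}"
    "(\<Sum>j<n. norm (m (A j))) > Sup (variation_sums S m) - e"
proof -
  have "\<exists>s\<in>variation_sums S m. Sup (variation_sums S m) - e < s"
    using assms zero_in_variation_sums by (subst less_cSup_iff[symmetric]) auto
  then obtain s where s: "s \<in> variation_sums S m" "Sup (variation_sums S m) - e < s"
    by blast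
  from s(1) obtain n :: nat and A where "s = (\<Sum>j<n. norm (m (A j)))"
      "\<forall>j<n. A j \<in> S" "disjoint_family_on A {..<n}"
    unfolding variation_sums_iff by auto
  then show ?thesis
    using that[of n A] s(2) by simp
qed

lemma variation_sums_mono: "S \<subseteq> S' \<Longrightarrow> variation_sums S m \<subseteq> variation_sums S' m"
  unfolding variation_sums_def by blast

lemma variation_mono:
  assumes "S \<subseteq> S'" "bdd_above (variation_sums S' m)"
  shows "bdd_above (variation_sums S m)" "Sup (variation_sums S m) \<le> Sup (variation_sums S' m)"
proof -
  show "bdd_above (variation_sums S m)"
    using assms by (meson bdd_above_mono variation_sums_mono)
  show "Sup (variation_sums S m) \<le> Sup (variation_sums S' m)"
    using assms zero_in_variation_sums by (intro cSup_subset_mono variation_sums_mono) auto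
qed

lemma variation_add_le:
  assumes "bdd_above (variation_sums S m)" "bdd_above (variation_sums S m')"
  shows "bdd_above (variation_sums S (\<lambda>A. m A + m' A))"
    and "Sup (variation_sums S (\<lambda>A. m A + m' A)) \<le>
           Sup (variation_sums S m) + Sup (variation_sums S m')"
proof -
  have "(\<Sum>j<n. norm (m (A j) + m' (A j))) \<le> Sup (variation_sums S m) + Sup (variation_sums S m')"
    if "\<And>j. j < n \<Longrightarrow> A j \<in> S" "disjoint_family_on A {..<n}" for n :: nat and A
  proof -
    have "(\<Sum>j<n. norm (m (A j) + m' (A j))) \<le> (\<Sum>j<n. norm (m (A j))) + (\<Sum>j<n. norm (m' (A j)))"
      unfolding sum.distrib[symmetric] by (intro sum_mono norm_triangle_ineq)
    also have "\<dots> \<le> Sup (variation_sums S m) + Sup (variation_sums S m')"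
      using that by (intro add_mono sum_norm_le_variation assms) auto
    finally show ?thesis .
  qed
  then show "bdd_above (variation_sums S (\<lambda>A. m A + m' A))"
    "Sup (variation_sums S (\<lambda>A. m A + m' A)) \<le> Sup (variation_sums S m) + Sup (variation_sums S m')"
    by (rule variation_le; blast)+
qed

lemma variation_scale_le:
  fixes m :: "'a set \<Rightarrow> 'k::real_normed_field"
  assumes "bdd_above (variation_sums S m)"
  shows "bdd_above (variation_sums S (\<lambda>A. c * m A))"
    and "Sup (variation_sums S (\<lambda>A. c * m A)) \<le> norm c * Sup (variation_sums S m)"
proof -
  have "(\<Sum>j<n. norm (c * m (A j))) \<le> norm c * Sup (variation_sums S m)"
    if "\<And>j. j < n \<Longrightarrow> A j \<in> S" "disjoint_family_on A {..<n}" for n :: nat and A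
    using that by (auto simp: norm_mult sum_distrib_left[symmetric]
        intro!: mult_left_mono sum_norm_le_variation assms)
  then show "bdd_above (variation_sums S (\<lambda>A. c * m A))"
    "Sup (variation_sums S (\<lambda>A. c * m A)) \<le> norm c * Sup (variation_sums S m)"
    by (rule variation_le; blast)+
qed

lemma additive_finite_UN:
  assumes "ring_of_sets \<Omega> S" "m {} = 0"
    and add: "\<And>A B. A \<in> S \<Longrightarrow> B \<in> S \<Longrightarrow> A \<inter> B = {} \<Longrightarrow> m (A \<union> B) = m A + m B"
    and "finite F" "\<And>i. i \<in> F \<Longrightarrow> A i \<in> S" "disjoint_family_on A F"
  shows "m (\<Union>i\<in>F. A i) = (\<Sum>i\<in>F. m (A i))"
  using assms(4-6)
proof (induction F)
  case empty
  then show ?case using assms(2) by simp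
next
  case (insert i F)
  interpret ring_of_sets \<Omega> S by fact
  have "A i \<inter> (\<Union>i\<in>F. A i) = {}"
    using insert by (auto simp: disjoint_family_on_def)
  moreover have "(\<Union>i\<in>F. A i) \<in> S" "A i \<in> S"
    using insert by auto
  ultimately have "m (A i \<union> (\<Union>i\<in>F. A i)) = m (A i) + m (\<Union>i\<in>F. A i)"
    by (intro add) auto
  then show ?case
    using insert by (simp add: disjoint_family_on_def)
qed

lemma disjoint_family_on_case_sum:
  assumes "disjoint_family_on E I" "disjoint_family_on F J"
    and "\<And>i j. i \<in> I \<Longrightarrow> j \<in> J \<Longrightarrow> E i \<inter> F j = {}"
  shows "disjoint_family_on (case_sum E F) (I <+> J)"
  unfolding disjoint_family_on_def
proof (intro ballI impI)
  have EF: "E i \<inter> F j = {}" "F j \<inter> E i = {}" if "i \<in> I" "j \<in> J" for i j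
    using assms(3)[OF that] by blast+
  have EE: "E i \<inter> E j = {}" if "i \<in> I" "j \<in> I" "i \<noteq> j" for i j
    using disjoint_family_onD[OF assms(1)] that by simp
  have FF: "F i \<inter> F j = {}" if "i \<in> J" "j \<in> J" "i \<noteq> j" for i j
    using disjoint_family_onD[OF assms(2)] that by simp
  fix x y assume "x \<in> I <+> J" "y \<in> I <+> J" "x \<noteq> y"
  then show "case_sum E F x \<inter> case_sum E F y = {}"
    by (cases x; cases y) (simp_all add: Plus_def image_iff EF EE FF)
qed

text \<open>Two families realising the variations over \<open>A\<close> and \<open>B\<close> up to \<open>e\<close> are concatenated; conversely
  every family below \<open>A \<union> B\<close> is cut along \<open>A\<close>.\<close>

lemma variation_additive:
  assumes "ring_of_sets \<Omega> S"
    and add: "\<And>A B. A \<in> S \<Longrightarrow> B \<in> S \<Longrightarrow> A \<inter> B = {} \<Longrightarrow> m (A \<union> B) = m A + m B"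
    and bdd: "bdd_above (variation_sums S m)"
    and AB: "A \<in> S" "B \<in> S" "A \<inter> B = {}"
  defines "V \<equiv> (\<lambda>A. Sup (variation_sums {B \<in> S. B \<subseteq> A} m))"
  shows "V (A \<union> B) = V A + V B"
proof (rule antisym)
  interpret ring_of_sets \<Omega> S by fact
  have bdd': "bdd_above (variation_sums {B \<in> S. B \<subseteq> A} m)" for A
    by (rule variation_mono(1)[OF _ bdd]) auto
  have "(\<Sum>j<n. norm (m (E j))) \<le> V A + V B"
    if E: "\<And>j. j < n \<Longrightarrow> E j \<in> {C \<in> S. C \<subseteq> A \<union> B}" "disjoint_family_on E {..<n}" for n :: nat and E
  proof -
    have "m (E j) = m (E j \<inter> A) + m (E j \<inter> B)" if "j < n" for j
    proof -
      have "E j = (E j \<inter> A) \<union> (E j \<inter> B)" "E j \<inter> A \<in> S" "E j \<inter> B \<in> S"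
        using E(1)[OF that] AB by auto
      then show ?thesis
        using add[of "E j \<inter> A" "E j \<inter> B"] AB(3) by (metis Int_assoc Int_empty_right Int_left_commute)
    qed
    then have "(\<Sum>j<n. norm (m (E j))) \<le> (\<Sum>j<n. norm (m (E j \<inter> A)) + norm (m (E j \<inter> B)))"
      by (intro sum_mono) (auto intro: norm_triangle_ineq)
    also have "\<dots> = (\<Sum>j<n. norm (m (E j \<inter> A))) + (\<Sum>j<n. norm (m (E j \<inter> B)))"
      by (rule sum.distrib)
    also have "\<dots> \<le> V A + V B"
    proof -
      have "disjoint_family_on (\<lambda>j. E j \<inter> D) {..<n}" for D
        using E(2) unfolding disjoint_family_on_def by blast
      then show ?thesis
        unfolding V_def using E(1) AB by (intro add_mono sum_norm_le_variation bdd') auto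
    qed
    finally show ?thesis .
  qed
  then show "V (A \<union> B) \<le> V A + V B"
    unfolding V_def by (rule variation_le(2)) auto
  have "V A + V B \<le> V (A \<union> B) + 2 * e" if "e > 0" for e
  proof -
    obtain n E where E: "\<And>j. j < n \<Longrightarrow> E j \<in> {C \<in> S. C \<subseteq> A}" "disjoint_family_on E {..<n::nat}"
      "(\<Sum>j<n. norm (m (E j))) > V A - e"
      unfolding V_def by (rule variation_approx[OF bdd'[of A] \<open>e > 0\<close>], rule that, assumption+, unfold V_def, assumption)
    obtain k F where F: "\<And>j. j < k \<Longrightarrow> F j \<in> {C \<in> S. C \<subseteq> B}" "disjoint_family_on F {..<k::nat}"
      "(\<Sum>j<k. norm (m (F j))) > V B - e"
      unfolding V_def by (rule variation_approx[OF bdd'[of B] \<open>e > 0\<close>], rule that, assumption+, unfold V_def, assumption)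
    have "(\<Sum>j<n. norm (m (E j))) + (\<Sum>j<k. norm (m (F j))) =
        (\<Sum>j\<in>{..<n} <+> {..<k}. norm (m (case_sum E F j)))"
      by (simp add: sum.Plus)
    also have "\<dots> \<le> V (A \<union> B)"
      unfolding V_def
    proof (rule sum_norm_le_variation[OF bdd'])
      show "case_sum E F j \<in> {C \<in> S. C \<subseteq> A \<union> B}" if "j \<in> {..<n} <+> {..<k}" for j
        using that E(1) F(1) by fastforce
      have "E i \<inter> F j = {}" if "i < n" "j < k" for i j
        using E(1)[OF that(1)] F(1)[OF that(2)] AB(3) by blast
      then show "disjoint_family_on (case_sum E F) ({..<n} <+> {..<k})"
        using E(2) F(2) by (intro disjoint_family_on_case_sum) auto
    qed simp
    finally show ?thesis using E(3) F(3) by simp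
  qed
  note * = this
  show "V A + V B \<le> V (A \<union> B)"
  proof (rule field_le_epsilon)
    fix e :: real assume "0 < e"
    then show "V A + V B \<le> V (A \<union> B) + e" using *[of "e / 2"] by simp
  qed
qed

section \<open>Extending contents on a ring of compact open sets\<close>

lemma borel_sigma_algebra: "sigma_algebra (topspace X) (borel_sets_of X)"
  unfolding borel_sets_of_def by (rule sigma_algebra_sigma_sets) (auto dest: openin_subset)

lemma open_borel: "openin X U \<Longrightarrow> U \<in> borel_sets_of X"
  unfolding borel_sets_of_def by auto

lemma closed_borel: "closedin X K \<Longrightarrow> K \<in> borel_sets_of X"
  using sigma_sets.Compl[of "topspace X - K" "topspace X" "{U. openin X U}"] closedin_subset[of X K]
  by (auto simp: closedin_def double_diff borel_sets_of_def)

text \<open>The setting common to both spaces of measures: the traces of the sets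
  \<open>hat A\<close> on the nonprincipal part, and the finite subsets of a discrete space.\<close>

locale compact_open_ring = ring_of_sets "topspace X" \<C> for X :: "'a topology" and \<C> +
  assumes Hausdorff: "Hausdorff_space X"
    and compact: "A \<in> \<C> \<Longrightarrow> compactin X A"
    and "open": "A \<in> \<C> \<Longrightarrow> openin X A"
    and base: "openin X U \<Longrightarrow> x \<in> U \<Longrightarrow> \<exists>A\<in>\<C>. x \<in> A \<and> A \<subseteq> U"
begin

lemma closed: "A \<in> \<C> \<Longrightarrow> closedin X A"
  using Hausdorff compact compactin_imp_closedin by blast

text \<open>Cover \<open>K\<close> by members of the ring inside \<open>U\<close> and unite a finite
  subcover. Such sets do the work that Urysohn functions do in general locally compact
  spaces.\<close>

lemma compact_between:
  assumes "compactin X K" "openin X U" "K \<subseteq> U"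
  obtains A where "A \<in> \<C>" "K \<subseteq> A" "A \<subseteq> U"
proof -
  have "\<exists>\<F>. finite \<F> \<and> \<F> \<subseteq> {A \<in> \<C>. A \<subseteq> U} \<and> K \<subseteq> \<Union>\<F>"
  proof (rule compactinD[OF assms(1)])
    show "K \<subseteq> \<Union>{A \<in> \<C>. A \<subseteq> U}"
      using base[OF assms(2)] assms(3) by blast
  qed (use "open" in blast)
  then obtain \<F> where "finite \<F>" "\<F> \<subseteq> \<C>" "\<Union>\<F> \<subseteq> U" "K \<subseteq> \<Union>\<F>"
    by blast
  then show ?thesis
    using that[of "\<Union>\<F>"] finite_Union by blast
qed

text \<open>The set \<open>A - W\<close> is compact and contained in \<open>U\<close>; any
  \<open>B\<close> of the ring between the two splits \<open>A\<close> along the cover.\<close>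

lemma split_cover:
  assumes "A \<in> \<C>" "openin X U" "openin X W" "A \<subseteq> U \<union> W"
  obtains B where "B \<in> \<C>" "A \<inter> B \<subseteq> U" "A - B \<subseteq> W"
proof -
  have "compactin X (A - W)"
    using closed_compactin[OF compact[OF assms(1)]] closedin_diff[OF closed[OF assms(1)] assms(3)]
    by blast
  then obtain B where "B \<in> \<C>" "A - W \<subseteq> B" "B \<subseteq> U"
    using assms(2,4) by (metis Diff_subset_conv Un_commute compact_between)
  then show ?thesis using that[of B] by blast
qed

lemma ring_borel: "\<C> \<subseteq> borel_sets_of X"
  using open_borel "open" by auto

end

text \<open>The bound \<open>b\<close> stands in for the value of \<open>c\<close> at the whole
  space, which may lie outside the ring.\<close>

locale bounded_content = compact_open_ring +
  fixes c :: "'a set \<Rightarrow> real" and b :: real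
  assumes nonneg: "A \<in> \<C> \<Longrightarrow> 0 \<le> c A"
    and add: "A \<in> \<C> \<Longrightarrow> B \<in> \<C> \<Longrightarrow> A \<inter> B = {} \<Longrightarrow> c (A \<union> B) = c A + c B"
    and bounded: "A \<in> \<C> \<Longrightarrow> c A \<le> b"
begin

lemma c_empty: "c {} = 0"
  using add[of "{}" "{}"] by simp

lemma c_mono: "A \<in> \<C> \<Longrightarrow> B \<in> \<C> \<Longrightarrow> A \<subseteq> B \<Longrightarrow> c A \<le> c B"
  using add[of A "B - A"] nonneg[of "B - A"] Diff[of B A] by (auto simp: Un_absorb1)

definition inner_content :: "'a set \<Rightarrow> ennreal" where
  "inner_content U = (SUP A\<in>{A \<in> \<C>. A \<subseteq> U}. ennreal (c A))"

text \<open>Values lie in \<open>ennreal\<close>, where suprema, infima and series exist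
  unconditionally; \<open>b\<close> makes them finite afterwards.\<close>

definition outer_content :: "'a set \<Rightarrow> ennreal" where
  "outer_content E = (INF U\<in>{U. openin X U \<and> E \<subseteq> U}. inner_content U)"

lemma le_inner_content: "A \<in> \<C> \<Longrightarrow> A \<subseteq> U \<Longrightarrow> ennreal (c A) \<le> inner_content U"
  unfolding inner_content_def by (rule SUP_upper) auto

lemma inner_content_least: "(\<And>A. A \<in> \<C> \<Longrightarrow> A \<subseteq> U \<Longrightarrow> ennreal (c A) \<le> r) \<Longrightarrow> inner_content U \<le> r"
  unfolding inner_content_def by (rule SUP_least) auto

lemma inner_content_mono: "U \<subseteq> W \<Longrightarrow> inner_content U \<le> inner_content W"
  by (rule inner_content_least) (auto intro: le_inner_content)

lemma inner_content_ring: "A \<in> \<C> \<Longrightarrow> inner_content A = ennreal (c A)"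
  by (intro antisym inner_content_least le_inner_content) (auto intro: ennreal_leI c_mono)

lemma outer_content_le: "openin X U \<Longrightarrow> E \<subseteq> U \<Longrightarrow> outer_content E \<le> inner_content U"
  unfolding outer_content_def by (rule INF_lower) auto

lemma outer_content_greatest: "(\<And>U. openin X U \<Longrightarrow> E \<subseteq> U \<Longrightarrow> r \<le> inner_content U) \<Longrightarrow> r \<le> outer_content E"
  unfolding outer_content_def by (rule INF_greatest) auto

lemma outer_content_open: "openin X U \<Longrightarrow> outer_content U = inner_content U"
  by (intro antisym outer_content_le outer_content_greatest) (auto intro: inner_content_mono)

lemma outer_content_mono: "E \<subseteq> F \<Longrightarrow> outer_content E \<le> outer_content F"
  by (rule outer_content_greatest) (auto intro: outer_content_le)

lemma outer_content_le_bound: "outer_content E \<le> ennreal b" if "E \<subseteq> topspace X"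
proof -
  have "outer_content E \<le> inner_content (topspace X)"
    using that by (intro outer_content_le) auto
  also have "\<dots> \<le> ennreal b"
    by (intro inner_content_least ennreal_leI bounded)
  finally show ?thesis .
qed

lemma inner_content_Un_le:
  assumes "openin X U" "openin X W"
  shows "inner_content (U \<union> W) \<le> inner_content U + inner_content W"
proof (rule inner_content_least)
  fix A assume A: "A \<in> \<C>" "A \<subseteq> U \<union> W"
  then obtain B where B: "B \<in> \<C>" "A \<inter> B \<subseteq> U" "A - B \<subseteq> W"
    using assms by (blast elim: split_cover)
  have "c A = c (A \<inter> B) + c (A - B)"
    using add[of "A \<inter> B" "A - B"] A B by (auto simp: Int_Diff_Un)
  then have "ennreal (c A) = ennreal (c (A \<inter> B)) + ennreal (c (A - B))"
    using nonneg[OF Int[OF A(1) B(1)]] nonneg[OF Diff[OF A(1) B(1)]] by simp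
  also have "\<dots> \<le> inner_content U + inner_content W"
    using A B by (intro add_mono le_inner_content) auto
  finally show "ennreal (c A) \<le> inner_content U + inner_content W" .
qed

lemma inner_content_empty: "inner_content {} = 0"
  using inner_content_ring[of "{}"] c_empty by simp

text \<open>A member \<open>A\<close> of the ring inside the union is compact, hence covered by
  finitely many \<open>U i\<close>, and the binary estimate can be iterated. This is the source of
  countable subadditivity, although \<open>c\<close> is only finitely additive.\<close>

lemma inner_content_UN_le:
  fixes U :: "nat \<Rightarrow> 'a set"
  assumes U: "\<And>i. openin X (U i)"
  shows "inner_content (\<Union>i. U i) \<le> (\<Sum>i. inner_content (U i))"
proof (rule inner_content_least)
  fix A assume A: "A \<in> \<C>" "A \<subseteq> (\<Union>i. U i)"
  have "\<exists>\<F>. finite \<F> \<and> \<F> \<subseteq> range U \<and> A \<subseteq> \<Union>\<F>"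
    using A U by (intro compactinD[OF compact]) auto
  then obtain F where F: "finite F" "A \<subseteq> (\<Union>i\<in>F. U i)"
    by (metis finite_subset_image)
  have "inner_content (\<Union>i\<in>F. U i) \<le> (\<Sum>i\<in>F. inner_content (U i))"
    using F(1)
  proof (induction F)
    case (insert i F)
    have "inner_content (\<Union>i\<in>insert i F. U i) \<le> inner_content (U i) + inner_content (\<Union>i\<in>F. U i)"
      using inner_content_Un_le[of "U i" "\<Union>i\<in>F. U i"] U by auto
    also have "\<dots> \<le> inner_content (U i) + (\<Sum>i\<in>F. inner_content (U i))"
      using insert by (intro add_left_mono) auto
    finally show ?case using insert by simp
  qed (simp add: inner_content_empty)
  also have "\<dots> \<le> (\<Sum>i. inner_content (U i))"
    by (rule sum_le_suminf) (use F in auto)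
  finally show "ennreal (c A) \<le> (\<Sum>i. inner_content (U i))"
    using le_inner_content[OF A(1) F(2)] by (rule order_trans[rotated])
qed

lemma outer_content_approx:
  assumes "E \<subseteq> topspace X" "e > 0"
  obtains U where "openin X U" "E \<subseteq> U" "inner_content U < outer_content E + ennreal e"
proof -
  have "outer_content E \<noteq> top"
    using outer_content_le_bound[OF assms(1)] by (auto simp: top_unique)
  then have "outer_content E < outer_content E + ennreal e"
    using assms(2) by (simp add: ennreal_less_zero_iff)
  then show ?thesis
    using that unfolding outer_content_def INF_less_iff by auto
qed

section \<open>Caratheodory's criterion for the outer content\<close>

lemma outer_measure_space_outer: "outer_measure_space (Pow (topspace X)) outer_content"
  unfolding outer_measure_space_def
proof (intro conjI)
  show "positive (Pow (topspace X)) outer_content"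
    using outer_content_open[of "{}"] by (simp add: positive_def inner_content_empty)
  show "increasing (Pow (topspace X)) outer_content"
    by (simp add: increasing_def outer_content_mono)
  show "countably_subadditive (Pow (topspace X)) outer_content"
    unfolding countably_subadditive_def
  proof (intro allI impI)
    fix E :: "nat \<Rightarrow> 'a set"
    assume E: "range E \<subseteq> Pow (topspace X)" 
    show "outer_content (\<Union>i. E i) \<le> (\<Sum>i. outer_content (E i))"
    proof (rule ennreal_le_epsilon)
      fix e :: real assume e: "0 < e"
      \<comment> \<open>Errors that sum to \<open>e\<close>; the exponent starts at 1 so that the
        powers of one half sum to 1.\<close>
      define d where "d i = e * (1 / 2) ^ Suc i" for i
      have d: "d i > 0" for i using e by (simp add: d_def)
      have "(\<lambda>i. d i) sums (e * 1)"
        unfolding d_def by (intro sums_mult power_half_series)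
      then have dsum: "(\<Sum>i. ennreal (d i)) = ennreal e"
        using d by (intro suminf_ennreal_eq less_imp_le) auto
      have "\<exists>U. openin X U \<and> E i \<subseteq> U \<and> inner_content U < outer_content (E i) + ennreal (d i)" for i
      proof -
        have "E i \<subseteq> topspace X" using E by auto
        from outer_content_approx[OF this d[of i]] show ?thesis by metis
      qed
      then obtain U where U: "\<And>i. openin X (U i)" "\<And>i. E i \<subseteq> U i"
          "\<And>i. inner_content (U i) < outer_content (E i) + ennreal (d i)"
        by metis
      have "outer_content (\<Union>i. E i) \<le> inner_content (\<Union>i. U i)"
        using U by (intro outer_content_le) auto
      also have "\<dots> \<le> (\<Sum>i. inner_content (U i))"
        by (rule inner_content_UN_le) (rule U)
      also have "\<dots> \<le> (\<Sum>i. outer_content (E i) + ennreal (d i))"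
        by (intro suminf_le less_imp_le U) auto
      also have "\<dots> = (\<Sum>i. outer_content (E i)) + (\<Sum>i. ennreal (d i))"
        by (rule suminf_add[symmetric]) auto
      finally show "outer_content (\<Union>i. E i) \<le> (\<Sum>i. outer_content (E i)) + ennreal e"
        by (simp add: dsum)
    qed
  qed
qed

text \<open>If \<open>A\<close> in the ring lies in \<open>W \<inter> U\<close> and \<open>B\<close>
  in the ring lies in \<open>W - A\<close>, then \<open>A \<union> B\<close> is a disjoint union
  inside \<open>W\<close>. As \<open>A\<close> is closed, \<open>W - A\<close> is open, and it
  contains \<open>W - U\<close>; so suprema over \<open>B\<close> and then over \<open>A\<close>
  give the estimate.\<close>

lemma inner_content_diff_le:
  assumes "openin X U" "openin X W"
  shows "inner_content (W \<inter> U) + outer_content (W - U) \<le> inner_content W"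
proof -
  have *: "ennreal (c A) + inner_content (W - A) \<le> inner_content W" if A: "A \<in> \<C>" "A \<subseteq> W \<inter> U" for A
  proof -
    have "ennreal (c A) + inner_content (W - A) = (SUP B\<in>{B \<in> \<C>. B \<subseteq> W - A}. ennreal (c A) + ennreal (c B))"
      unfolding inner_content_def[of "W - A"] add.commute[of "ennreal (c A)"]
      by (rule ennreal_SUP_add_left[symmetric]) (auto intro: exI[of _ "{}"])
    also have "\<dots> \<le> inner_content W"
    proof (rule SUP_least)
      fix B assume B: "B \<in> {B \<in> \<C>. B \<subseteq> W - A}"
      then have "ennreal (c A) + ennreal (c B) = ennreal (c (A \<union> B))"
        using add[of A B] nonneg[OF A(1)] nonneg[of B] A by (subst add) (auto simp flip: ennreal_plus)
      also have "\<dots> \<le> inner_content W"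
        using A B by (intro le_inner_content) auto
      finally show "ennreal (c A) + ennreal (c B) \<le> inner_content W" .
    qed
    finally show ?thesis .
  qed
  have "inner_content (W \<inter> U) + outer_content (W - U) =
      (SUP A\<in>{A \<in> \<C>. A \<subseteq> W \<inter> U}. ennreal (c A) + outer_content (W - U))"
    unfolding inner_content_def[of "W \<inter> U"]
    by (rule ennreal_SUP_add_left[symmetric]) (auto intro: exI[of _ "{}"])
  also have "\<dots> \<le> inner_content W"
  proof (rule SUP_least)
    fix A assume A: "A \<in> {A \<in> \<C>. A \<subseteq> W \<inter> U}"
    have "outer_content (W - U) \<le> inner_content (W - A)"
      using A assms closed by (intro outer_content_le openin_diff) auto
    then show "ennreal (c A) + outer_content (W - U) \<le> inner_content W"
      using *[of A] A by (auto intro: order_trans add_left_mono)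
  qed
  finally show ?thesis .
qed

text \<open>\<open>lambda_system\<close> is the family of Caratheodory measurable sets. The
  criterion for open test sets passes to an arbitrary \<open>E\<close>, because the outer content of
  \<open>E\<close> is an infimum over open supersets of \<open>E\<close>.\<close>

lemma open_in_lambda_system:
  assumes "openin X U"
  shows "U \<in> lambda_system (topspace X) (Pow (topspace X)) outer_content"
proof -
  interpret P: algebra "topspace X" "Pow (topspace X)"
    by (rule algebra_Pow)
  have "subadditive (Pow (topspace X)) outer_content"
    using outer_measure_space_outer P.countably_subadditive_subadditive
    unfolding outer_measure_space_def by blast
  then have "outer_content E \<le> outer_content (E \<inter> U) + outer_content (E - U)" if "E \<subseteq> topspace X" for E
    using subadditiveD[of "Pow (topspace X)" outer_content "E \<inter> U" "E - U"] that
    by (auto simp: Int_Diff_Un)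
  moreover have "outer_content (E \<inter> U) + outer_content (E - U) \<le> outer_content E" for E
  proof (rule outer_content_greatest)
    fix W assume W: "openin X W" "E \<subseteq> W"
    have "outer_content (E \<inter> U) + outer_content (E - U) \<le> outer_content (W \<inter> U) + outer_content (W - U)"
      using W by (intro add_mono outer_content_mono) auto
    also have "\<dots> \<le> inner_content W"
      using inner_content_diff_le[OF assms W(1)] assms W(1) by (simp add: outer_content_open openin_Int)
    finally show "outer_content (E \<inter> U) + outer_content (E - U) \<le> inner_content W" .
  qed
  ultimately show ?thesis
    unfolding P.lambda_system_eq using openin_subset[OF assms] by (auto intro: antisym)
qed

lemma measure_space_outer: "measure_space (topspace X) (borel_sets_of X) outer_content"
proof -
  let ?L = "lambda_system (topspace X) (Pow (topspace X)) outer_content"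
  have L: "measure_space (topspace X) ?L outer_content"
    by (rule sigma_algebra.caratheodory_lemma[OF sigma_algebra_Pow outer_measure_space_outer])
  then have "borel_sets_of X \<subseteq> ?L"
    unfolding borel_sets_of_def measure_space_def using open_in_lambda_system
    by (intro sigma_algebra.sigma_sets_subset) auto
  then show ?thesis
    using L borel_sigma_algebra
    unfolding measure_space_def positive_def countably_additive_def by blast
qed

section \<open>The extension as a finite measure and its regularity\<close>

definition extension :: "'a measure" where
  "extension = measure_of (topspace X) (borel_sets_of X) outer_content"

lemma space_extension: "space extension = topspace X"
  and sets_extension: "sets extension = borel_sets_of X"
  unfolding extension_def using borel_sigma_algebra[of X]
  by (simp_all add: sigma_algebra.space_measure_of_eq sigma_algebra.sets_measure_of_eq)

lemma emeasure_extension: "B \<in> borel_sets_of X \<Longrightarrow> emeasure extension B = outer_content B"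
  using measure_space_outer borel_sigma_algebra unfolding extension_def
  by (intro emeasure_measure_of_sigma) (auto simp: measure_space_def)

lemma finite_measure_extension: "finite_measure extension"
proof
  have "topspace X \<in> borel_sets_of X" by (rule open_borel) simp
  then show "emeasure extension (space extension) \<noteq> \<infinity>"
    using outer_content_le_bound[of "topspace X"]
    by (auto simp: emeasure_extension space_extension top_unique)
qed

lemma measure_extension: "A \<in> \<C> \<Longrightarrow> measure extension A = c A"
  using emeasure_extension[of A] ring_borel outer_content_open[OF "open"] inner_content_ring nonneg
  by (auto simp: measure_def)

lemma extension_outer_regular:
  assumes "B \<in> borel_sets_of X" "e > 0"
  obtains U where "openin X U" "B \<subseteq> U" "measure extension (U - B) < e"
proof -
  interpret finite_measure extension by (rule finite_measure_extension)
  have "B \<subseteq> topspace X"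
    using assms(1) sets.sets_into_space[of B extension] by (simp add: sets_extension space_extension)
  from outer_content_approx[OF this assms(2)]
  obtain U where U: "openin X U" "B \<subseteq> U" "inner_content U < outer_content B + ennreal e"
    by metis
  have "emeasure extension U < emeasure extension B + ennreal e"
    using U open_borel[OF U(1)] assms(1) by (simp add: emeasure_extension outer_content_open)
  then have "measure extension U < measure extension B + e"
    using assms(2) by (simp add: emeasure_eq_measure ennreal_less_iff flip: ennreal_plus)
  then have "measure extension (U - B) < e"
    using finite_measure_Diff[of U B] U(2) assms(1) open_borel[OF U(1)] by (simp add: sets_extension)
  with U show ?thesis using that by blast
qed

text \<open>Inner regularity is outer regularity of a relative complement. Some \<open>A\<close> in
  the ring carries all but \<open>e / 3\<close> of the mass; an open \<open>W\<close> slightly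
  larger than \<open>A - B\<close> leaves the compact set \<open>A - W\<close> inside
  \<open>B\<close>. The three thirds pay for \<open>U - B\<close>, for the complement of
  \<open>A\<close> and for \<open>W - (A - B)\<close>, which together cover
  \<open>U - (A - W)\<close>.\<close>

lemma extension_regular:
  assumes B: "B \<in> borel_sets_of X" and e: "e > 0"
  obtains K U where "compactin X K" "closedin X K" "openin X U" "K \<subseteq> B" "B \<subseteq> U"
    "measure extension (U - K) < e"
proof -
  interpret finite_measure extension by (rule finite_measure_extension)
  have "0 < e / 3" using e by simp
  from extension_outer_regular[OF B this]
  obtain U where U: "openin X U" "B \<subseteq> U" "measure extension (U - B) < e / 3"
    by metis
  have "\<exists>A\<in>\<C>. measure extension (topspace X - A) < e / 3"
  proof (rule ccontr)
    let ?t = "measure extension (topspace X)"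
    assume contra: "\<not> ?thesis"
    have le: "c A \<le> ?t - e / 3" if "A \<in> \<C>" for A
    proof -
      have "measure extension (topspace X - A) = ?t - c A"
        using that ring_borel open_borel[of X "topspace X"] sets_into_space
        by (subst finite_measure_Diff) (auto simp: sets_extension measure_extension)
      moreover have "\<not> measure extension (topspace X - A) < e / 3"
        using contra that by blast
      ultimately show ?thesis by linarith
    qed
    have "ennreal ?t = inner_content (topspace X)"
      by (simp add: open_borel outer_content_open emeasure_extension flip: emeasure_eq_measure)
    also have "\<dots> \<le> ennreal (?t - e / 3)"
      using le by (intro inner_content_least ennreal_leI) auto
    \<comment> \<open>The empty set shows that \<open>?t - e / 3\<close> is nonnegative, so
      \<open>ennreal\<close> does not truncate it to 0.\<close>
    finally show False
      using le[of "{}"] c_empty e by simp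
  qed
  then obtain A where A: "A \<in> \<C>" "measure extension (topspace X - A) < e / 3"
    by blast
  have Ab: "A \<in> borel_sets_of X" using A ring_borel by blast
  have "A - B \<in> borel_sets_of X" "0 < e / 3"
    using sets.Diff[of A extension B] Ab B e by (simp_all add: sets_extension)
  from extension_outer_regular[OF this]
  obtain W where W: "openin X W" "A - B \<subseteq> W" "measure extension (W - (A - B)) < e / 3"
    by metis
  have Wb: "W \<in> borel_sets_of X" and Ub: "U \<in> borel_sets_of X"
    using W U open_borel by auto
  have cl: "closedin X (A - W)"
    using closed[OF A(1)] W(1) by (rule closedin_diff)
  then have "compactin X (A - W)"
    by (intro closed_compactin[OF compact[OF A(1)]]) auto
  moreover have "measure extension (U - (A - W)) < e"
  proof -
    have sets: "U \<in> sets extension" "B \<in> sets extension" "A \<in> sets extension"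
      "W \<in> sets extension" "topspace X \<in> sets extension"
      using Ub B Ab Wb open_borel[of X "topspace X"] by (auto simp: sets_extension)
    then have meas: "U - B \<in> sets extension" "topspace X - A \<in> sets extension"
      "W - (A - B) \<in> sets extension"
      "topspace X - A \<union> (W - (A - B)) \<in> sets extension"
      "U - B \<union> (topspace X - A \<union> (W - (A - B))) \<in> sets extension"
      by auto
    have "measure extension (U - (A - W)) \<le>
        measure extension ((U - B) \<union> ((topspace X - A) \<union> (W - (A - B))))"
      using openin_subset[OF U(1)] by (intro finite_measure_mono meas) auto
    also have "\<dots> \<le> measure extension (U - B) +
        measure extension ((topspace X - A) \<union> (W - (A - B)))"
      by (intro measure_Un_le meas)
    also have "measure extension ((topspace X - A) \<union> (W - (A - B))) \<le>
        measure extension (topspace X - A) + measure extension (W - (A - B))"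
      by (intro measure_Un_le meas)
    finally show ?thesis using U A W by linarith
  qed
  ultimately show ?thesis
    using U(1,2) W(2) cl by (intro that[of "A - W" U]) auto
qed

end

section \<open>Radon measures\<close>

lemma borel_into_topspace: "B \<in> borel_sets_of X \<Longrightarrow> B \<subseteq> topspace X"
  unfolding borel_sets_of_def by (erule sigma_sets_into_sp[rotated]) (auto dest: openin_subset)

lemma total_variation_topspace:
  "total_variation X \<mu> (topspace X) = Sup (variation_sums (borel_sets_of X) \<mu>)"
proof -
  have "{B \<in> borel_sets_of X. B \<subseteq> topspace X} = borel_sets_of X"
    using borel_into_topspace by blast
  then show ?thesis by (simp add: total_variation_def)
qed

lemma radon_bdd:
  assumes "\<mu> \<in> radon_measures X"
  shows "bdd_above (variation_sums {B \<in> borel_sets_of X. B \<subseteq> E} \<mu>)"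
  using assms unfolding radon_measures_def by (auto intro: variation_mono(1)[rotated])

lemma total_variation_mono:
  assumes "\<mu> \<in> radon_measures X" "E \<subseteq> F"
  shows "total_variation X \<mu> E \<le> total_variation X \<mu> F"
  unfolding total_variation_def using assms by (intro variation_mono(2) radon_bdd) auto

lemma radon_notin: "\<mu> \<in> radon_measures X \<Longrightarrow> B \<notin> borel_sets_of X \<Longrightarrow> \<mu> B = 0"
  and radon_sums: "\<mu> \<in> radon_measures X \<Longrightarrow> range A \<subseteq> borel_sets_of X \<Longrightarrow> disjoint_family A \<Longrightarrow>
    (\<lambda>n::nat. \<mu> (A n)) sums \<mu> (\<Union>n. A n)"
  by (auto simp: radon_measures_def)

lemma radon_regular:
  assumes "\<mu> \<in> radon_measures X" "B \<in> borel_sets_of X" "e > 0"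
  obtains K U where "compactin X K" "K \<in> borel_sets_of X" "openin X U" "K \<subseteq> B" "B \<subseteq> U"
    "total_variation X \<mu> (U - K) < e"
  using assms unfolding radon_measures_def by blast

lemma radon_measuresI:
  assumes "\<And>B. B \<notin> borel_sets_of X \<Longrightarrow> \<mu> B = 0"
    and "\<And>A::nat \<Rightarrow> 'a set. range A \<subseteq> borel_sets_of X \<Longrightarrow> disjoint_family A \<Longrightarrow>
        (\<lambda>n. \<mu> (A n)) sums \<mu> (\<Union>n. A n)"
    and "bdd_above (variation_sums (borel_sets_of X) \<mu>)"
    and "\<And>B e. B \<in> borel_sets_of X \<Longrightarrow> e > 0 \<Longrightarrow>
        \<exists>K U. compactin X K \<and> K \<in> borel_sets_of X \<and> openin X U \<and> K \<subseteq> B \<and> B \<subseteq> U \<and>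
          total_variation X \<mu> (U - K) < e"
  shows "\<mu> \<in> radon_measures X"
  using assms unfolding radon_measures_def by blast

text \<open>Countable additivity along the constant sequence of empty sets: a constant series
  converges only if its term is 0.\<close>

lemma radon_empty:
  assumes "\<mu> \<in> radon_measures X"
  shows "\<mu> {} = 0"
proof -
  have "(\<lambda>n::nat. \<mu> {}) sums \<mu> (\<Union>n::nat. {})"
    using open_borel[of X "{}"]
    by (intro radon_sums[OF assms]) (auto simp: disjoint_family_on_def)
  then have "summable (\<lambda>n::nat. \<mu> {})"
    by (rule sums_summable)
  then show ?thesis
    by (simp add: summable_const_iff)
qed

lemma radon_additive:
  assumes "\<mu> \<in> radon_measures X" "A \<in> borel_sets_of X" "B \<in> borel_sets_of X" "A \<inter> B = {}"
  shows "\<mu> (A \<union> B) = \<mu> A + \<mu> B"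
proof -
  have "(\<lambda>n. \<mu> (binaryset A B n)) sums \<mu> (\<Union>n. binaryset A B n)"
    using assms open_borel[of X "{}"]
    by (intro radon_sums[OF assms(1)])
       (auto simp: binaryset_def disjoint_family_on_def split: if_splits)
  then have "(\<lambda>n. \<mu> (binaryset A B n)) sums \<mu> (A \<union> B)"
    by (simp add: UN_binaryset_eq)
  moreover have "(\<lambda>n. \<mu> (binaryset A B n)) sums (\<mu> A + \<mu> B)"
    by (rule binaryset_sums) (rule radon_empty[OF assms(1)])
  ultimately show ?thesis
    by (rule sums_unique2)
qed

lemma total_variation_add_le:
  assumes "\<mu> \<in> radon_measures X" "\<nu> \<in> radon_measures X"
  shows "total_variation X (\<lambda>B. \<mu> B + \<nu> B) E \<le> total_variation X \<mu> E + total_variation X \<nu> E"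
  unfolding total_variation_def by (intro variation_add_le radon_bdd assms)

lemma total_variation_scale_le:
  assumes "\<mu> \<in> radon_measures X"
  shows "total_variation X (\<lambda>B. c * \<mu> B) E \<le> norm c * total_variation X \<mu> E"
  unfolding total_variation_def by (intro variation_scale_le radon_bdd assms)

lemma radon_add:
  assumes \<mu>: "\<mu> \<in> radon_measures X" and \<nu>: "\<nu> \<in> radon_measures X"
  shows "(\<lambda>B. \<mu> B + \<nu> B) \<in> radon_measures X"
proof (rule radon_measuresI)
  show "(\<lambda>n. \<mu> (A n) + \<nu> (A n)) sums (\<mu> (\<Union>n. A n) + \<nu> (\<Union>n. A n))"
    if "range A \<subseteq> borel_sets_of X" "disjoint_family A" for A :: "nat \<Rightarrow> 'a set"
    by (intro sums_add radon_sums[OF \<mu>] radon_sums[OF \<nu>] that)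
  show "bdd_above (variation_sums (borel_sets_of X) (\<lambda>B. \<mu> B + \<nu> B))"
    using assms by (intro variation_add_le) (auto simp: radon_measures_def)
  fix B and e :: real assume B: "B \<in> borel_sets_of X" "e > 0"
  obtain K U where K: "compactin X K" "K \<in> borel_sets_of X" "openin X U" "K \<subseteq> B" "B \<subseteq> U"
    "total_variation X \<mu> (U - K) < e / 2"
    using radon_regular[OF \<mu> B(1), of "e / 2"] B(2) by (metis half_gt_zero)
  obtain K' U' where K': "compactin X K'" "K' \<in> borel_sets_of X" "openin X U'" "K' \<subseteq> B" "B \<subseteq> U'"
    "total_variation X \<nu> (U' - K') < e / 2"
    using radon_regular[OF \<nu> B(1), of "e / 2"] B(2) by (metis half_gt_zero)
  \<comment> \<open>One pair of sets serves both measures, since this difference lies in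
    \<open>U - K\<close> as well as in \<open>U' - K'\<close>.\<close>
  have "total_variation X (\<lambda>B. \<mu> B + \<nu> B) (U \<inter> U' - (K \<union> K')) \<le>
      total_variation X \<mu> (U \<inter> U' - (K \<union> K')) + total_variation X \<nu> (U \<inter> U' - (K \<union> K'))"
    by (rule total_variation_add_le[OF assms])
  also have "\<dots> \<le> total_variation X \<mu> (U - K) + total_variation X \<nu> (U' - K')"
    by (intro add_mono total_variation_mono assms) auto
  also have "\<dots> < e" using K K' by simp
  finally have "total_variation X (\<lambda>B. \<mu> B + \<nu> B) (U \<inter> U' - (K \<union> K')) < e" .
  moreover have "K \<union> K' \<in> borel_sets_of X"
    using K K' borel_sigma_algebra by (meson algebra_iff_Un sigma_algebra_iff)
  ultimately show "\<exists>K U. compactin X K \<and> K \<in> borel_sets_of X \<and> openin X U \<and> K \<subseteq> B \<and> B \<subseteq> U \<and>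
      total_variation X (\<lambda>B. \<mu> B + \<nu> B) (U - K) < e"
    using K K' by (intro exI[of _ "K \<union> K'"] exI[of _ "U \<inter> U'"]) (auto intro: compactin_Un)
qed (simp add: radon_notin[OF \<mu>] radon_notin[OF \<nu>])

lemma radon_scale:
  assumes \<mu>: "\<mu> \<in> radon_measures X"
  shows "(\<lambda>B. c * \<mu> B) \<in> radon_measures X"
proof (rule radon_measuresI)
  show "(\<lambda>n. c * \<mu> (A n)) sums (c * \<mu> (\<Union>n. A n))"
    if "range A \<subseteq> borel_sets_of X" "disjoint_family A" for A :: "nat \<Rightarrow> 'a set"
    by (intro sums_mult radon_sums[OF \<mu>] that)
  show "bdd_above (variation_sums (borel_sets_of X) (\<lambda>B. c * \<mu> B))"
    using assms by (intro variation_scale_le) (auto simp: radon_measures_def)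
  fix B and e :: real assume B: "B \<in> borel_sets_of X" "e > 0"
  \<comment> \<open>The summand 1 covers the case \<open>c = 0\<close>.\<close>
  have "0 < e / (norm c + 1)"
    using B(2) by (intro divide_pos_pos add_nonneg_pos) auto
  from radon_regular[OF \<mu> B(1) this]
  obtain K U where K: "compactin X K" "K \<in> borel_sets_of X" "openin X U" "K \<subseteq> B" "B \<subseteq> U"
    "total_variation X \<mu> (U - K) < e / (norm c + 1)"
    by metis
  have "total_variation X (\<lambda>B. c * \<mu> B) (U - K) \<le> norm c * total_variation X \<mu> (U - K)"
    by (rule total_variation_scale_le[OF \<mu>])
  also have "\<dots> \<le> norm c * (e / (norm c + 1))"
    using K(6) by (intro mult_left_mono) auto
  also have "\<dots> < (norm c + 1) * (e / (norm c + 1))"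
    using \<open>0 < e / (norm c + 1)\<close> by (intro mult_strict_right_mono) auto
  also have "\<dots> = e"
    by (simp add: add_nonneg_eq_0_iff)
  finally show "\<exists>K U. compactin X K \<and> K \<in> borel_sets_of X \<and> openin X U \<and> K \<subseteq> B \<and> B \<subseteq> U \<and>
      total_variation X (\<lambda>B. c * \<mu> B) (U - K) < e"
    using K by blast
qed (simp add: radon_notin[OF \<mu>])

lemma radon_sum:
  assumes "finite F" "F \<noteq> {}" "\<And>i. i \<in> F \<Longrightarrow> \<mu> i \<in> radon_measures X"
  shows "(\<lambda>B. \<Sum>i\<in>F. \<mu> i B) \<in> radon_measures X"
  using assms
proof (induction F rule: finite_ne_induct)
  case (insert i F)
  then have "(\<lambda>B. \<mu> i B + (\<Sum>i\<in>F. \<mu> i B)) \<in> radon_measures X"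
    by (intro radon_add) auto
  then show ?case using insert by simp
qed simp

text \<open>The measures of disjoint sets below \<open>E\<close> sum to the measure of their union,
  so the variation of a nonnegative measure over \<open>E\<close> is at most its value at
  \<open>E\<close>, and regularity of the measure becomes regularity of the variation.\<close>

lemma radon_of_measure:
  assumes "finite_measure M" "sets M = borel_sets_of X"
    and reg: "\<And>B e. B \<in> borel_sets_of X \<Longrightarrow> e > 0 \<Longrightarrow>
        \<exists>K U. compactin X K \<and> closedin X K \<and> openin X U \<and> K \<subseteq> B \<and> B \<subseteq> U \<and> measure M (U - K) < e"
  shows "(\<lambda>B. of_real (measure M B)) \<in> (radon_measures X :: ('a set \<Rightarrow> 'k::real_normed_field) set)"
proof -
  interpret finite_measure M by fact
  let ?\<mu> = "\<lambda>B. of_real (measure M B) :: 'k"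
  have le: "(\<Sum>j<n. norm (?\<mu> (A j))) \<le> measure M E"
    if "\<And>j. j < n \<Longrightarrow> A j \<in> {B \<in> borel_sets_of X. B \<subseteq> E}" "disjoint_family_on A {..<n}"
      "E \<in> sets M" for n :: nat and A E
  proof -
    have "(\<Sum>j<n. norm (?\<mu> (A j))) = measure M (\<Union>j<n. A j)"
      using that assms(2) by (subst finite_measure_finite_Union) auto
    also have "\<dots> \<le> measure M E"
      using that by (intro finite_measure_mono) auto
    finally show ?thesis .
  qed
  show ?thesis
  proof (rule radon_measuresI)
    show "?\<mu> B = 0" if "B \<notin> borel_sets_of X" for B
      using that assms(2) by (simp add: measure_notin_sets)
    show "(\<lambda>n. ?\<mu> (A n)) sums ?\<mu> (\<Union>n. A n)"
      if "range A \<subseteq> borel_sets_of X" "disjoint_family A" for A :: "nat \<Rightarrow> 'a set"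
      using that assms(2) by (intro sums_of_real finite_measure_UNION) auto
    show "bdd_above (variation_sums (borel_sets_of X) ?\<mu>)"
      by (rule variation_le(1)[of _ _ "measure M (topspace X)"])
         (use borel_into_topspace open_borel[of X "topspace X"] assms(2) in \<open>intro le; auto\<close>)
    fix B and e :: real assume "B \<in> borel_sets_of X" "e > 0"
    then obtain K U where K: "compactin X K" "closedin X K" "openin X U" "K \<subseteq> B" "B \<subseteq> U"
        "measure M (U - K) < e"
      using reg by blast
    have "U - K \<in> sets M"
      using open_borel[OF K(3)] closed_borel[OF K(2)] by (simp flip: assms(2) add: sets.Diff)
    then have "total_variation X ?\<mu> (U - K) \<le> measure M (U - K)"
      unfolding total_variation_def by (intro variation_le(2) le) auto
    then show "\<exists>K U. compactin X K \<and> K \<in> borel_sets_of X \<and> openin X U \<and> K \<subseteq> B \<and> B \<subseteq> U \<and>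
        total_variation X ?\<mu> (U - K) < e"
      using K closed_borel by (intro exI[of _ K] exI[of _ U]) auto
  qed
qed

text \<open>Both \<open>A\<close> and \<open>D\<close> lie between \<open>K\<close> and
  \<open>U\<close>, so \<open>A - D\<close> and \<open>D - A\<close> are disjoint parts of
  \<open>U - K\<close>. A Borel set can thus be exchanged for a nearby member of a ring.\<close>

lemma radon_norm_le:
  assumes \<mu>: "\<mu> \<in> radon_measures X" and "A \<in> borel_sets_of X" "D \<in> borel_sets_of X"
    and "K \<subseteq> A" "K \<subseteq> D" "A \<subseteq> U" "D \<subseteq> U"
  shows "norm (\<mu> A) \<le> norm (\<mu> D) + total_variation X \<mu> (U - K)"
proof -
  interpret S: sigma_algebra "topspace X" "borel_sets_of X" by (rule borel_sigma_algebra)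
  have sets: "A \<inter> D \<in> borel_sets_of X" "A - D \<in> borel_sets_of X" "D - A \<in> borel_sets_of X"
    using assms by auto
  have "\<mu> ((A \<inter> D) \<union> (A - D)) = \<mu> (A \<inter> D) + \<mu> (A - D)"
    "\<mu> ((A \<inter> D) \<union> (D - A)) = \<mu> (A \<inter> D) + \<mu> (D - A)"
    by (intro radon_additive[OF \<mu>] sets; blast)+
  moreover have "(A \<inter> D) \<union> (A - D) = A" "(A \<inter> D) \<union> (D - A) = D" by blast+
  ultimately have "\<mu> A = \<mu> D + \<mu> (A - D) - \<mu> (D - A)" by simp
  then have "norm (\<mu> A) \<le> norm (\<mu> D) + (norm (\<mu> (A - D)) + norm (\<mu> (D - A)))"
    using norm_triangle_ineq4[of "\<mu> D + \<mu> (A - D)" "\<mu> (D - A)"]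
      norm_triangle_ineq[of "\<mu> D" "\<mu> (A - D)"] by simp
  also have "norm (\<mu> (A - D)) + norm (\<mu> (D - A)) =
      (\<Sum>i\<in>UNIV. norm (\<mu> (if i then A - D else D - A)))"
    by (simp add: UNIV_bool)
  also have "\<dots> \<le> total_variation X \<mu> (U - K)"
    unfolding total_variation_def using assms sets
    by (intro sum_norm_le_variation radon_bdd) (auto simp: disjoint_family_on_def)
  finally show ?thesis by simp
qed

section \<open>Radon measures and their values on the ring\<close>

context compact_open_ring
begin

text \<open>Inner regularity replaces disjoint Borel sets by disjoint compact sets, and these are
  separated by disjoint members of the ring.\<close>

lemma radon_variation_on_ring:
  assumes \<mu>: "\<mu> \<in> radon_measures X"
  shows "bdd_above (variation_sums \<C> \<mu>)"
    and "total_variation X \<mu> (topspace X) = Sup (variation_sums \<C> \<mu>)"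
proof -
  have bdd: "bdd_above (variation_sums (borel_sets_of X) \<mu>)"
    using \<mu> by (simp add: radon_measures_def)
  show bddC: "bdd_above (variation_sums \<C> \<mu>)"
    by (rule variation_mono(1)[OF ring_borel bdd])
  have *: "(\<Sum>j<n. norm (\<mu> (A j))) \<le> Sup (variation_sums \<C> \<mu>) + e"
    if A: "\<And>j. j < n \<Longrightarrow> A j \<in> borel_sets_of X" "disjoint_family_on A {..<n}" and e: "e > 0"
    for n :: nat and A and e :: real
  proof -
    \<comment> \<open>Each of the \<open>n\<close> exchanges of a Borel set for a member of the ring
      costs at most \<open>d\<close>; the 1 covers \<open>n = 0\<close>.\<close>
    define d where "d = e / (real n + 1)"
    have d: "d > 0" using e by (simp add: d_def)
    have "\<forall>j\<in>{..<n}. \<exists>P. compactin X (fst P) \<and> openin X (snd P) \<and> fst P \<subseteq> A j \<and> A j \<subseteq> snd P \<and>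
        total_variation X \<mu> (snd P - fst P) < d"
    proof
      fix j assume "j \<in> {..<n}"
      then have "A j \<in> borel_sets_of X" using A by simp
      from radon_regular[OF \<mu> this d] show "\<exists>P. compactin X (fst P) \<and> openin X (snd P) \<and>
          fst P \<subseteq> A j \<and> A j \<subseteq> snd P \<and> total_variation X \<mu> (snd P - fst P) < d"
        by (metis fst_conv snd_conv)
    qed
    from bchoice[OF this] obtain P where P: "\<forall>j\<in>{..<n}. compactin X (fst (P j)) \<and>
        openin X (snd (P j)) \<and> fst (P j) \<subseteq> A j \<and> A j \<subseteq> snd (P j) \<and>
        total_variation X \<mu> (snd (P j) - fst (P j)) < d" by blast
    define K U where "K j = fst (P j)" and "U j = snd (P j)" for j
    have K: "compactin X (K j)" "openin X (U j)" "K j \<subseteq> A j" "A j \<subseteq> U j"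
        "total_variation X \<mu> (U j - K j) < d" if "j < n" for j
      using P that by (auto simp: K_def U_def)
    have "\<forall>j\<in>{..<n}. \<exists>C. C \<in> \<C> \<and> K j \<subseteq> C \<and> C \<subseteq> U j - (\<Union>i\<in>{..<n} - {j}. K i)"
    proof
      fix j assume "j \<in> {..<n}"
      then have j: "j < n" by simp
      have "closedin X (\<Union>i\<in>{..<n} - {j}. K i)"
        using K(1) Hausdorff by (intro closedin_Union) (auto intro: compactin_imp_closedin)
      then have "openin X (U j - (\<Union>i\<in>{..<n} - {j}. K i))"
        using K(2)[OF j] by (intro openin_diff)
      moreover have "K j \<inter> K i = {}" if "i \<in> {..<n} - {j}" for i
      proof -
        have "A i \<inter> A j = {}" using A(2) that j by (auto dest: disjoint_family_onD)
        then show ?thesis using K(3)[of i] K(3)[OF j] that by auto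
      qed
      then have "K j \<subseteq> U j - (\<Union>i\<in>{..<n} - {j}. K i)"
        using K(3,4)[OF j] by blast
      ultimately show "\<exists>C. C \<in> \<C> \<and> K j \<subseteq> C \<and> C \<subseteq> U j - (\<Union>i\<in>{..<n} - {j}. K i)"
        using compact_between[OF K(1)[OF j]] by metis
    qed
    from bchoice[OF this] obtain C where
      C: "\<forall>j\<in>{..<n}. C j \<in> \<C> \<and> K j \<subseteq> C j \<and> C j \<subseteq> U j - (\<Union>i\<in>{..<n} - {j}. K i)" by blast
    \<comment> \<open>Each \<open>C i\<close> avoids every \<open>K j\<close> with \<open>j\<close>
      different from \<open>i\<close>, so cutting away the other sets makes the family disjoint
      without losing a point of \<open>K j\<close>.\<close>
    define D where "D j = C j - (\<Union>i\<in>{..<n} - {j}. C i)" for j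
    have D: "D j \<in> \<C>" "K j \<subseteq> D j" "D j \<subseteq> U j" if "j < n" for j
    proof -
      show "D j \<in> \<C>"
        unfolding D_def using C that by (intro Diff finite_UN) auto
      show "D j \<subseteq> U j" unfolding D_def using C that by blast
      have "K j \<inter> C i = {}" if "i \<in> {..<n} - {j}" for i
        using C that \<open>j < n\<close> by blast
      then show "K j \<subseteq> D j" unfolding D_def using C \<open>j < n\<close> by blast
    qed
    have "D i \<inter> D j = {}" if "i < n" "j < n" "i \<noteq> j" for i j
      using that unfolding D_def by blast
    then have disj: "disjoint_family_on D {..<n}"
      by (auto simp: disjoint_family_on_def)
    have "norm (\<mu> (A j)) \<le> norm (\<mu> (D j)) + d" if j: "j < n" for j
    proof -
      have "norm (\<mu> (A j)) \<le> norm (\<mu> (D j)) + total_variation X \<mu> (U j - K j)"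
        using D[OF j] K[OF j] A(1)[OF j] ring_borel by (intro radon_norm_le[OF \<mu>]) auto
      then show ?thesis using K(5)[OF j] by simp
    qed
    then have "(\<Sum>j<n. norm (\<mu> (A j))) \<le> (\<Sum>j<n. norm (\<mu> (D j)) + d)"
      by (intro sum_mono) auto
    also have "\<dots> = (\<Sum>j<n. norm (\<mu> (D j))) + real n * d"
      by (simp add: sum.distrib)
    also have "\<dots> \<le> Sup (variation_sums \<C> \<mu>) + e"
      using D(1) disj bddC e unfolding d_def
      by (intro add_mono sum_norm_le_variation) (auto simp: field_simps)
    finally show ?thesis .
  qed
  have "(\<Sum>j<n. norm (\<mu> (A j))) \<le> Sup (variation_sums \<C> \<mu>)"
    if "\<And>j. j < n \<Longrightarrow> A j \<in> borel_sets_of X" "disjoint_family_on A {..<n}" for n :: nat and A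
    by (rule field_le_epsilon, rule *[OF that])
  then have "Sup (variation_sums (borel_sets_of X) \<mu>) \<le> Sup (variation_sums \<C> \<mu>)"
    by (rule variation_le(2)) auto
  then show "total_variation X \<mu> (topspace X) = Sup (variation_sums \<C> \<mu>)"
    using variation_mono(2)[OF ring_borel bdd] by (simp add: total_variation_topspace)
qed

text \<open>The difference of the two measures is Radon and vanishes on the ring; its total
  variation is computed on the ring and is therefore 0.\<close>

lemma radon_eqI:
  assumes \<mu>: "\<mu> \<in> radon_measures X" and \<nu>: "\<nu> \<in> radon_measures X"
    and eq: "\<And>A. A \<in> \<C> \<Longrightarrow> \<mu> A = \<nu> A"
  shows "\<mu> = \<nu>"
proof
  fix B
  have \<delta>: "(\<lambda>B. \<mu> B + (-1) * \<nu> B) \<in> radon_measures X" (is "?\<delta> \<in> _")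
    by (intro radon_add radon_scale \<mu> \<nu>)
  have "Sup (variation_sums \<C> ?\<delta>) \<le> 0"
    by (rule variation_le(2)) (simp add: eq)
  then have "total_variation X ?\<delta> (topspace X) \<le> 0"
    by (simp only: radon_variation_on_ring(2)[OF \<delta>])
  moreover have "norm (?\<delta> B) \<le> total_variation X ?\<delta> (topspace X)" if "B \<in> borel_sets_of X"
    unfolding total_variation_topspace using \<delta> that
    by (intro norm_le_variation) (auto simp: radon_measures_def)
  ultimately have "norm (?\<delta> B) \<le> 0" if "B \<in> borel_sets_of X"
    using that by (meson order_trans)
  then show "\<mu> B = \<nu> B"
    using radon_notin[OF \<mu>, of B] radon_notin[OF \<nu>, of B]
    by (cases "B \<in> borel_sets_of X") auto
qed

lemma radon_extension_nonneg:
  assumes "bounded_content X \<C> p b"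
  obtains \<mu> :: "'a set \<Rightarrow> 'k::real_normed_field"
    where "\<mu> \<in> radon_measures X" "\<And>A. A \<in> \<C> \<Longrightarrow> \<mu> A = of_real (p A)"
proof -
  interpret P: bounded_content X \<C> p b by fact
  show ?thesis
  proof (rule that[of "\<lambda>B. of_real (measure P.extension B)"])
    show "(\<lambda>B. of_real (measure P.extension B)) \<in> (radon_measures X :: ('a set \<Rightarrow> 'k) set)"
    proof (rule radon_of_measure[OF P.finite_measure_extension P.sets_extension])
      fix B and e :: real assume "B \<in> borel_sets_of X" "e > 0"
      from P.extension_regular[OF this]
      show "\<exists>K U. compactin X K \<and> closedin X K \<and> openin X U \<and> K \<subseteq> B \<and> B \<subseteq> U \<and>
          measure P.extension (U - K) < e"
        by metis
    qed
  qed (simp add: P.measure_extension)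
qed

text \<open>Adding the variation \<open>V\<close> makes every coordinate of \<open>c\<close> nonnegative, which avoids a Jordan
  decomposition.\<close>

lemma radon_extension:
  fixes c :: "'a set \<Rightarrow> 'k::{real_normed_field, euclidean_space}"
  assumes add: "\<And>A B. A \<in> \<C> \<Longrightarrow> B \<in> \<C> \<Longrightarrow> A \<inter> B = {} \<Longrightarrow> c (A \<union> B) = c A + c B"
    and bdd: "bdd_above (variation_sums \<C> c)"
  obtains \<mu> where "\<mu> \<in> radon_measures X" "\<And>A. A \<in> \<C> \<Longrightarrow> \<mu> A = c A"
proof -
  define V where "V A = Sup (variation_sums {B \<in> \<C>. B \<subseteq> A} c)" for A
  have bdd': "bdd_above (variation_sums {B \<in> \<C>. B \<subseteq> A} c)" for A
    by (rule variation_mono(1)[OF _ bdd]) auto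
  have V_add: "V (A \<union> B) = V A + V B" if "A \<in> \<C>" "B \<in> \<C>" "A \<inter> B = {}" for A B
    unfolding V_def by (rule variation_additive[OF ring_of_sets_axioms add bdd that])
  have V_le: "V A \<le> Sup (variation_sums \<C> c)" for A
    unfolding V_def by (rule variation_mono(2)[OF _ bdd]) auto
  have c_le: "norm (c A) \<le> V A" if "A \<in> \<C>" for A
    unfolding V_def using that by (intro norm_le_variation bdd') auto
  have content: "bounded_content X \<C> (\<lambda>A. c A \<bullet> b + V A) (2 * Sup (variation_sums \<C> c))"
    if b: "norm b \<le> 1" for b
  proof
    have *: "\<bar>c A \<bullet> b\<bar> \<le> V A" if "A \<in> \<C>" for A
    proof -
      have "\<bar>c A \<bullet> b\<bar> \<le> norm (c A) * norm b" by (rule Cauchy_Schwarz_ineq2)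
      also have "\<dots> \<le> norm (c A) * 1" using b by (intro mult_left_mono) auto
      finally show ?thesis using c_le[OF that] by simp
    qed
    fix A assume A: "A \<in> \<C>"
    show "0 \<le> c A \<bullet> b + V A" using *[OF A] by linarith
    show "c A \<bullet> b + V A \<le> 2 * Sup (variation_sums \<C> c)" using *[OF A] V_le[of A] by linarith
    show "c (A \<union> B) \<bullet> b + V (A \<union> B) = c A \<bullet> b + V A + (c B \<bullet> b + V B)"
      if "B \<in> \<C>" "A \<inter> B = {}" for B
      using that A by (simp add: add V_add inner_add_left)
  qed
  have "\<exists>\<mu>. \<mu> \<in> (radon_measures X :: ('a set \<Rightarrow> 'k) set) \<and> (\<forall>A\<in>\<C>. \<mu> A = of_real (c A \<bullet> b + V A))"
    if "norm b \<le> 1" for b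
    using radon_extension_nonneg[OF content[OF that], where ?'k = 'k] by metis
  then obtain M :: "'k \<Rightarrow> 'a set \<Rightarrow> 'k" where
    M: "\<And>b. norm b \<le> 1 \<Longrightarrow> M b \<in> radon_measures X"
       "\<And>b A. norm b \<le> 1 \<Longrightarrow> A \<in> \<C> \<Longrightarrow> M b A = of_real (c A \<bullet> b + V A)"
    by metis
  show ?thesis
  \<comment> \<open>\<open>M 0\<close> extends \<open>V\<close> itself, because the inner product
    with 0 vanishes; this is why \<open>content\<close> admits every \<open>b\<close> of norm at
    most 1. Subtracting it from \<open>M b\<close> leaves the coordinate of \<open>c\<close> along
    \<open>b\<close>, and multiplying by the field element \<open>b\<close> reassembles
    \<open>c\<close> from its coordinates.\<close>
  proof (rule that[of "\<lambda>B. \<Sum>b\<in>Basis. b * M b B + (- b) * M 0 B"])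
    show "(\<lambda>B. \<Sum>b\<in>Basis. b * M b B + (- b) * M 0 B) \<in> radon_measures X"
      by (intro radon_sum radon_add radon_scale M) auto
    fix A assume A: "A \<in> \<C>"
    have "(\<Sum>b\<in>Basis. b * M b A + (- b) * M 0 A) = (\<Sum>b\<in>Basis. (c A \<bullet> b) *\<^sub>R b)"
      using A by (intro sum.cong) (auto simp: M(2) scaleR_conv_of_real algebra_simps)
    then show "(\<Sum>b\<in>Basis. b * M b A + (- b) * M 0 A) = c A"
      by (simp add: euclidean_representation)
  qed
qed

end

section \<open>Ultrafilters on \<open>\<omega>\<close>\<close>

text \<open>Finer filters are smaller, so Zorn's lemma is applied to the reversed order and a chain
  is bounded by its infimum. A minimal proper filter decides every set \<open>B\<close>: either its
  meet with \<open>principal B\<close> is improper, and it contains the complement of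
  \<open>B\<close>, or the meet is proper, hence equal to the filter.\<close>

lemma ex_ultrafilter_le:
  assumes "F \<noteq> bot"
  obtains p where "ultrafilter p" "p \<le> F"
proof -
  define A where "A = {G. G \<noteq> bot \<and> G \<le> F}"
  have "\<exists>p\<in>A. \<forall>G\<in>A. G \<le> p \<longrightarrow> G = p"
  proof (rule predicate_Zorn)
    show "partial_order_on A (relation_of (\<lambda>G H. H \<le> G) A)"
      by (rule partial_order_on_relation_ofI) auto
    fix C assume C: "C \<in> Chains (relation_of (\<lambda>G H. H \<le> G) A)"
    then have CA: "C \<subseteq> A" and chain: "\<And>G H. G \<in> C \<Longrightarrow> H \<in> C \<Longrightarrow> G \<le> H \<or> H \<le> G"
      by (auto simp: Chains_def relation_of_def)
    show "\<exists>u\<in>A. \<forall>G\<in>C. u \<le> G"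
    proof (cases "C = {}")
      case True
      then show ?thesis using assms by (auto simp: A_def)
    next
      case False
      \<comment> \<open>A nonempty chain is directed, so whatever holds eventually along its infimum
        already holds eventually along a member.\<close>
      have "\<not> eventually (\<lambda>_. False) (Inf C)"
      proof
        assume "eventually (\<lambda>_. False) (Inf C)"
        moreover have "\<exists>K\<in>C. K \<le> inf G H" if "G \<in> C" "H \<in> C" for G H
          using chain[OF that] that by (metis inf.absorb1 inf.absorb2 order_refl)
        ultimately obtain G where "G \<in> C" "eventually (\<lambda>_. False) G"
          using eventually_Inf_base[OF False] by blast
        then show False
          using CA by (auto simp: A_def trivial_limit_def)
      qed
      moreover have "Inf C \<le> F"
        using False CA by (auto simp: A_def intro: Inf_lower2)
      ultimately show ?thesis
        by (intro bexI[of _ "Inf C"]) (auto simp: A_def trivial_limit_def intro: Inf_lower)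
    qed
  qed
  then obtain p where p: "p \<noteq> bot" "p \<le> F" and max: "\<And>G. G \<noteq> bot \<Longrightarrow> G \<le> p \<Longrightarrow> G = p"
    unfolding A_def by (auto dest: order_trans)
  have "(\<forall>\<^sub>F n in p. n \<in> B) \<or> (\<forall>\<^sub>F n in p. n \<notin> B)" for B
  proof (cases "inf p (principal B) = bot")
    case True
    then show ?thesis
      unfolding trivial_limit_def eventually_inf_principal by (auto elim: eventually_mono)
  next
    case False
    then have "inf p (principal B) = p"
      by (rule max) simp
    then have "eventually (\<lambda>n. n \<in> B) p \<longleftrightarrow> eventually (\<lambda>n. n \<in> B) (inf p (principal B))"
      by simp
    then show ?thesis
      by (simp add: eventually_inf_principal)
  qed
  then show ?thesis
    using that p by (auto simp: ultrafilter_def)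
qed

lemma ultrafilter_not_mem_iff:
  assumes "ultrafilter p"
  shows "(\<forall>\<^sub>F n in p. n \<notin> A) \<longleftrightarrow> \<not> (\<forall>\<^sub>F n in p. n \<in> A)"
proof -
  have False if "\<forall>\<^sub>F n in p. n \<in> A" "\<forall>\<^sub>F n in p. n \<notin> A"
  proof -
    have "\<forall>\<^sub>F n in p. False"
      using that by eventually_elim simp
    then show False
      using assms by (simp add: ultrafilter_def trivial_limit_def)
  qed
  then show ?thesis
    using assms unfolding ultrafilter_def by blast
qed

section \<open>The Boolean algebra of the sets \<open>hat A\<close>\<close>

lemma hat_mono: "A \<subseteq> B \<Longrightarrow> hat A \<subseteq> hat B"
  by (auto simp: hat_def elim: eventually_mono)

lemma hat_Compl: "hat (- A) = hat UNIV - hat A"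
  unfolding hat_def using ultrafilter_not_mem_iff by auto

lemma hat_Diff: "hat (A - B) = hat A - hat B"
  using hat_mono[of A UNIV] unfolding Diff_eq hat_Int hat_Compl by auto

lemma hat_Un: "hat (A \<union> B) = hat A \<union> hat B"
proof -
  have "A \<union> B = - (- A \<inter> - B)" by auto
  then have "hat (A \<union> B) = hat UNIV - ((hat UNIV - hat A) \<inter> (hat UNIV - hat B))"
    by (simp only: hat_Compl hat_Int)
  then show ?thesis
    using hat_mono[of A UNIV] hat_mono[of B UNIV] by auto
qed

lemma hat_empty [simp]: "hat {} = {}"
  by (auto simp: hat_def ultrafilter_def trivial_limit_def)

lemma hat_singleton: "hat {n} = {principal {n}}"
proof (intro equalityI subsetI)
  fix p assume "p \<in> hat {n}"
  then have p: "p \<noteq> bot" "\<forall>\<^sub>F k in p. k = n"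
    by (auto simp: hat_def ultrafilter_def)
  have "eventually P p \<longleftrightarrow> P n" for P
  proof
    assume "eventually P p"
    with p(2) have "\<forall>\<^sub>F k in p. P n" by eventually_elim simp
    then show "P n" using p(1) by simp
  next
    assume "P n"
    with p(2) show "eventually P p" by (auto elim: eventually_mono)
  qed
  then show "p \<in> {principal {n}}"
    by (simp add: filter_eq_iff eventually_principal)
next
  fix p assume "p \<in> {principal {n}}"
  then show "p \<in> hat {n}"
    by (auto simp: hat_def ultrafilter_def eventually_principal principal_eq_bot_iff)
qed

lemma hat_finite: "finite A \<Longrightarrow> hat A \<subseteq> principal_points"
proof (induction A rule: finite_induct)
  case (insert n A)
  have "hat (insert n A) = hat {n} \<union> hat A"
    by (metis hat_Un insert_is_Un)
  then show ?case
    using insert by (auto simp: hat_singleton principal_points_def)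
qed simp

lemma principal_points_eq_UN_hat: "principal_points = (\<Union>n. hat {n})"
  by (auto simp: principal_points_def hat_singleton)

text \<open>An infinite set meets every cofinite set, so the cofinite filter and
  \<open>principal A\<close> have a proper meet; an ultrafilter below it contains \<open>A\<close>
  and no singleton.\<close>

lemma ex_nonprincipal_in_hat:
  assumes "infinite A"
  shows "hat A - principal_points \<noteq> {}"
proof -
  have "inf cofinite (principal A) \<noteq> bot"
    using assms by (simp add: trivial_limit_def eventually_inf_principal eventually_cofinite)
  then obtain p where p: "ultrafilter p" "p \<le> inf cofinite (principal A)"
    by (rule ex_ultrafilter_le)
  then have "p \<in> hat A"
    by (auto simp: hat_def le_principal)
  moreover have "p \<notin> hat {n}" for n
  proof -
    have "\<forall>\<^sub>F k in p. k \<notin> {n}"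
      using p(2) by (intro filter_leD[OF _, of p cofinite]) (auto simp: eventually_cofinite)
    then show ?thesis
      using p(1) ultrafilter_not_mem_iff unfolding hat_def by blast
  qed
  ultimately show ?thesis
    by (auto simp: principal_points_eq_UN_hat)
qed

section \<open>The topology of the space of ultrafilters\<close>

lemma topspace_beta_omega: "topspace beta_omega = hat UNIV"
  using hat_mono[of _ UNIV] by (auto simp: beta_omega_def)

lemma openin_beta_omega_hat: "openin beta_omega (hat A)"
  unfolding beta_omega_def by (intro topology_generated_by_Basis) auto

lemma closedin_beta_omega_hat: "closedin beta_omega (hat A)"
  using openin_beta_omega_hat[of "- A"] hat_mono[of A UNIV]
  by (simp add: closedin_def topspace_beta_omega hat_Compl)

lemma beta_omega_base:
  assumes "openin beta_omega U" "p \<in> U"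
  obtains A where "p \<in> hat A" "hat A \<subseteq> U"
proof -
  have "generate_topology_on (range hat) U"
    using assms(1) by (simp add: beta_omega_def openin_topology_generated_by_iff)
  then have "p \<in> U \<Longrightarrow> \<exists>A. p \<in> hat A \<and> hat A \<subseteq> U"
  proof induction
    case (Int U W)
    then obtain A B where "p \<in> hat A" "hat A \<subseteq> U" "p \<in> hat B" "hat B \<subseteq> W"
      by auto
    then show ?case
      by (intro exI[of _ "A \<inter> B"]) (auto simp: hat_Int)
  qed blast+
  then show ?thesis
    using assms(2) that by blast
qed

text \<open>If no finite union of basic sets refining the cover contains \<open>hat A\<close>, the complements of
  these sets generate a proper filter, and an ultrafilter below it avoids the whole cover.\<close>

lemma compactin_beta_omega_hat: "compactin beta_omega (hat A)"
  unfolding compactin_def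
proof (intro conjI allI impI)
  show "hat A \<subseteq> topspace beta_omega"
    by (simp add: topspace_beta_omega hat_mono)
  fix \<U> assume \<U>: "Ball \<U> (openin beta_omega) \<and> hat A \<subseteq> \<Union>\<U>"
  define \<B> where "\<B> = {B. \<exists>U\<in>\<U>. hat B \<subseteq> U}"
  have "\<exists>\<F>. finite \<F> \<and> \<F> \<subseteq> \<B> \<and> A \<subseteq> \<Union>\<F>"
  proof (rule ccontr)
    assume contra: "\<nexists>\<F>. finite \<F> \<and> \<F> \<subseteq> \<B> \<and> A \<subseteq> \<Union>\<F>"
    define \<G> where "\<G> = {A - \<Union>\<F> |\<F>. finite \<F> \<and> \<F> \<subseteq> \<B>}"
    have ev: "eventually P (INF G\<in>\<G>. principal G) \<longleftrightarrow> (\<exists>G\<in>\<G>. \<forall>n\<in>G. P n)" for P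
    proof (subst eventually_INF_base)
      show "\<G> \<noteq> {}" unfolding \<G>_def by blast
      show "\<exists>x\<in>\<G>. principal x \<le> inf (principal G) (principal H)" if GH: "G \<in> \<G>" "H \<in> \<G>" for G H
      proof -
        obtain \<F>1 \<F>2 where F: "G = A - \<Union>\<F>1" "finite \<F>1" "\<F>1 \<subseteq> \<B>" "H = A - \<Union>\<F>2" "finite \<F>2" "\<F>2 \<subseteq> \<B>"
          using GH unfolding \<G>_def by blast
        then have "A - \<Union>(\<F>1 \<union> \<F>2) \<in> \<G>" unfolding \<G>_def by blast
        then show ?thesis by (rule bexI[rotated]) (auto simp: F)
      qed
    qed (simp add: eventually_principal)
    have "(INF G\<in>\<G>. principal G) \<noteq> bot"
      unfolding trivial_limit_def ev using contra unfolding \<G>_def by blast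
    then obtain p where p: "ultrafilter p" "p \<le> (INF G\<in>\<G>. principal G)"
      by (rule ex_ultrafilter_le)
    have "A \<in> \<G>" unfolding \<G>_def by (rule CollectI, rule exI[of _ "{}"]) auto
    then have "\<forall>\<^sub>F n in p. n \<in> A"
      by (intro filter_leD[OF p(2)]) (auto simp: ev)
    then have "p \<in> hat A" using p(1) by (simp add: hat_def)
    then obtain U where U: "U \<in> \<U>" "p \<in> U" using \<U> by blast
    then obtain B where B: "p \<in> hat B" "hat B \<subseteq> U"
      using \<U> beta_omega_base by blast
    have "A - \<Union>{B} \<in> \<G>" using B(2) U(1) unfolding \<G>_def \<B>_def by blast
    then have "\<forall>\<^sub>F n in p. n \<notin> B"
      by (intro filter_leD[OF p(2)]) (auto simp: ev)
    then show False
      using B(1) p(1) ultrafilter_not_mem_iff by (auto simp: hat_def)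
  qed
  then obtain \<F> where F: "finite \<F>" "\<F> \<subseteq> \<B>" "A \<subseteq> \<Union>\<F>" by blast
  have "\<forall>B\<in>\<F>. \<exists>U. U \<in> \<U> \<and> hat B \<subseteq> U"
    using F(2) unfolding \<B>_def by blast
  from bchoice[OF this] obtain u where u: "\<And>B. B \<in> \<F> \<Longrightarrow> u B \<in> \<U> \<and> hat B \<subseteq> u B"
    by blast
  \<comment> \<open>Finiteness of \<open>\<F>\<close> matters here, since \<open>hat\<close>
    commutes only with finite unions; hence the subcover was selected on the level of subsets of
    \<omega>.\<close>
  have "hat (\<Union>\<F>) \<subseteq> \<Union>(u ` \<F>)"
    using F(1) u
  proof (induction \<F>)
    case (insert B \<F>)
    then show ?case by (auto simp: hat_Un)
  qed simp
  then have "hat A \<subseteq> \<Union>(u ` \<F>)"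
    using hat_mono[OF F(3)] by blast
  then show "\<exists>\<F>. finite \<F> \<and> \<F> \<subseteq> \<U> \<and> hat A \<subseteq> \<Union>\<F>"
    using F(1) u by (intro exI[of _ "u ` \<F>"]) auto
qed

lemma Hausdorff_beta_omega: "Hausdorff_space beta_omega"
  unfolding Hausdorff_space_def
proof (intro allI impI)
  fix p q assume pq: "p \<in> topspace beta_omega \<and> q \<in> topspace beta_omega \<and> p \<noteq> q"
  then have uf: "ultrafilter p" "ultrafilter q"
    by (auto simp: topspace_beta_omega hat_def)
  obtain P where P: "eventually P p \<noteq> eventually P q"
    using pq by (auto simp: filter_eq_iff)
  \<comment> \<open>A set on which the two ultrafilters disagree, replaced by its complement if
    necessary so that it belongs to \<open>p\<close>.\<close>
  define A where "A = (if eventually P p then {n. P n} else {n. \<not> P n})"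
  have "p \<in> hat A" "q \<in> hat (- A)"
    using P uf ultrafilter_not_mem_iff[of p "{n. P n}"] ultrafilter_not_mem_iff[of q "{n. P n}"]
    by (auto simp: A_def hat_def split: if_splits)
  moreover have "disjnt (hat A) (hat (- A))"
    unfolding disjnt_def hat_Int[symmetric] by simp
  ultimately show "\<exists>U V. openin beta_omega U \<and> openin beta_omega V \<and> p \<in> U \<and> q \<in> V \<and> disjnt U V"
    using openin_beta_omega_hat by blast
qed

section \<open>Radon measures on the nonprincipal part\<close>

text \<open>The trace of \<open>hat A\<close> on the remainder of the Stone-Cech compactification.
  It represents the power set of \<omega> modulo finite sets as a field of sets.\<close>

definition star :: "nat set \<Rightarrow> nat filter set" where
  "star A = hat A - principal_points"

lemma star_Un: "star (A \<union> B) = star A \<union> star B"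
  and star_Int: "star (A \<inter> B) = star A \<inter> star B"
  and star_Diff: "star (A - B) = star A - star B"
  and star_empty [simp]: "star {} = {}"
  by (auto simp: star_def hat_Un hat_Int hat_Diff)

lemma star_UN: "finite F \<Longrightarrow> star (\<Union>i\<in>F. A i) = (\<Union>i\<in>F. star (A i))"
  by (induction F rule: finite_induct) (auto simp: star_Un)

lemma star_eq_empty_iff: "star A = {} \<longleftrightarrow> finite A"
  using ex_nonprincipal_in_hat[of A] hat_finite[of A] by (auto simp: star_def)

abbreviation nonprincipal_part :: "nat set set \<Rightarrow> nat filter topology" where
  "nonprincipal_part I \<equiv> subtopology beta_omega (U_ideal I - principal_points)"

lemma ideal_closed:
  assumes "ideal_on_omega I"
  shows "A \<in> I \<Longrightarrow> B \<subseteq> A \<Longrightarrow> B \<in> I" "A \<in> I \<Longrightarrow> B \<in> I \<Longrightarrow> A \<union> B \<in> I" "finite A \<Longrightarrow> A \<in> I"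
  using assms by (auto simp: ideal_on_omega_def)

lemma ideal_ring: "ideal_on_omega I \<Longrightarrow> ring_of_sets UNIV I"
  by (rule ring_of_setsI) (auto intro: ideal_closed)

lemma topspace_nonprincipal_part:
  "topspace (nonprincipal_part I) = U_ideal I - principal_points"
  using hat_mono[of _ UNIV] by (auto simp: topspace_beta_omega U_ideal_def)

lemma compact_open_ring_star:
  assumes I: "ideal_on_omega I"
  shows "compact_open_ring (nonprincipal_part I) (star ` I)"
proof -
  have star_sub: "star A \<subseteq> U_ideal I - principal_points" if "A \<in> I" for A
    using that by (auto simp: star_def U_ideal_def)
  have "ring_of_sets (topspace (nonprincipal_part I)) (star ` I)"
    unfolding topspace_nonprincipal_part
  proof (rule ring_of_setsI)
    show "star ` I \<subseteq> Pow (U_ideal I - principal_points)" using star_sub by auto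
    show "{} \<in> star ` I" using ideal_closed(3)[OF I, of "{}"] by (force simp: image_iff)
    fix a b assume "a \<in> star ` I" "b \<in> star ` I"
    then obtain A B where AB: "A \<in> I" "B \<in> I" "a = star A" "b = star B" by auto
    have "A \<union> B \<in> I" "A - B \<in> I" using AB ideal_closed[OF I] by auto
    then show "a \<union> b \<in> star ` I" "a - b \<in> star ` I"
      unfolding AB by (auto simp flip: star_Un star_Diff)
  qed
  moreover have "compact_open_ring_axioms (nonprincipal_part I) (star ` I)"
  proof
    show "Hausdorff_space (nonprincipal_part I)"
      by (intro Hausdorff_space_subtopology Hausdorff_beta_omega)
  next
    fix a assume "a \<in> star ` I"
    then obtain A where A: "A \<in> I" "a = star A" by auto
    \<comment> \<open>Because the principal points form an open set, removing them from
      \<open>hat A\<close> leaves a closed and hence compact set.\<close>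
    have "openin beta_omega principal_points"
      unfolding principal_points_eq_UN_hat by (intro openin_Union) (auto intro: openin_beta_omega_hat)
    then have "closedin beta_omega (star A)"
      unfolding star_def by (intro closedin_diff closedin_beta_omega_hat)
    then have "compactin beta_omega (star A)"
      by (rule closed_compactin[OF compactin_beta_omega_hat, rotated]) (auto simp: star_def)
    then show "compactin (nonprincipal_part I) a"
      using star_sub A by (auto simp: compactin_subtopology)
    have "star A = hat A \<inter> (U_ideal I - principal_points)"
      using A by (auto simp: star_def U_ideal_def)
    then show "openin (nonprincipal_part I) a"
      using A openin_beta_omega_hat unfolding openin_subtopology by blast
  next
    fix U p assume "openin (nonprincipal_part I) U" "p \<in> U"
    then obtain T where T: "openin beta_omega T" "U = T \<inter> (U_ideal I - principal_points)" "p \<in> T"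
      unfolding openin_subtopology by auto
    obtain B where B: "p \<in> hat B" "hat B \<subseteq> T"
      using beta_omega_base[OF T(1,3)] by metis
    \<comment> \<open>Membership of \<open>p\<close> in \<open>U_ideal I\<close> provides a set of
      the ideal; intersecting with it brings the neighbourhood into the ring.\<close>
    obtain A where A: "A \<in> I" "p \<in> hat A"
      using \<open>p \<in> U\<close> T(2) by (auto simp: U_ideal_def)
    have "A \<inter> B \<in> I" using A ideal_closed(1)[OF I] by blast
    moreover have "p \<in> star (A \<inter> B)"
      using A B T \<open>p \<in> U\<close> by (auto simp: star_def hat_Int)
    moreover have "star (A \<inter> B) \<subseteq> U"
      using A B(2) unfolding T(2) star_def hat_Int U_ideal_def by blast
    ultimately show "\<exists>a\<in>star ` I. p \<in> a \<and> a \<subseteq> U" by blast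
  qed
  ultimately show ?thesis by (simp add: compact_open_ring_def)
qed

text \<open>A family in \<open>I\<close> whose images under \<^term>\<open>star\<close> are disjoint is only almost disjoint, but
  disjointifying it does not change the images.\<close>

lemma variation_sums_star:
  assumes I: "ideal_on_omega I" and m: "\<And>A. A \<in> I \<Longrightarrow> m A = c (star A)"
  shows "variation_sums I m = variation_sums (star ` I) c"
proof (intro equalityI subsetI)
  fix s assume "s \<in> variation_sums I m"
  then obtain n :: nat and A where A: "s = (\<Sum>j<n. norm (m (A j)))" "\<forall>j<n. A j \<in> I"
      "disjoint_family_on A {..<n}"
    unfolding variation_sums_iff by auto
  have "s = (\<Sum>j<n. norm (c (star (A j))))"
    using A m by simp
  moreover have "disjoint_family_on (\<lambda>j. star (A j)) {..<n}"
    using A(3) by (simp add: disjoint_family_on_def flip: star_Int)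
  ultimately show "s \<in> variation_sums (star ` I) c"
    using A(2) by (auto intro!: sum_norm_in_variation_sums)
next
  fix s assume "s \<in> variation_sums (star ` I) c"
  then obtain n :: nat and C where C: "s = (\<Sum>j<n. norm (c (C j)))" "\<forall>j<n. C j \<in> star ` I"
      "disjoint_family_on C {..<n}"
    unfolding variation_sums_iff by auto
  have "\<forall>j\<in>{..<n}. \<exists>A. A \<in> I \<and> C j = star A" using C(2) by auto
  from bchoice[OF this] obtain A where A: "\<And>j. j < n \<Longrightarrow> A j \<in> I" "\<And>j. j < n \<Longrightarrow> C j = star (A j)"
    by auto
  have mem: "disjointed A j \<in> I" if "j < n" for j
    using A(1)[OF that] by (rule ideal_closed(1)[OF I]) (rule disjointed_subset)
  have "star (disjointed A j) = C j" if j: "j < n" for j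
  proof -
    have "star (disjointed A j) = star (A j) - (\<Union>i\<in>{0..<j}. star (A i))"
      by (simp add: disjointed_def star_Diff star_UN)
    moreover have "star (A j) \<inter> star (A i) = {}" if "i < j" for i
      using disjoint_family_onD[OF C(3), of j i] that j A(2) by simp
    then have "star (A j) \<inter> (\<Union>i\<in>{0..<j}. star (A i)) = {}"
      by (simp add: Int_UN_distrib)
    ultimately show ?thesis using A(2)[OF j] by blast
  qed
  then have "s = (\<Sum>j<n. norm (m (disjointed A j)))"
    unfolding C(1) using m mem by (intro sum.cong) auto
  then show "s \<in> variation_sums I m"
    using mem disjoint_family_disjointed[of A]
    by (auto intro!: sum_norm_in_variation_sums intro: disjoint_family_on_mono[rotated])
qed

lemma ba_closed:
  assumes "m \<in> vecs (ba I)"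
  shows "A \<notin> I \<Longrightarrow> m A = 0" "A \<in> I \<Longrightarrow> B \<in> I \<Longrightarrow> A \<inter> B = {} \<Longrightarrow> m (A \<union> B) = m A + m B"
    "bdd_above (variation_sums I m)"
  using assms by (auto simp: ba_def)

lemma vecs_ba0: "m \<in> vecs (ba0 I) \<longleftrightarrow> m \<in> vecs (ba I) \<and> (\<forall>n. m {n} = 0)"
  by (simp add: ba0_def)

lemma ba0_simps [simp]:
  "vadd (ba0 I) m m' = (\<lambda>A. m A + m' A)" "smul (ba0 I) c m = (\<lambda>A. c * m A)"
  "vnorm (ba0 I) m = Sup (variation_sums I m)"
  by (simp_all add: ba0_def ba_def function_space_def)

lemma ba_simps [simp]:
  "vadd (ba I) m m' = (\<lambda>A. m A + m' A)" "smul (ba I) c m = (\<lambda>A. c * m A)"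
  "vnorm (ba I) m = Sup (variation_sums I m)"
  by (simp_all add: ba_def)

lemma ba_empty:
  assumes "ideal_on_omega I" "m \<in> vecs (ba I)"
  shows "m {} = 0"
  using ba_closed(2)[OF assms(2), of "{}" "{}"] ideal_closed(3)[OF assms(1), of "{}"] by simp

lemma ba_finite:
  assumes I: "ideal_on_omega I" and m: "m \<in> vecs (ba I)" and "finite F"
  shows "m F = (\<Sum>n\<in>F. m {n})"
proof -
  have "m (\<Union>n\<in>F. {n}) = (\<Sum>n\<in>F. m {n})"
  proof (rule additive_finite_UN[where S = I and m = m])
    show "ring_of_sets UNIV I" by (rule ideal_ring[OF I])
    show "m {} = 0" by (rule ba_empty[OF I m])
    show "m (A \<union> B) = m A + m B" if "A \<in> I" "B \<in> I" "A \<inter> B = {}" for A B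
      using that by (rule ba_closed(2)[OF m])
    show "{n} \<in> I" for n by (rule ideal_closed(3)[OF I]) simp
  qed (use assms(3) in \<open>auto simp: disjoint_family_on_def\<close>)
  then show ?thesis by simp
qed

text \<open>Equality under \<open>star\<close> means that \<open>A - B\<close> and
  \<open>B - A\<close> are finite, and \<open>m\<close> vanishes on finite sets because it vanishes
  on singletons. Hence \<open>m\<close> induces a well-defined function on the images.\<close>

lemma ba0_star_cong:
  assumes I: "ideal_on_omega I" and m: "m \<in> vecs (ba0 I)"
    and AB: "A \<in> I" "B \<in> I" "star A = star B"
  shows "m A = m B"
proof -
  have *: "m A = m (A \<inter> B)" if "A \<in> I" "star A \<subseteq> star B" for A B
  proof -
    have "finite (A - B)" using that by (simp add: star_Diff flip: star_eq_empty_iff)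
    then have "m (A - B) = 0"
      using ba_finite[OF I, of m "A - B"] m by (simp add: vecs_ba0)
    moreover have "m ((A \<inter> B) \<union> (A - B)) = m (A \<inter> B) + m (A - B)"
      using m that ideal_closed(1)[OF I] by (intro ba_closed(2)[of m I]) (auto simp: vecs_ba0)
    ultimately show ?thesis by (simp add: Int_Diff_Un)
  qed
  have "m A = m (A \<inter> B)" by (rule *) (use AB in auto)
  also have "A \<inter> B = B \<inter> A" by (rule Int_commute)
  also have "m (B \<inter> A) = m B" by (rule *[symmetric]) (use AB in auto)
  finally show ?thesis .
qed

text \<open>A measure is pulled back along \<open>star\<close>. Injectivity is uniqueness of Radon
  extensions, surjectivity their existence, and the isometry is the computation of the total
  variation on the ring.\<close>

theorem radon_isometric_ba0:
  assumes I: "ideal_on_omega I"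
  shows "(radon_space (nonprincipal_part I) :: ('k::{real_normed_field, euclidean_space}, _) normed_space)
    \<equiv>\<^sub>i ba0 I"
proof -
  let ?X = "nonprincipal_part I"
  interpret compact_open_ring ?X "star ` I" by (rule compact_open_ring_star[OF I])
  define T where "T = (\<lambda>(\<mu> :: nat filter set \<Rightarrow> 'k) A. if A \<in> I then \<mu> (star A) else 0)"
  have var: "variation_sums I (T \<mu>) = variation_sums (star ` I) \<mu>" for \<mu>
    by (rule variation_sums_star[OF I]) (simp add: T_def)
  have T_mem: "T \<mu> \<in> vecs (ba0 I)" if \<mu>: "\<mu> \<in> radon_measures ?X" for \<mu>
  proof -
    have "T \<mu> (A \<union> B) = T \<mu> A + T \<mu> B" if "A \<in> I" "B \<in> I" "A \<inter> B = {}" for A B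
    proof -
      have "\<mu> (star A \<union> star B) = \<mu> (star A) + \<mu> (star B)"
        using that ring_borel by (intro radon_additive[OF \<mu>]) (auto simp flip: star_Int)
      then show ?thesis
        using that ideal_closed(2)[OF I] by (simp add: T_def star_Un)
    qed
    moreover have "bdd_above (variation_sums I (T \<mu>))"
      unfolding var by (rule radon_variation_on_ring(1)[OF \<mu>])
    moreover have "star {n} = {}" for n by (simp add: star_eq_empty_iff)
    ultimately show ?thesis
      using radon_empty[OF \<mu>] unfolding vecs_ba0 by (auto simp: ba_def T_def)
  qed
  show ?thesis
  proof (rule isometrically_isomorphicI[where T = T])
    show "bij_betw T (vecs (radon_space ?X)) (vecs (ba0 I))"
      unfolding bij_betw_def
    proof
      show "inj_on T (vecs (radon_space ?X))"
      proof (rule inj_onI)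
        fix \<mu> \<nu> assume *: "\<mu> \<in> vecs (radon_space ?X)" "\<nu> \<in> vecs (radon_space ?X)" "T \<mu> = T \<nu>"
        have "\<mu> a = \<nu> a" if "a \<in> star ` I" for a
        proof -
          obtain A where "A \<in> I" "a = star A" using \<open>a \<in> star ` I\<close> by auto
          then show ?thesis using fun_cong[OF *(3), of A] by (simp add: T_def)
        qed
        with * show "\<mu> = \<nu>"
          by (intro radon_eqI) (auto simp: radon_space_def)
      qed
      show "T ` vecs (radon_space ?X) = vecs (ba0 I)"
      proof (intro equalityI subsetI)
        fix m :: "nat set \<Rightarrow> 'k" assume m: "m \<in> vecs (ba0 I)"
        \<comment> \<open>Any choice of preimage gives the same value, by
          \<open>ba0_star_cong\<close>.\<close>
        define c where "c a = m (inv_into I star a)" for a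
        have c: "m A = c (star A)" if "A \<in> I" for A
          unfolding c_def using that
          by (intro ba0_star_cong[OF I m]) (auto intro: inv_into_into simp: f_inv_into_f)
        have "c (a \<union> b) = c a + c b" if ab: "a \<in> star ` I" "b \<in> star ` I" "a \<inter> b = {}" for a b
        proof -
          obtain A B where AB: "A \<in> I" "B \<in> I" "a = star A" "b = star B" using ab by auto
          have BA: "B - A \<in> I" "A \<union> B \<in> I" using AB ideal_closed[OF I] by auto
          have "c (a \<union> b) = m (A \<union> B)" using BA by (simp add: c AB star_Un)
          \<comment> \<open>Disjoint images only force \<open>A \<inter> B\<close> to be finite.
            Removing \<open>A\<close> from \<open>B\<close> makes the sets disjoint and does not
            affect the value of \<open>m\<close>.\<close>
          also have "\<dots> = m (A \<union> (B - A))" by simp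
          also have "\<dots> = m A + m (B - A)"
            using m AB BA by (intro ba_closed(2)[of m I]) (auto simp: vecs_ba0)
          also have "m (B - A) = m B"
            using ab AB BA by (intro ba0_star_cong[OF I m]) (auto simp: star_Diff)
          finally show ?thesis using AB by (simp add: c)
        qed
        moreover have "bdd_above (variation_sums (star ` I) c)"
          using m variation_sums_star[of I m c, OF I c] ba_closed(3)[of m I] by (simp add: vecs_ba0)
        ultimately obtain \<mu> where \<mu>: "\<mu> \<in> radon_measures ?X" "\<And>a. a \<in> star ` I \<Longrightarrow> \<mu> a = c a"
          using radon_extension[of c] by metis
        have "T \<mu> = m"
          using m \<mu>(2) c ba_closed(1)[of m I] by (auto simp: T_def vecs_ba0 fun_eq_iff)
        then show "m \<in> T ` vecs (radon_space ?X)"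
          using \<mu>(1) by (auto simp: radon_space_def)
      qed (use T_mem in \<open>auto simp: radon_space_def\<close>)
    qed
    show "vnorm (ba0 I) (T \<mu>) = vnorm (radon_space ?X) \<mu>" if "\<mu> \<in> vecs (radon_space ?X)" for \<mu>
      using that radon_variation_on_ring(2)[of \<mu>] by (simp add: radon_space_def var)
  qed (auto simp: radon_space_def T_def fun_eq_iff)
qed

section \<open>Radon measures on \<open>\<omega>\<close>\<close>

lemma closed_under_operations_radon: "closed_under_operations (radon_space X)"
  by (simp add: closed_under_operations_def radon_space_def radon_add radon_scale)

lemma compact_open_ring_finite:
  "compact_open_ring (discrete_topology UNIV) {F :: 'a set. finite F}"
proof -
  have "ring_of_sets (topspace (discrete_topology UNIV)) {F :: 'a set. finite F}"
    by (rule ring_of_setsI) auto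
  moreover have "compact_open_ring_axioms (discrete_topology UNIV) {F :: 'a set. finite F}"
  proof
    show "\<exists>A\<in>{F. finite F}. x \<in> A \<and> A \<subseteq> U" if "x \<in> U" for x :: 'a and U
      using that by (intro bexI[of _ "{x}"]) auto
  qed (auto simp: finite_imp_compactin)
  ultimately show ?thesis by (simp add: compact_open_ring_def)
qed

lemma variation_of_sum_le:
  fixes x :: "nat \<Rightarrow> 'k::real_normed_field"
  assumes "summable (\<lambda>n. norm (x n))"
  shows "bdd_above (variation_sums {F. finite F} (sum x))"
    and "Sup (variation_sums {F. finite F} (sum x)) \<le> (\<Sum>n. norm (x n))"
proof -
  have "(\<Sum>j<n. norm (sum x (A j))) \<le> (\<Sum>n. norm (x n))"
    if A: "\<And>j. j < n \<Longrightarrow> A j \<in> {F. finite F}" "disjoint_family_on A {..<n}" for n :: nat and A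
  proof -
    have "(\<Sum>j<n. norm (sum x (A j))) \<le> (\<Sum>j<n. \<Sum>i\<in>A j. norm (x i))"
      by (intro sum_mono norm_sum)
    also have "\<dots> = (\<Sum>i\<in>(\<Union>j<n. A j). norm (x i))"
      using A by (intro sum.UNION_disjoint[symmetric]) (auto dest: disjoint_family_onD)
    also have "\<dots> \<le> (\<Sum>n. norm (x n))"
      using A by (intro sum_le_suminf assms) auto
    finally show ?thesis .
  qed
  then show "bdd_above (variation_sums {F. finite F} (sum x))"
    "Sup (variation_sums {F. finite F} (sum x)) \<le> (\<Sum>n. norm (x n))"
    by (rule variation_le; blast)+
qed

text \<open>The singletons below \<open>N\<close> are an admissible disjoint family, for every
  \<open>N\<close>.\<close>

lemma variation_of_sum_ge:
  fixes m :: "nat set \<Rightarrow> 'k::real_normed_field"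
  assumes "bdd_above (variation_sums S m)" "\<And>n. {n} \<in> S"
  shows "summable (\<lambda>n. norm (m {n}))" and "(\<Sum>n. norm (m {n})) \<le> Sup (variation_sums S m)"
proof -
  have *: "(\<Sum>n<N. norm (m {n})) \<le> Sup (variation_sums S m)" for N
    using assms by (intro sum_norm_le_variation) (auto simp: disjoint_family_on_def)
  show "summable (\<lambda>n. norm (m {n}))"
    by (rule summableI_nonneg_bounded[OF _ *]) auto
  then show "(\<Sum>n. norm (m {n})) \<le> Sup (variation_sums S m)"
    by (rule suminf_le_const) (rule *)
qed


text \<open>On finite sets a measure is the sum of its point masses, and singletons exhaust the
  variation on the ring of finite sets; so the total variation is the sum of the moduli of the point
  masses.\<close>

theorem radon_isometric_ell1:
  "(radon_space (discrete_topology UNIV) :: ('k::{real_normed_field, euclidean_space}, nat set \<Rightarrow> 'k) normed_space)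
    \<equiv>\<^sub>i ell1"
proof -
  let ?X = "discrete_topology (UNIV :: nat set)"
  interpret compact_open_ring ?X "{F. finite F}" by (rule compact_open_ring_finite)
  define T where "T = (\<lambda>(\<mu> :: nat set \<Rightarrow> 'k) n. \<mu> {n})"
  have fin: "\<mu> F = sum (T \<mu>) F" if "\<mu> \<in> radon_measures ?X" "finite F" for \<mu> F
  proof -
    have "\<mu> (\<Union>n\<in>F. {n}) = (\<Sum>n\<in>F. \<mu> {n})"
      by (rule additive_finite_UN[where m = \<mu>, OF ring_of_sets_axioms radon_empty[OF that(1)]])
         (use that ring_borel in \<open>auto simp: disjoint_family_on_def intro: radon_additive\<close>)
    then show ?thesis by (simp add: T_def)
  qed
  have var: "variation_sums {F. finite F} \<mu> = variation_sums {F. finite F} (sum (T \<mu>))"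
    if "\<mu> \<in> radon_measures ?X" for \<mu>
    by (rule variation_sums_cong) (simp add: fin[OF that])
  have summ: "summable (\<lambda>n. norm (T \<mu> n))" "total_variation ?X \<mu> UNIV = (\<Sum>n. norm (T \<mu> n))"
    if \<mu>: "\<mu> \<in> radon_measures ?X" for \<mu>
  proof -
    show s: "summable (\<lambda>n. norm (T \<mu> n))"
      using variation_of_sum_ge(1)[OF radon_variation_on_ring(1)[OF \<mu>]] by (simp add: T_def)
    show "total_variation ?X \<mu> UNIV = (\<Sum>n. norm (T \<mu> n))"
      using variation_of_sum_ge(2)[OF radon_variation_on_ring(1)[OF \<mu>]] variation_of_sum_le(2)[OF s]
        radon_variation_on_ring(2)[OF \<mu>] var[OF \<mu>] by (simp add: T_def)
  qed
  show ?thesis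
  proof (rule isometrically_isomorphicI[where T = T])
    show "bij_betw T (vecs (radon_space ?X)) (vecs ell1)"
      unfolding bij_betw_def
    proof
      show "inj_on T (vecs (radon_space ?X))"
        by (rule inj_onI, rule radon_eqI) (auto simp: radon_space_def fin)
      show "T ` vecs (radon_space ?X) = vecs ell1"
      proof (intro equalityI subsetI)
        fix x :: "nat \<Rightarrow> 'k" assume "x \<in> vecs ell1"
        then have x: "summable (\<lambda>n. norm (x n))" by (simp add: ell1_def)
        obtain \<mu> where \<mu>: "\<mu> \<in> radon_measures ?X" "\<And>F. F \<in> {F. finite F} \<Longrightarrow> \<mu> F = sum x F"
          using radon_extension[OF _ variation_of_sum_le(1)[OF x]] sum.union_disjoint by blast
        then have "T \<mu> = x" by (auto simp: T_def fun_eq_iff)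
        then show "x \<in> T ` vecs (radon_space ?X)" using \<mu>(1) by (auto simp: radon_space_def)
      qed (use summ(1) in \<open>auto simp: radon_space_def ell1_def\<close>)
    qed
  qed (auto simp: radon_space_def ell1_def summ(2), simp_all add: T_def)
qed

section \<open>Splitting off the atomic part\<close>

lemma ell1_simps [simp]:
  "x \<in> vecs ell1 \<longleftrightarrow> summable (\<lambda>n. norm (x n))"
  "vadd ell1 x y = (\<lambda>n. x n + y n)" "smul ell1 c x = (\<lambda>n. c * x n)"
  "vnorm ell1 x = (\<Sum>n. norm (x n))"
  by (simp_all add: ell1_def)

lemma summable_on_of_summable_norm:
  fixes x :: "nat \<Rightarrow> 'b::banach"
  assumes "summable (\<lambda>n. norm (x n))"
  shows "x abs_summable_on A" "x summable_on A"
proof -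
  have "(\<lambda>n. norm (x n)) summable_on UNIV"
    using assms by (subst summable_on_UNIV_nonneg_real_iff) auto
  then show "x abs_summable_on A"
    by (rule summable_on_subset) simp
  then show "x summable_on A"
    by (rule abs_summable_summable)
qed

lemma infsum_UNIV_eq_suminf:
  fixes x :: "nat \<Rightarrow> 'b::banach"
  assumes "summable (\<lambda>n. norm (x n))"
  shows "infsum x UNIV = suminf x"
  using has_sum_imp_sums[OF has_sum_infsum[OF summable_on_of_summable_norm(2)[OF assms]]]
  by (simp add: sums_unique)

lemma infsum_additive:
  fixes x :: "nat \<Rightarrow> 'b::banach"
  assumes "summable (\<lambda>n. norm (x n))" "A \<inter> B = {}"
  shows "infsum x (A \<union> B) = infsum x A + infsum x B"
  by (intro infsum_Un_disjoint summable_on_of_summable_norm assms)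

text \<open>The unordered sum of norms is itself additive over disjoint sets and monotone, and it
  dominates the norm of the sum on each piece.\<close>

lemma sum_norm_infsum_le:
  fixes x :: "nat \<Rightarrow> 'b::banach"
  assumes x: "summable (\<lambda>n. norm (x n))"
    and "finite F" "disjoint_family_on A F" "\<And>i. i \<in> F \<Longrightarrow> A i \<subseteq> E"
  shows "(\<Sum>i\<in>F. norm (infsum x (A i))) \<le> infsum (\<lambda>n. norm (x n)) E"
proof -
  let ?N = "infsum (\<lambda>n. norm (x n))"
  have N: "summable (\<lambda>n. norm (norm (x n)))" using x by simp
  have "ring_of_sets (UNIV :: nat set) UNIV"
    by (rule ring_of_setsI) auto
  then have "?N (\<Union>i\<in>F. A i) = (\<Sum>i\<in>F. ?N (A i))"
    by (rule additive_finite_UN[where S = UNIV and m = ?N])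
       (use assms infsum_additive[OF N] in auto)
  moreover have "?N (\<Union>i\<in>F. A i) \<le> ?N E"
    using assms(4) by (intro infsum_mono2 summable_on_of_summable_norm(1) x) auto
  moreover have "(\<Sum>i\<in>F. norm (infsum x (A i))) \<le> (\<Sum>i\<in>F. ?N (A i))"
    by (intro sum_mono norm_infsum_bound summable_on_of_summable_norm x)
  ultimately show ?thesis by simp
qed

text \<open>The purely atomic set function with point masses \<open>x\<close>. Members of
  \<open>I\<close> may be infinite, so the sum over them is the unordered \<open>infsum\<close>,
  which absolute summability makes additive in \<open>A\<close>.\<close>

definition atomic :: "nat set set \<Rightarrow> (nat \<Rightarrow> 'k::{real_normed_field, banach}) \<Rightarrow> nat set \<Rightarrow> 'k" where
  "atomic I x = (\<lambda>A. if A \<in> I then infsum x A else 0)"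

lemma atomic_singleton: "ideal_on_omega I \<Longrightarrow> atomic I x {n} = x n"
  using ideal_closed(3)[of I "{n}"] by (simp add: atomic_def)

lemma variation_atomic:
  assumes x: "summable (\<lambda>n. norm (x n))"
  shows "bdd_above (variation_sums I (atomic I x))"
    and "Sup (variation_sums I (atomic I x)) \<le> (\<Sum>n. norm (x n))"
proof -
  have "(\<Sum>j<n. norm (atomic I x (A j))) \<le> (\<Sum>n. norm (x n))"
    if "\<And>j. j < n \<Longrightarrow> A j \<in> I" "disjoint_family_on A {..<n}" for n :: nat and A
  proof -
    have "(\<Sum>j<n. norm (atomic I x (A j))) = (\<Sum>j<n. norm (infsum x (A j)))"
      using that by (intro sum.cong) (auto simp: atomic_def)
    also have "\<dots> \<le> infsum (\<lambda>n. norm (x n)) UNIV"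
      using that by (intro sum_norm_infsum_le x) auto
    finally show ?thesis using x by (simp add: infsum_UNIV_eq_suminf)
  qed
  then show "bdd_above (variation_sums I (atomic I x))"
    "Sup (variation_sums I (atomic I x)) \<le> (\<Sum>n. norm (x n))"
    by (rule variation_le; blast)+
qed

text \<open>The lower bound tests the sum on the atoms \<open>{n}\<close> with \<open>n < N\<close>, which carry almost all of the
  norm of \<open>x\<close>, together with sets from which \<open>{..<N}\<close> has been removed: this does not change
  \<open>m\<close>, and leaves only the tail of \<open>x\<close>.\<close>

lemma variation_add_atomic:
  fixes x :: "nat \<Rightarrow> 'k::{real_normed_field, banach}"
  assumes I: "ideal_on_omega I" and x: "summable (\<lambda>n. norm (x n))" and m: "m \<in> vecs (ba0 I)"
  shows "bdd_above (variation_sums I (\<lambda>A. atomic I x A + m A))"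
    and "Sup (variation_sums I (\<lambda>A. atomic I x A + m A)) =
           (\<Sum>n. norm (x n)) + Sup (variation_sums I m)"
proof -
  have m': "m \<in> vecs (ba I)" "\<And>n. m {n} = 0" using m by (auto simp: vecs_ba0)
  show bdd: "bdd_above (variation_sums I (\<lambda>A. atomic I x A + m A))"
    by (intro variation_add_le variation_atomic x ba_closed(3)[OF m'(1)])
  have "(\<Sum>n. norm (x n)) + Sup (variation_sums I m) \<le>
      Sup (variation_sums I (\<lambda>A. atomic I x A + m A)) + e" if "e > 0" for e
  proof -
    let ?N = "infsum (\<lambda>n. norm (x n))"
    \<comment> \<open>Three errors: the truncation of \<open>x\<close> at \<open>N\<close>, the
      choice of a nearly optimal family for \<open>m\<close>, and the mass of the tail of
      \<open>x\<close> on the sets \<open>B j\<close>.\<close>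
    define d where "d = e / 3"
    have d: "d > 0" using that by (simp add: d_def)
    have "(\<lambda>N. \<Sum>n<N. norm (x n)) \<longlonglongrightarrow> (\<Sum>n. norm (x n))"
      using x by (rule summable_LIMSEQ)
    then have "\<forall>\<^sub>F N in sequentially. (\<Sum>n. norm (x n)) - d < (\<Sum>n<N. norm (x n))"
      using d by (intro order_tendstoD(1)[of _ "\<Sum>n. norm (x n)"]) auto
    then obtain N where N: "(\<Sum>n. norm (x n)) - d < (\<Sum>n<N. norm (x n))"
      by (auto simp: eventually_sequentially)
    have "?N ({..<N} \<union> - {..<N}) = ?N {..<N} + ?N (- {..<N})"
      using x by (intro infsum_additive) auto
    then have tail: "?N (- {..<N}) < d"
      using N x by (simp add: Compl_partition infsum_UNIV_eq_suminf del: Compl_lessThan)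
    obtain k A where A: "\<And>j. j < k \<Longrightarrow> A j \<in> I" "disjoint_family_on A {..<k::nat}"
        "(\<Sum>j<k. norm (m (A j))) > Sup (variation_sums I m) - d"
      using variation_approx[OF ba_closed(3)[OF m'(1)] d] by blast
    define B where "B j = A j - {..<N}" for j
    have B: "B j \<in> I" "m (B j) = m (A j)" if "j < k" for j
    proof -
      show BI: "B j \<in> I" using A(1)[OF that] unfolding B_def by (rule ideal_closed(1)[OF I]) auto
      have "A j \<inter> {..<N} \<in> I" by (rule ideal_closed(3)[OF I]) auto
      then have "m (B j \<union> (A j \<inter> {..<N})) = m (B j) + m (A j \<inter> {..<N})"
        using BI by (intro ba_closed(2)[OF m'(1)]) (auto simp: B_def)
      moreover have "B j \<union> (A j \<inter> {..<N}) = A j" by (auto simp: B_def)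
      moreover have "m (A j \<inter> {..<N}) = 0"
        using ba_finite[OF I m'(1), of "A j \<inter> {..<N}"] m'(2) by simp
      ultimately show "m (B j) = m (A j)" by simp
    qed
    have disjB: "disjoint_family_on B {..<k}"
      using A(2) unfolding disjoint_family_on_def B_def by blast
    let ?m = "\<lambda>A. atomic I x A + m A"
    have "(\<Sum>n<N. norm (x n)) + (\<Sum>j<k. norm (?m (B j))) =
        (\<Sum>i\<in>{..<N} <+> {..<k}. norm (?m (case_sum (\<lambda>n. {n}) B i)))"
      using m'(2) by (simp add: sum.Plus atomic_singleton[OF I])
    also have "\<dots> \<le> Sup (variation_sums I ?m)"
    proof (rule sum_norm_le_variation[OF bdd])
      show "case_sum (\<lambda>n. {n}) B i \<in> I" if "i \<in> {..<N} <+> {..<k}" for i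
        using that B(1) ideal_closed(3)[OF I] by (auto simp: Plus_def)
      show "disjoint_family_on (case_sum (\<lambda>n. {n}) B) ({..<N} <+> {..<k})"
        using disjB by (intro disjoint_family_on_case_sum) (auto simp: disjoint_family_on_def B_def)
    qed simp
    finally have *: "(\<Sum>n<N. norm (x n)) + (\<Sum>j<k. norm (?m (B j))) \<le> Sup (variation_sums I ?m)" .
    have "(\<Sum>j<k. norm (m (A j))) \<le> (\<Sum>j<k. norm (?m (B j)) + norm (infsum x (B j)))"
    proof (rule sum_mono)
      fix j assume "j \<in> {..<k}"
      then have "m (A j) = ?m (B j) - infsum x (B j)"
        using B[of j] by (simp add: atomic_def)
      then show "norm (m (A j)) \<le> norm (?m (B j)) + norm (infsum x (B j))"
        by (metis norm_triangle_ineq4)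
    qed
    also have "\<dots> = (\<Sum>j<k. norm (?m (B j))) + (\<Sum>j<k. norm (infsum x (B j)))"
      by (rule sum.distrib)
    also have "(\<Sum>j<k. norm (infsum x (B j))) \<le> ?N (- {..<N})"
    proof (intro sum_norm_infsum_le x disjB)
      show "B j \<subseteq> - {..<N}" for j by (auto simp: B_def)
    qed simp
    finally show ?thesis
      using * tail N A(3) by (simp add: d_def)
  qed
  then have "(\<Sum>n. norm (x n)) + Sup (variation_sums I m) \<le>
      Sup (variation_sums I (\<lambda>A. atomic I x A + m A))"
    by (rule field_le_epsilon)
  moreover have "Sup (variation_sums I (\<lambda>A. atomic I x A + m A)) \<le>
      (\<Sum>n. norm (x n)) + Sup (variation_sums I m)"
    using variation_add_le(2)[OF variation_atomic(1)[OF x] ba_closed(3)[OF m'(1)]]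
      variation_atomic(2)[OF x, of I] by simp
  ultimately show "Sup (variation_sums I (\<lambda>A. atomic I x A + m A)) =
      (\<Sum>n. norm (x n)) + Sup (variation_sums I m)"
    by simp
qed

lemma atomic_in_ba:
  assumes I: "ideal_on_omega I" and x: "summable (\<lambda>n. norm (x n))"
  shows "atomic I x \<in> vecs (ba I)"
  using variation_atomic(1)[OF x] infsum_additive[OF x] ideal_closed(2)[OF I]
  by (simp add: ba_def atomic_def)

lemma closed_under_operations_ba0: "closed_under_operations (ba0 I)"
  unfolding closed_under_operations_def
  by (auto simp: ba0_def ba_def distrib_left intro!: variation_add_le(1) variation_scale_le(1))

lemma closed_under_operations_ell1:
  "closed_under_operations (ell1 :: ('k::real_normed_field, nat \<Rightarrow> 'k) normed_space)"
proof -
  have "summable (\<lambda>n. norm (x n + y n))"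
    if "summable (\<lambda>n. norm (x n))" "summable (\<lambda>n. norm (y n))" for x y :: "nat \<Rightarrow> 'k"
    by (rule summable_comparison_test'[OF summable_add[OF that]]) (simp add: norm_triangle_ineq)
  then show ?thesis
    by (simp add: closed_under_operations_def norm_mult summable_mult)
qed

theorem ell1_ba0_isometric_ba:
  assumes I: "ideal_on_omega I"
  shows "(ell1 :: ('k::{real_normed_field, banach}, _) normed_space) \<oplus>\<^sub>1 ba0 I \<equiv>\<^sub>i ba I"
proof (rule isometrically_isomorphicI[where T = "\<lambda>(x, m) A. atomic I x A + m A"])
  let ?T = "\<lambda>(x :: nat \<Rightarrow> 'k, m) A. atomic I x A + m A"
  note atom = atomic_singleton[OF I]
  show "bij_betw ?T (vecs (ell1 \<oplus>\<^sub>1 ba0 I)) (vecs (ba I))"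
  proof (rule bij_betwI[where g = "\<lambda>m. (\<lambda>n. m {n}, \<lambda>A. m A - atomic I (\<lambda>n. m {n}) A)"])
    show "?T \<in> vecs (ell1 \<oplus>\<^sub>1 ba0 I) \<rightarrow> vecs (ba I)"
    proof
      fix p :: "(nat \<Rightarrow> 'k) \<times> (nat set \<Rightarrow> 'k)" assume "p \<in> vecs (ell1 \<oplus>\<^sub>1 ba0 I)"
      then obtain x m where p: "p = (x, m)" "summable (\<lambda>n. norm (x n))" "m \<in> vecs (ba0 I)"
        by (cases p) auto
      have m: "m \<in> vecs (ba I)" using p(3) by (simp add: vecs_ba0)
      note a = atomic_in_ba[OF I p(2)]
      have "atomic I x (A \<union> B) + m (A \<union> B) = (atomic I x A + m A) + (atomic I x B + m B)"
        if "A \<in> I" "B \<in> I" "A \<inter> B = {}" for A B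
        using ba_closed(2)[OF m that] ba_closed(2)[OF a that] by simp
      then show "?T p \<in> vecs (ba I)"
        using ba_closed(1)[OF m] ba_closed(1)[OF a] variation_add_atomic(1)[OF I p(2,3)]
        by (simp add: ba_def p(1))
    qed
    \<comment> \<open>Distinct singletons are disjoint members of \<open>I\<close>, so the variation
      of \<open>m\<close> bounds every partial sum and the atomic part of \<open>m\<close>
      exists.\<close>
    have summ: "summable (\<lambda>n. norm (m {n}))" if "m \<in> vecs (ba I)" for m :: "nat set \<Rightarrow> 'k"
      using ba_closed(3)[OF that] ideal_closed(3)[OF I] by (intro variation_of_sum_ge(1)[of I]) auto
    show "(\<lambda>m :: nat set \<Rightarrow> 'k. (\<lambda>n. m {n}, \<lambda>A. m A - atomic I (\<lambda>n. m {n}) A)) \<in> vecs (ba I) \<rightarrow> vecs (ell1 \<oplus>\<^sub>1 ba0 I)"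
    proof
      fix m :: "nat set \<Rightarrow> 'k" assume m: "m \<in> vecs (ba I)"
      let ?x = "\<lambda>n. m {n}"
      note a = atomic_in_ba[OF I summ[OF m]]
      have "m (A \<union> B) - atomic I ?x (A \<union> B) = (m A - atomic I ?x A) + (m B - atomic I ?x B)"
        if "A \<in> I" "B \<in> I" "A \<inter> B = {}" for A B
        using ba_closed(2)[OF m that] ba_closed(2)[OF a that] by simp
      moreover have "bdd_above (variation_sums I (\<lambda>A. m A + (- 1) * atomic I ?x A))"
        by (intro variation_add_le(1) variation_scale_le(1) ba_closed(3)[OF m] ba_closed(3)[OF a])
      ultimately have "(\<lambda>A. m A - atomic I ?x A) \<in> vecs (ba0 I)"
        using ba_closed(1)[OF m] ba_closed(1)[OF a] by (simp add: vecs_ba0 atom) (simp add: ba_def)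
      then show "(?x, \<lambda>A. m A - atomic I ?x A) \<in> vecs (ell1 \<oplus>\<^sub>1 ba0 I)"
        using summ[OF m] by simp
    qed
  qed (auto simp: atom vecs_ba0)
  show "?T (vadd (ell1 \<oplus>\<^sub>1 ba0 I) p q) = vadd (ba I) (?T p) (?T q)"
    if "p \<in> vecs (ell1 \<oplus>\<^sub>1 ba0 I)" "q \<in> vecs (ell1 \<oplus>\<^sub>1 ba0 I)" for p q
    using that by (cases p; cases q) (auto simp: atomic_def infsum_add summable_on_of_summable_norm fun_eq_iff)
  show "?T (smul (ell1 \<oplus>\<^sub>1 ba0 I) c p) = smul (ba I) c (?T p)"
    if "p \<in> vecs (ell1 \<oplus>\<^sub>1 ba0 I)" for c p
    by (cases p) (auto simp: atomic_def infsum_cmult_right' fun_eq_iff distrib_left)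
  show "vnorm (ba I) (?T p) = vnorm (ell1 \<oplus>\<^sub>1 ba0 I) p" if "p \<in> vecs (ell1 \<oplus>\<^sub>1 ba0 I)" for p
    using that variation_add_atomic(2)[OF I] by (cases p) auto
qed

section \<open>The dual of \<open>c\<^sub>0\<close>\<close>

lemma c0_ideal_simps [simp]:
  "vadd (c0_ideal I) x y = (\<lambda>n. x n + y n)" "smul (c0_ideal I) c x = (\<lambda>n. c * x n)"
  "vnorm (c0_ideal I) x = (SUP n. norm (x n))"
  by (simp_all add: c0_ideal_def ell_infty_def function_space_def)

lemma vecs_c0_ideal:
  "x \<in> vecs (c0_ideal I) \<longleftrightarrow> bounded (range x) \<and> (\<forall>e>0. {n. e \<le> norm (x n)} \<in> I)"
  by (simp add: c0_ideal_def ell_infty_def)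

lemma c0_ideal_add:
  assumes I: "ideal_on_omega I" and xy: "x \<in> vecs (c0_ideal I)" "y \<in> vecs (c0_ideal I)"
  shows "(\<lambda>n. x n + y n) \<in> vecs (c0_ideal I)"
proof -
  have "{n. e \<le> norm (x n + y n)} \<in> I" if "e > 0" for e
  proof (rule ideal_closed(1)[OF I])
    show "{n. e / 2 \<le> norm (x n)} \<union> {n. e / 2 \<le> norm (y n)} \<in> I"
      using xy half_gt_zero[OF that] by (intro ideal_closed(2)[OF I]) (simp_all add: vecs_c0_ideal del: half_gt_zero_iff divide_le_eq_numeral1)
    show "{n. e \<le> norm (x n + y n)} \<subseteq> {n. e / 2 \<le> norm (x n)} \<union> {n. e / 2 \<le> norm (y n)}"
    proof
      fix n assume "n \<in> {n. e \<le> norm (x n + y n)}"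
      then have "e \<le> norm (x n) + norm (y n)"
        using norm_triangle_ineq[of "x n" "y n"] by simp
      then show "n \<in> {n. e / 2 \<le> norm (x n)} \<union> {n. e / 2 \<le> norm (y n)}" by auto
    qed
  qed
  then show ?thesis
    using xy by (simp add: vecs_c0_ideal bounded_plus_comp)
qed

lemma c0_ideal_scale:
  assumes I: "ideal_on_omega I" and x: "x \<in> vecs (c0_ideal I)"
  shows "(\<lambda>n. c * x n) \<in> vecs (c0_ideal I)"
proof (cases "c = 0")
  case True
  then show ?thesis
    using ideal_closed(3)[OF I, of "{}"] by (auto simp: vecs_c0_ideal)
next
  case False
  have "{n. e \<le> norm (c * x n)} = {n. e / norm c \<le> norm (x n)}" for e
    using False by (auto simp: norm_mult field_simps)
  moreover obtain B where "\<And>n. norm (x n) \<le> B"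
    using x by (auto simp: vecs_c0_ideal bounded_iff)
  then have "norm (c * x n) \<le> norm c * B" for n
    by (simp add: norm_mult mult_left_mono)
  then have "bounded (range (\<lambda>n. c * x n))"
    by (auto simp: bounded_iff)
  ultimately show ?thesis
    using x False by (simp add: vecs_c0_ideal)
qed

lemma norm_le_vnorm_c0_ideal:
  assumes "x \<in> vecs (c0_ideal I)"
  shows "norm (x n) \<le> vnorm (c0_ideal I) x"
  using assms by (auto simp: vecs_c0_ideal bounded_iff intro!: cSUP_upper bdd_aboveI2)

section \<open>Step sequences: the linear span of the indicators of members of the ideal\<close>

definition step_sequence :: "nat set set \<Rightarrow> (nat \<Rightarrow> 'k::zero) \<Rightarrow> bool" where
  "step_sequence I s \<longleftrightarrow> finite (range s) \<and> {n. s n \<noteq> 0} \<in> I"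

lemma step_in_c0_ideal:
  assumes "ideal_on_omega I" "step_sequence I s"
  shows "s \<in> vecs (c0_ideal I)"
proof -
  have "{n. e \<le> norm (s n)} \<in> I" if "e > 0" for e
  proof (rule ideal_closed(1)[OF assms(1)])
    show "{n. s n \<noteq> 0} \<in> I" using assms(2) by (simp add: step_sequence_def)
  qed (use that in auto)
  moreover have "bounded (range s)"
    using assms(2) by (intro finite_imp_bounded) (simp add: step_sequence_def)
  ultimately show ?thesis by (simp add: vecs_c0_ideal)
qed

lemma step_combine:
  assumes I: "ideal_on_omega I" and "step_sequence I s" "step_sequence I t" "h 0 0 = 0"
  shows "step_sequence I (\<lambda>n. h (s n) (t n))"
  unfolding step_sequence_def
proof
  have "range (\<lambda>n. h (s n) (t n)) \<subseteq> case_prod h ` (range s \<times> range t)" by auto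
  then show "finite (range (\<lambda>n. h (s n) (t n)))"
    by (rule finite_subset) (use assms(2,3) in \<open>simp add: step_sequence_def\<close>)
  have "{n. h (s n) (t n) \<noteq> 0} \<subseteq> {n. s n \<noteq> 0} \<union> {n. t n \<noteq> 0}"
    using assms(4) by auto
  then show "{n. h (s n) (t n) \<noteq> 0} \<in> I"
    using assms(2,3) ideal_closed(1,2)[OF I] unfolding step_sequence_def by blast
qed

lemma step_scale: "ideal_on_omega I \<Longrightarrow> step_sequence I s \<Longrightarrow> step_sequence I (\<lambda>n. c * s n :: 'k::real_normed_field)"
  using step_combine[of I s s "\<lambda>a _. c * a"] by simp

lemma step_indicator:
  assumes "A \<in> I"
  shows "step_sequence I (indicator A :: nat \<Rightarrow> 'k::zero_neq_one)"
proof -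
  have "range (indicator A :: nat \<Rightarrow> 'k) \<subseteq> {0, 1}" by (auto simp: indicator_def)
  then show ?thesis
    using assms by (auto simp: step_sequence_def indicator_def intro: finite_subset)
qed

text \<open>The bounded range of \<open>x\<close> has a finite \<open>e\<close>-net
  \<open>K\<close>, and values are rounded to \<open>K\<close>. Values of modulus below
  \<open>e\<close> are rounded to 0 instead, which confines the support to a member of
  \<open>I\<close>.\<close>

lemma step_approx:
  fixes x :: "nat \<Rightarrow> 'k::{real_normed_field, heine_borel}"
  assumes I: "ideal_on_omega I" and x: "x \<in> vecs (c0_ideal I)" and e: "e > 0"
  obtains s where "step_sequence I s" "\<And>n. norm (x n - s n) \<le> e"
proof -
  have "compact (closure (range x))"
    using x by (simp add: vecs_c0_ideal)
  then obtain K where K: "finite K" "closure (range x) \<subseteq> (\<Union>y\<in>K. ball y e)"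
    using e by (auto simp: compact_eq_totally_bounded)
  have "\<forall>n. \<exists>y\<in>K. norm (x n - y) < e"
  proof
    fix n
    have "x n \<in> closure (range x)" by (auto intro: closure_subset[THEN subsetD])
    then obtain z where "z \<in> K" "x n \<in> ball z e" using K(2) by blast
    then show "\<exists>y\<in>K. norm (x n - y) < e"
      by (auto simp: dist_norm norm_minus_commute)
  qed
  then obtain y where y: "\<And>n. y n \<in> K" "\<And>n. norm (x n - y n) < e" by metis
  define s where "s n = (if e \<le> norm (x n) then y n else 0)" for n
  have "range s \<subseteq> insert 0 K" using y(1) by (auto simp: s_def)
  then have "finite (range s)" by (rule finite_subset) (simp add: K(1))
  moreover have "{n. s n \<noteq> 0} \<in> I"
  proof (rule ideal_closed(1)[OF I])
    show "{n. e \<le> norm (x n)} \<in> I" using x e by (simp add: vecs_c0_ideal)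
  qed (auto simp: s_def)
  ultimately have "step_sequence I s"
    by (simp add: step_sequence_def)
  moreover have "norm (x n - s n) \<le> e" for n
    using y(2)[of n] by (auto simp: s_def)
  ultimately show ?thesis by (rule that)
qed

section \<open>Integration against an element of \<open>ba\<close>\<close>

definition step_integral :: "(nat set \<Rightarrow> 'k) \<Rightarrow> (nat \<Rightarrow> 'k::real_normed_field) \<Rightarrow> 'k" where
  "step_integral m s = (\<Sum>c\<in>range s. c * m (s -` {c}))"

text \<open>An integral may be computed on any finer partition into level sets of \<open>g\<close>:
  those with the same value of \<open>h\<close> are united by additivity of \<open>m\<close>. The
  value 0 is treated apart, since its level set may lie outside \<open>I\<close>, but its terms have
  the factor 0. The type of values of \<open>g\<close> is left open so that \<open>g\<close> can be
  a pair of sequences.\<close>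

lemma step_integral_comp:
  fixes h :: "'b \<Rightarrow> 'k::real_normed_field"
  assumes I: "ideal_on_omega I" and m: "m \<in> vecs (ba I)"
    and Z: "finite Z" "range g \<subseteq> Z" and supp: "{n. g n \<noteq> z0} \<in> I" "h z0 = 0"
  shows "step_integral m (\<lambda>n. h (g n)) = (\<Sum>z\<in>Z. h z * m (g -` {z}))"
proof -
  have fib: "g -` {z} \<in> I" if "z \<noteq> z0" for z
    by (rule ideal_closed(1)[OF I supp(1)]) (use that in auto)
  have fing: "finite (range g)" using Z finite_subset by blast
  have "c * m ((\<lambda>n. h (g n)) -` {c}) = (\<Sum>z | z \<in> range g \<and> h z = c. h z * m (g -` {z}))" for c
  proof (cases "c = 0")
    case False
    have "m (\<Union>z\<in>{z \<in> range g. h z = c}. g -` {z}) = (\<Sum>z\<in>{z \<in> range g. h z = c}. m (g -` {z}))"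
    proof (rule additive_finite_UN[where S = I and m = m])
      show "ring_of_sets UNIV I" by (rule ideal_ring[OF I])
      show "m {} = 0" by (rule ba_empty[OF I m])
      show "m (A \<union> B) = m A + m B" if "A \<in> I" "B \<in> I" "A \<inter> B = {}" for A B
        using that by (rule ba_closed(2)[OF m])
      show "g -` {z} \<in> I" if "z \<in> {z \<in> range g. h z = c}" for z
        using that False supp(2) by (intro fib) auto
    qed (use fing in \<open>auto simp: disjoint_family_on_def\<close>)
    moreover have "(\<Union>z\<in>{z \<in> range g. h z = c}. g -` {z}) = (\<lambda>n. h (g n)) -` {c}" by auto
    ultimately show ?thesis by (simp add: sum_distrib_left)
  qed simp
  then have "step_integral m (\<lambda>n. h (g n)) =
      (\<Sum>c\<in>range (\<lambda>n. h (g n)). \<Sum>z | z \<in> range g \<and> h z = c. h z * m (g -` {z}))"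
    by (simp add: step_integral_def)
  also have "\<dots> = (\<Sum>z\<in>range g. h z * m (g -` {z}))"
    using fing finite_imageI[OF fing, of h] by (intro sum.group) (auto simp: image_image)
  also have "\<dots> = (\<Sum>z\<in>Z. h z * m (g -` {z}))"
  proof (rule sum.mono_neutral_left[OF Z])
    have "g -` {z} = {}" if "z \<in> Z - range g" for z using that by auto
    then show "\<forall>z\<in>Z - range g. h z * m (g -` {z}) = 0"
      using ba_empty[OF I m] by simp
  qed
  finally show ?thesis .
qed

text \<open>The joint level sets of \<open>s\<close> and \<open>t\<close> form a common partition for the two integrals.\<close>

lemma step_integral_add:
  assumes I: "ideal_on_omega I" and m: "m \<in> vecs (ba I)" and st: "step_sequence I s" "step_sequence I t"
  shows "step_integral m (\<lambda>n. s n + t n) = step_integral m s + step_integral m t"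
proof -
  define g where "g n = (s n, t n)" for n
  have Z: "finite (range s \<times> range t)" "range g \<subseteq> range s \<times> range t"
    using st by (auto simp: step_sequence_def g_def)
  have "{n. g n \<noteq> (0, 0)} \<subseteq> {n. s n \<noteq> 0} \<union> {n. t n \<noteq> 0}" by (auto simp: g_def)
  then have supp: "{n. g n \<noteq> (0, 0)} \<in> I"
    using st ideal_closed(1,2)[OF I] unfolding step_sequence_def by blast
  note * = step_integral_comp[OF I m Z supp]
  show ?thesis
    using *[of "\<lambda>(a, b). a + b"] *[of fst] *[of snd]
    by (simp add: g_def distrib_right sum.distrib split_def)
qed

lemma step_integral_scale:
  assumes I: "ideal_on_omega I" and m: "m \<in> vecs (ba I)" and s: "step_sequence I s"
  shows "step_integral m (\<lambda>n. c * s n) = c * step_integral m s"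
proof -
  have "step_integral m (\<lambda>n. c * s n) = (\<Sum>z\<in>range s. c * z * m (s -` {z}))"
    using s by (intro step_integral_comp[OF I m, where ?z0.0 = 0]) (auto simp: step_sequence_def)
  then show ?thesis
    by (simp add: step_integral_def sum_distrib_left mult.assoc)
qed

lemma step_integral_indicator:
  assumes I: "ideal_on_omega I" and m: "m \<in> vecs (ba I)" and A: "A \<in> I"
  shows "step_integral m (indicator A) = m A"
proof -
  \<comment> \<open>The indicator factors through membership in \<open>A\<close>; the complement of
    \<open>A\<close> receives the coefficient 0.\<close>
  have "step_integral m (\<lambda>n. of_bool (n \<in> A)) = (\<Sum>z\<in>UNIV. of_bool z * m ((\<lambda>n. n \<in> A) -` {z}))"
    using A by (intro step_integral_comp[OF I m, where ?z0.0 = False]) auto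
  also have "\<dots> = m A"
    by (simp add: UNIV_bool vimage_def)
  finally show ?thesis by (simp add: indicator_def [abs_def])
qed

text \<open>The level sets of nonzero values are disjoint members of \<open>I\<close>, so the moduli
  of \<open>m\<close> on them sum to at most the variation.\<close>

lemma norm_step_integral_le:
  assumes I: "ideal_on_omega I" and m: "m \<in> vecs (ba I)" and s: "step_sequence I s" 
    and le: "\<And>n. norm (s n) \<le> K"
  shows "norm (step_integral m s) \<le> Sup (variation_sums I m) * K"
proof -
  have K: "0 \<le> K" using le norm_ge_zero order_trans by blast
  have fin: "finite (range s)" using s by (simp add: step_sequence_def)
  have "step_integral m s = (\<Sum>c\<in>range s - {0}. c * m (s -` {c}))"
    unfolding step_integral_def using fin by (intro sum.mono_neutral_right) auto
  then have "norm (step_integral m s) \<le> (\<Sum>c\<in>range s - {0}. norm (c * m (s -` {c})))"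
    by (simp only: norm_sum)
  also have "\<dots> \<le> (\<Sum>c\<in>range s - {0}. K * norm (m (s -` {c})))"
    using le by (intro sum_mono) (auto simp: norm_mult intro!: mult_right_mono)
  also have "\<dots> = K * (\<Sum>c\<in>range s - {0}. norm (m (s -` {c})))"
    by (simp add: sum_distrib_left)
  also have "\<dots> \<le> K * Sup (variation_sums I m)"
  proof (intro mult_left_mono K
      sum_norm_le_variation[where m = m and A = "\<lambda>c. s -` {c}", OF ba_closed(3)[OF m]])
    show "s -` {c} \<in> I" if "c \<in> range s - {0}" for c
      by (rule ideal_closed(1)[OF I, of "{n. s n \<noteq> 0}"]) (use that s in \<open>auto simp: step_sequence_def\<close>)
  qed (use fin in \<open>auto simp: disjoint_family_on_def\<close>)
  finally show ?thesis by (simp add: mult.commute)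
qed

lemma norm_step_integral_diff_le:
  assumes I: "ideal_on_omega I" and m: "m \<in> vecs (ba I)" and st: "step_sequence I s" "step_sequence I t"
    and le: "\<And>n. norm (s n - t n) \<le> K"
  shows "norm (step_integral m s - step_integral m t) \<le> Sup (variation_sums I m) * K"
proof -
  have "step_integral m (\<lambda>n. s n + (- 1) * t n) = step_integral m s + (- 1) * step_integral m t"
    using step_integral_add[OF I m st(1) step_scale[OF I st(2), of "- 1"]]
      step_integral_scale[OF I m st(2), of "- 1"] by simp
  moreover have "norm (step_integral m (\<lambda>n. s n + (- 1) * t n)) \<le> Sup (variation_sums I m) * K"
    using le st by (intro norm_step_integral_le[OF I m] step_combine[OF I, where h = "\<lambda>a b. a + (- 1) * b"]) auto
  ultimately show ?thesis by simp
qed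

text \<open>The integral is described by its error bound against all step sequences at once, so that
  its properties can be read off from whichever approximants are convenient.\<close>

definition is_integral :: "nat set set \<Rightarrow> (nat set \<Rightarrow> 'k) \<Rightarrow> (nat \<Rightarrow> 'k::real_normed_field) \<Rightarrow> 'k \<Rightarrow> bool" where
  "is_integral I m x l \<longleftrightarrow> (\<forall>s e. step_sequence I s \<longrightarrow> (\<forall>n. norm (x n - s n) \<le> e) \<longrightarrow>
     norm (l - step_integral m s) \<le> Sup (variation_sums I m) * e)"

text \<open>Step sequences close to \<open>x\<close> are close to each other, which makes the
  integrals of the approximants \<open>S k\<close> a Cauchy sequence. The same estimate, with an
  arbitrary \<open>s\<close> in place of the second approximant, passes to the limit and becomes the
  required bound.\<close>

lemma is_integral_exists:
  fixes x :: "nat \<Rightarrow> 'k::{real_normed_field, euclidean_space}"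
  assumes I: "ideal_on_omega I" and m: "m \<in> vecs (ba I)" and x: "x \<in> vecs (c0_ideal I)"
  shows "\<exists>l. is_integral I m x l"
proof -
  let ?V = "Sup (variation_sums I m)"
  have V: "0 \<le> ?V" by (rule variation_nonneg[OF ba_closed(3)[OF m]])
  have "\<exists>s. step_sequence I s \<and> (\<forall>n. norm (x n - s n) \<le> inverse (real (Suc k)))" for k
    using step_approx[OF I x, of "inverse (real (Suc k))"] by (metis of_nat_0_less_iff positive_imp_inverse_positive zero_less_Suc)
  then obtain S where S: "\<And>k. step_sequence I (S k)" "\<And>k n. norm (x n - S k n) \<le> inverse (real (Suc k))"
    by metis
  define u where "u k = step_integral m (S k)" for k
  have close: "norm (u k - step_integral m s) \<le> ?V * (inverse (real (Suc k)) + e)"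
    if "step_sequence I s" "\<And>n. norm (x n - s n) \<le> e" for k s e
    unfolding u_def
  proof (rule norm_step_integral_diff_le[OF I m S(1) that(1)])
    fix n
    have "norm (S k n - s n) \<le> norm (x n - S k n) + norm (x n - s n)"
      using norm_triangle_ineq4[of "x n - s n" "x n - S k n"] by simp
    then show "norm (S k n - s n) \<le> inverse (real (Suc k)) + e"
      using S(2)[of n k] that(2)[of n] by linarith
  qed
  have "Cauchy u"
  proof (rule metric_CauchyI)
    fix e :: real assume e: "0 < e"
    \<comment> \<open>The 2 accounts for the errors of two approximants, and the 1 for vanishing
      variation.\<close>
    then have "0 < e / (2 * (?V + 1))" using V by simp
    then obtain M where M: "inverse (real (Suc M)) < e / (2 * (?V + 1))"
      by (rule reals_Archimedean[THEN exE])
    have "dist (u k) (u l) < e" if "M \<le> k" "M \<le> l" for k l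
    proof -
      have "norm (u k - u l) \<le> ?V * (inverse (real (Suc k)) + inverse (real (Suc l)))"
        using close[OF S(1) S(2), of k l] by (simp add: u_def)
      also have "\<dots> \<le> (?V + 1) * (inverse (real (Suc M)) + inverse (real (Suc M)))"
        using that V by (intro mult_mono add_mono le_imp_inverse_le) auto
      also have "\<dots> = inverse (real (Suc M)) * (2 * (?V + 1))" by (simp add: algebra_simps)
      also have "\<dots> < e"
        using M V by (simp add: pos_less_divide_eq)
      finally show ?thesis by (simp add: dist_norm)
    qed
    then show "\<exists>M. \<forall>k\<ge>M. \<forall>l\<ge>M. dist (u k) (u l) < e" by blast
  qed
  then obtain l where l: "u \<longlonglongrightarrow> l"
    using Cauchy_convergent convergent_def by blast
  have "is_integral I m x l"
    unfolding is_integral_def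
  proof (intro allI impI)
    fix s e assume s: "step_sequence I s" "\<forall>n. norm (x n - s n) \<le> e"
    have "(\<lambda>k. norm (u k - step_integral m s)) \<longlonglongrightarrow> norm (l - step_integral m s)"
      by (intro tendsto_intros l)
    moreover have "(\<lambda>k. ?V * (inverse (real (Suc k)) + e)) \<longlonglongrightarrow> ?V * (0 + e)"
      by (intro tendsto_intros LIMSEQ_inverse_real_of_nat)
    ultimately have "norm (l - step_integral m s) \<le> ?V * (0 + e)"
      using close[OF s(1)] s(2) by (intro LIMSEQ_le) auto
    then show "norm (l - step_integral m s) \<le> ?V * e" by simp
  qed
  then show ?thesis by blast
qed

section \<open>Functionals and the elements of \<open>ba\<close> they determine\<close>

lemma dual_simps [simp]:
  "vadd (dual X) \<phi> \<psi> = (\<lambda>x. \<phi> x + \<psi> x)" "smul (dual X) c \<phi> = (\<lambda>x. c * \<phi> x)"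
  "vnorm (dual X) \<phi> = Sup {norm (\<phi> x) |x. x \<in> vecs X \<and> vnorm X x \<le> 1}"
  by (simp_all add: dual_def)

lemma vecs_dual_c0_ideal:
  "\<phi> \<in> vecs (dual (c0_ideal I)) \<longleftrightarrow>
    (\<forall>x. x \<notin> vecs (c0_ideal I) \<longrightarrow> \<phi> x = 0) \<and>
    (\<forall>x\<in>vecs (c0_ideal I). \<forall>y\<in>vecs (c0_ideal I). \<phi> (\<lambda>n. x n + y n) = \<phi> x + \<phi> y) \<and>
    (\<forall>c. \<forall>x\<in>vecs (c0_ideal I). \<phi> (\<lambda>n. c * x n) = c * \<phi> x) \<and>
    (\<exists>C. \<forall>x\<in>vecs (c0_ideal I). norm (\<phi> x) \<le> C * vnorm (c0_ideal I) x)"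
  unfolding dual_def function_space_simps mem_Collect_eq c0_ideal_simps(1,2) ..

lemma dual_c0_ideal_linear:
  assumes "\<phi> \<in> vecs (dual (c0_ideal I))" "x \<in> vecs (c0_ideal I)"
  shows "y \<in> vecs (c0_ideal I) \<Longrightarrow> \<phi> (\<lambda>n. x n + y n) = \<phi> x + \<phi> y"
    and "\<phi> (\<lambda>n. c * x n) = c * \<phi> x"
  using assms by (simp_all add: vecs_dual_c0_ideal)

lemma vnorm_c0_ideal_nonneg: "x \<in> vecs (c0_ideal I) \<Longrightarrow> 0 \<le> vnorm (c0_ideal I) x"
  using norm_le_vnorm_c0_ideal[of x I 0] norm_ge_zero[of "x 0"] by linarith

lemma dual_c0_ideal_bounded:
  assumes "\<phi> \<in> vecs (dual (c0_ideal I))"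
  shows "\<exists>C\<ge>0. \<forall>x\<in>vecs (c0_ideal I). norm (\<phi> x) \<le> C * vnorm (c0_ideal I) x"
proof -
  obtain C where C: "\<forall>x\<in>vecs (c0_ideal I). norm (\<phi> x) \<le> C * vnorm (c0_ideal I) x"
    using assms unfolding vecs_dual_c0_ideal by (elim exE conjE)
  have "norm (\<phi> x) \<le> \<bar>C\<bar> * vnorm (c0_ideal I) x" if "x \<in> vecs (c0_ideal I)" for x
  proof -
    have "norm (\<phi> x) \<le> C * vnorm (c0_ideal I) x" using C that by (rule bspec)
    also have "\<dots> \<le> \<bar>C\<bar> * vnorm (c0_ideal I) x"
      by (rule mult_right_mono[OF abs_ge_self vnorm_c0_ideal_nonneg[OF that]])
    finally show ?thesis .
  qed
  then show ?thesis by (intro exI[of _ "\<bar>C\<bar>"]) simp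
qed

text \<open>The functional is integration against \<open>m\<close>. Each linearity relation holds up
  to a fixed multiple of every positive \<open>e\<close>, hence exactly; the norm bound is the
  comparison with the zero sequence, whose distance from \<open>x\<close> is at most the norm of
  \<open>x\<close>.\<close>

lemma functional_of_ba:
  fixes m :: "nat set \<Rightarrow> 'k::{real_normed_field, euclidean_space}"
  assumes I: "ideal_on_omega I" and m: "m \<in> vecs (ba I)"
  obtains \<phi> where "\<phi> \<in> vecs (dual (c0_ideal I))" "\<And>A. A \<in> I \<Longrightarrow> \<phi> (indicator A) = m A"
    "\<And>x. x \<in> vecs (c0_ideal I) \<Longrightarrow> norm (\<phi> x) \<le> Sup (variation_sums I m) * vnorm (c0_ideal I) x"
proof -
  let ?V = "Sup (variation_sums I m)" and ?E = "vecs (c0_ideal I :: ('k, _) normed_space)"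
  have V: "0 \<le> ?V" by (rule variation_nonneg[OF ba_closed(3)[OF m]])
  define \<phi> where "\<phi> x = (if x \<in> ?E then SOME l. is_integral I m x l else 0)" for x
  have \<phi>: "norm (\<phi> x - step_integral m s) \<le> ?V * e"
    if "x \<in> ?E" "step_sequence I s" "\<And>n. norm (x n - s n) \<le> e" for x s e
  proof -
    have "is_integral I m x (\<phi> x)"
      using someI_ex[OF is_integral_exists[OF I m that(1)]] that(1) by (simp add: \<phi>_def)
    then show ?thesis using that by (simp add: is_integral_def)
  qed
  have eq0: "z = 0" if "\<And>e. e > 0 \<Longrightarrow> norm z \<le> C * e" "0 \<le> C" for z :: 'k and C
  proof -
    have "norm z \<le> 0 + e" if "e > 0" for e
    proof -
      have "norm z \<le> C * (e / (C + 1))"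
        using \<open>0 \<le> C\<close> \<open>e > 0\<close> by (intro \<open>\<And>e. e > 0 \<Longrightarrow> norm z \<le> C * e\<close>) auto
      also have "\<dots> \<le> e" using \<open>0 \<le> C\<close> \<open>e > 0\<close> by (simp add: field_simps)
      finally show ?thesis by simp
    qed
    then have "norm z \<le> 0" by (rule field_le_epsilon)
    then show ?thesis by simp
  qed
  have add: "\<phi> (\<lambda>n. x n + y n) = \<phi> x + \<phi> y" if xy: "x \<in> ?E" "y \<in> ?E" for x y
  proof -
    \<comment> \<open>The sum of the approximants is off by \<open>2 * e\<close> and each summand by
      \<open>e\<close>, which gives 4.\<close>
    have "norm (\<phi> (\<lambda>n. x n + y n) - (\<phi> x + \<phi> y)) \<le> (4 * ?V) * e" if e: "e > 0" for e
    proof -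
      obtain s where s: "step_sequence I s" "\<And>n. norm (x n - s n) \<le> e" using step_approx[OF I xy(1) e] by blast
      obtain t where t: "step_sequence I t" "\<And>n. norm (y n - t n) \<le> e" using step_approx[OF I xy(2) e] by blast
      have "norm (\<phi> (\<lambda>n. x n + y n) - step_integral m (\<lambda>n. s n + t n)) \<le> ?V * (2 * e)"
      proof (rule \<phi>[OF c0_ideal_add[OF I xy] step_combine[OF I s(1) t(1)]])
        show "norm (x n + y n - (s n + t n)) \<le> 2 * e" for n
          using norm_triangle_ineq[of "x n - s n" "y n - t n"] s(2)[of n] t(2)[of n]
          by (simp add: algebra_simps)
      qed simp
      moreover note \<phi>[OF xy(1) s] \<phi>[OF xy(2) t]
      moreover have "norm (\<phi> (\<lambda>n. x n + y n) - (\<phi> x + \<phi> y)) \<le>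
          norm (\<phi> (\<lambda>n. x n + y n) - step_integral m (\<lambda>n. s n + t n)) +
          (norm (\<phi> x - step_integral m s) + norm (\<phi> y - step_integral m t))"
        unfolding step_integral_add[OF I m s(1) t(1)]
        using norm_triangle_ineq[of "\<phi> x - step_integral m s" "\<phi> y - step_integral m t"]
          norm_triangle_ineq4[of "\<phi> (\<lambda>n. x n + y n) - (step_integral m s + step_integral m t)"
            "(\<phi> x - step_integral m s) + (\<phi> y - step_integral m t)"]
        by (simp add: algebra_simps)
      ultimately show ?thesis by (simp add: algebra_simps)
    qed
    then show ?thesis using V eq0[of "\<phi> (\<lambda>n. x n + y n) - (\<phi> x + \<phi> y)" "4 * ?V"] by simp
  qed
  have scale: "\<phi> (\<lambda>n. c * x n) = c * \<phi> x" if x: "x \<in> ?E" for c x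
  proof -
    have "norm (\<phi> (\<lambda>n. c * x n) - c * \<phi> x) \<le> (2 * ?V * norm c) * e" if e: "e > 0" for e
    proof -
      obtain s where s: "step_sequence I s" "\<And>n. norm (x n - s n) \<le> e" using step_approx[OF I x e] by blast
      have "norm (\<phi> (\<lambda>n. c * x n) - step_integral m (\<lambda>n. c * s n)) \<le> ?V * (norm c * e)"
        using s(2) by (intro \<phi>[OF c0_ideal_scale[OF I x] step_scale[OF I s(1)]])
          (auto simp: norm_mult mult_left_mono simp flip: right_diff_distrib)
      moreover have "norm (c * (\<phi> x - step_integral m s)) \<le> norm c * (?V * e)"
        unfolding norm_mult by (intro mult_left_mono \<phi>[OF x s]) auto
      moreover have "norm (\<phi> (\<lambda>n. c * x n) - c * \<phi> x) \<le>
          norm (\<phi> (\<lambda>n. c * x n) - step_integral m (\<lambda>n. c * s n)) +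
          norm (c * (\<phi> x - step_integral m s))"
        unfolding step_integral_scale[OF I m s(1)]
        using norm_triangle_ineq4[of "\<phi> (\<lambda>n. c * x n) - c * step_integral m s" "c * (\<phi> x - step_integral m s)"]
        by (simp add: algebra_simps)
      ultimately show ?thesis by (simp add: algebra_simps)
    qed
    then show ?thesis using V eq0[of "\<phi> (\<lambda>n. c * x n) - c * \<phi> x" "2 * ?V * norm c"] by simp
  qed
  have le: "norm (\<phi> x) \<le> ?V * vnorm (c0_ideal I) x" if x: "x \<in> ?E" for x
  proof -
    have "step_sequence I (\<lambda>_. 0 :: 'k)"
      using ideal_closed(3)[OF I, of "{}"] by (simp add: step_sequence_def)
    moreover have "step_integral m (\<lambda>_. 0) = 0" by (simp add: step_integral_def)
    ultimately show ?thesis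
      using \<phi>[OF x, of "\<lambda>_. 0" "vnorm (c0_ideal I) x"] norm_le_vnorm_c0_ideal[OF x]
      by (simp del: c0_ideal_simps)
  qed
  show ?thesis
  proof (rule that[of \<phi>])
    show "\<phi> \<in> vecs (dual (c0_ideal I))"
      unfolding vecs_dual_c0_ideal
      by (intro conjI allI ballI impI exI[of _ ?V] add scale le) (auto simp: \<phi>_def)
    \<comment> \<open>An indicator approximates itself with error 0.\<close>
    show "\<phi> (indicator A) = m A" if "A \<in> I" for A
      using \<phi>[OF step_in_c0_ideal[OF I] _, of "indicator A" "indicator A" 0] step_indicator[OF that]
        step_integral_indicator[OF I m that] by simp
  qed (rule le)
qed

text \<open>Membership is carried through the induction together with the formula, because \<phi> is
  linear only on the carrier.\<close>

lemma functional_sum_indicator: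
  fixes \<phi> :: "(nat \<Rightarrow> 'k::real_normed_field) \<Rightarrow> 'k"
  assumes I: "ideal_on_omega I" and \<phi>: "\<phi> \<in> vecs (dual (c0_ideal I))"
    and "finite F" "\<And>i. i \<in> F \<Longrightarrow> A i \<in> I"
  shows "(\<lambda>n. \<Sum>i\<in>F. c i * indicator (A i) n) \<in> vecs (c0_ideal I) \<and>
    \<phi> (\<lambda>n. \<Sum>i\<in>F. c i * indicator (A i) n) = (\<Sum>i\<in>F. c i * \<phi> (indicator (A i)))"
  using assms(3,4)
proof (induction F)
  case empty
  have "(\<lambda>_. 0 :: 'k) \<in> vecs (c0_ideal I)"
    using ideal_closed(3)[OF I, of "{}"] by (auto simp: vecs_c0_ideal)
  moreover from this have "\<phi> (\<lambda>n. 0 * 0) = 0 * \<phi> (\<lambda>_. 0)"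
    using dual_c0_ideal_linear(2)[OF \<phi>, of "\<lambda>_. 0" 0] by simp
  ultimately show ?case by simp
next
  case (insert i F)
  have i: "(indicator (A i) :: nat \<Rightarrow> 'k) \<in> vecs (c0_ideal I)"
    using insert by (intro step_in_c0_ideal[OF I] step_indicator) auto
  note ci = c0_ideal_scale[OF I i, of "c i"]
  have y: "(\<lambda>n. \<Sum>j\<in>F. c j * indicator (A j) n) \<in> vecs (c0_ideal I)"
    "\<phi> (\<lambda>n. \<Sum>j\<in>F. c j * indicator (A j) n) = (\<Sum>j\<in>F. c j * \<phi> (indicator (A j)))"
    using insert.IH insert.prems by blast+
  show ?case
    unfolding sum.insert[OF insert.hyps]
    using c0_ideal_add[OF I ci y(1)] dual_c0_ideal_linear(1)[OF \<phi> ci y(1)]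
      dual_c0_ideal_linear(2)[OF \<phi> i, of "c i"] y(2) by metis
qed

text \<open>Step sequences are dense in the domain.\<close>

lemma functional_eqI:
  fixes \<phi> \<psi> :: "(nat \<Rightarrow> 'k::{real_normed_field, heine_borel}) \<Rightarrow> 'k"
  assumes I: "ideal_on_omega I"
    and \<phi>: "\<phi> \<in> vecs (dual (c0_ideal I))" and \<psi>: "\<psi> \<in> vecs (dual (c0_ideal I))"
    and eq: "\<And>A. A \<in> I \<Longrightarrow> \<phi> (indicator A) = \<psi> (indicator A)"
  shows "\<phi> = \<psi>"
proof
  fix x
  let ?E = "vecs (c0_ideal I :: ('k, _) normed_space)"
  show "\<phi> x = \<psi> x"
  proof (cases "x \<in> ?E")
    case x: True
    obtain C where C: "0 \<le> C" "\<And>x. x \<in> ?E \<Longrightarrow> norm (\<phi> x) \<le> C * vnorm (c0_ideal I) x"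
      using dual_c0_ideal_bounded[OF \<phi>] by metis
    obtain D where D: "0 \<le> D" "\<And>x. x \<in> ?E \<Longrightarrow> norm (\<psi> x) \<le> D * vnorm (c0_ideal I) x"
      using dual_c0_ideal_bounded[OF \<psi>] by metis
    have simp_eq: "\<phi> s = \<psi> s" if s: "step_sequence I s" for s
    proof -
      \<comment> \<open>The value 0 is left out because its level set may lie outside
        \<open>I\<close>.\<close>
      have "s = (\<lambda>n. \<Sum>c\<in>range s - {0}. c * indicator (s -` {c}) n)"
      proof
        fix n
        have "(\<Sum>c\<in>range s - {0}. c * indicator (s -` {c}) n) =
            (\<Sum>c\<in>range s - {0}. if c = s n then c else 0)"
          by (intro sum.cong) (auto simp: indicator_def)
        also have "\<dots> = s n"
          using s by (subst sum.delta) (auto simp: step_sequence_def)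
        finally show "s n = (\<Sum>c\<in>range s - {0}. c * indicator (s -` {c}) n)" ..
      qed
      moreover have "finite (range s - {0})" using s by (simp add: step_sequence_def)
      moreover have lev: "s -` {c} \<in> I" if "c \<in> range s - {0}" for c
        by (rule ideal_closed(1)[OF I, of "{n. s n \<noteq> 0}"]) (use that s in \<open>auto simp: step_sequence_def\<close>)
      ultimately show ?thesis
        using functional_sum_indicator[OF I \<phi>, of "range s - {0}" "\<lambda>c. s -` {c}" "\<lambda>c. c"]
          functional_sum_indicator[OF I \<psi>, of "range s - {0}" "\<lambda>c. s -` {c}" "\<lambda>c. c"] eq lev
        by simp
    qed
    have "norm (\<phi> x - \<psi> x) \<le> 0 + e" if e: "e > 0" for e
    proof -
      define d where "d = e / (C + D + 1)"
      have pos: "0 < C + D + 1" using C(1) D(1) by linarith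
      have d: "d > 0" using e pos by (simp add: d_def)
      obtain s where s: "step_sequence I s" "\<And>n. norm (x n - s n) \<le> d"
        using step_approx[OF I x d] by blast
      have sE: "s \<in> ?E" by (rule step_in_c0_ideal[OF I s(1)])
      define y where "y n = x n + (- 1) * s n" for n
      have yE: "y \<in> ?E"
        unfolding y_def by (intro c0_ideal_add[OF I] c0_ideal_scale[OF I] x sE)
      have "\<phi> y = \<phi> x + (- 1) * \<phi> s" "\<psi> y = \<psi> x + (- 1) * \<psi> s"
        unfolding y_def
        using dual_c0_ideal_linear(1)[OF \<phi> x c0_ideal_scale[OF I sE, of "- 1"]] dual_c0_ideal_linear(2)[OF \<phi> sE, of "- 1"]
          dual_c0_ideal_linear(1)[OF \<psi> x c0_ideal_scale[OF I sE, of "- 1"]] dual_c0_ideal_linear(2)[OF \<psi> sE, of "- 1"]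
        by simp_all
      then have "\<phi> x - \<psi> x = \<phi> y - \<psi> y"
        using simp_eq[OF s(1)] by simp
      moreover have "vnorm (c0_ideal I) y \<le> d"
        using s(2) by (auto simp: y_def intro!: cSUP_least)
      then have "C * vnorm (c0_ideal I) y \<le> C * d" "D * vnorm (c0_ideal I) y \<le> D * d"
        using C(1) D(1) by (auto intro: mult_left_mono simp del: c0_ideal_simps)
      ultimately have "norm (\<phi> x - \<psi> x) \<le> C * d + D * d"
        using norm_triangle_ineq4[of "\<phi> y" "\<psi> y"] C(2)[OF yE] D(2)[OF yE]
        by (simp del: c0_ideal_simps)
      also have "\<dots> \<le> (C + D + 1) * d" using d by (simp add: algebra_simps)
      also have "\<dots> = e" using pos by (simp add: d_def)
      finally show ?thesis by simp
    qed
    then have "norm (\<phi> x - \<psi> x) \<le> 0" by (rule field_le_epsilon)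
    then show ?thesis by simp
  qed (use \<phi> \<psi> in \<open>simp add: vecs_dual_c0_ideal\<close>)
qed

text \<open>The test vector takes on \<open>A j\<close> the unimodular value that rotates \<open>\<phi> (indicator (A j))\<close> to
  its modulus; \<open>0 / 0 = 0\<close> covers the sets where that number vanishes.\<close>

lemma functional_variation_le:
  fixes \<phi> :: "(nat \<Rightarrow> 'k::real_normed_field) \<Rightarrow> 'k"
  assumes I: "ideal_on_omega I" and \<phi>: "\<phi> \<in> vecs (dual (c0_ideal I))"
    and A: "\<forall>j<n. A j \<in> I" "disjoint_family_on A {..<n::nat}"
  shows "\<exists>y. y \<in> vecs (c0_ideal I) \<and> vnorm (c0_ideal I) y \<le> 1 \<and>
    norm (\<phi> y) = (\<Sum>j<n. norm (\<phi> (indicator (A j))))"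
proof -
  define c where "c j = of_real (norm (\<phi> (indicator (A j)))) / \<phi> (indicator (A j))" for j
  define y where "y k = (\<Sum>j<n. c j * indicator (A j) k)" for k
  have c: "norm (c j) \<le> 1" "c j * \<phi> (indicator (A j)) = of_real (norm (\<phi> (indicator (A j))))" for j
    by (auto simp: c_def norm_divide)
  have y: "y \<in> vecs (c0_ideal I)" "\<phi> y = (\<Sum>j<n. c j * \<phi> (indicator (A j)))"
    unfolding y_def using functional_sum_indicator[OF I \<phi>, of "{..<n}" A c] A(1) by auto
  have "norm (y k) \<le> 1" for k
  proof (cases "\<exists>i<n. k \<in> A i")
    case True
    then obtain i where i: "i < n" "k \<in> A i" by blast
    have "k \<notin> A j" if "j < n" "j \<noteq> i" for j
      using disjoint_family_onD[OF A(2), of i j] i that by auto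
    then have "y k = (\<Sum>j<n. if j = i then c i else 0)"
      unfolding y_def using i by (intro sum.cong) (auto simp: indicator_def)
    then show ?thesis using c(1)[of i] i by simp
  next
    case False
    then have "y k = 0" by (auto simp: y_def indicator_def)
    then show ?thesis by simp
  qed
  then have "vnorm (c0_ideal I) y \<le> 1" by (auto intro!: cSUP_least)
  moreover have "norm (\<phi> y) = (\<Sum>j<n. norm (\<phi> (indicator (A j))))"
  proof -
    have "\<phi> y = of_real (\<Sum>j<n. norm (\<phi> (indicator (A j))))"
      by (simp add: y(2) c(2))
    then show ?thesis by (simp only: norm_of_real) (simp add: sum_nonneg)
  qed
  ultimately show ?thesis using y(1) by blast
qed

theorem dual_c0_ideal_isometric_ba:
  assumes I: "ideal_on_omega I"
  shows "dual (c0_ideal I :: ('k::{real_normed_field, euclidean_space}, _) normed_space) \<equiv>\<^sub>i ba I"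
proof -
  let ?E = "c0_ideal I :: ('k, _) normed_space"
  define T where "T = (\<lambda>(\<phi> :: (nat \<Rightarrow> 'k) \<Rightarrow> 'k) A. if A \<in> I then \<phi> (indicator A) else 0)"
  have ind: "(indicator A :: nat \<Rightarrow> 'k) \<in> vecs ?E" if "A \<in> I" for A
    using that by (intro step_in_c0_ideal[OF I] step_indicator)
  have T_mem: "T \<phi> \<in> vecs (ba I)" if \<phi>: "\<phi> \<in> vecs (dual ?E)" for \<phi>
  proof -
    have "T \<phi> (A \<union> B) = T \<phi> A + T \<phi> B" if "A \<in> I" "B \<in> I" "A \<inter> B = {}" for A B
    proof -
      have "indicator (A \<union> B) = (\<lambda>n. indicator A n + indicator B n :: 'k)"
        using that(3) by (auto simp: indicator_def fun_eq_iff)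
      then have "\<phi> (indicator (A \<union> B)) = \<phi> (indicator A) + \<phi> (indicator B)"
        using dual_c0_ideal_linear(1)[OF \<phi> ind ind] that by simp
      then show ?thesis
        using that ideal_closed(2)[OF I] by (simp add: T_def)
    qed
    moreover have "bdd_above (variation_sums I (T \<phi>))"
    proof -
      obtain C where C: "0 \<le> C" "\<And>x. x \<in> vecs ?E \<Longrightarrow> norm (\<phi> x) \<le> C * vnorm ?E x"
        using dual_c0_ideal_bounded[OF \<phi>] by metis
      have "(\<Sum>j<n. norm (T \<phi> (A j))) \<le> C"
        if A: "\<And>j. j < n \<Longrightarrow> A j \<in> I" "disjoint_family_on A {..<n}" for n :: nat and A
      proof -
        have A': "\<forall>j<n. A j \<in> I" using A(1) by simp
        obtain y where y: "y \<in> vecs ?E" "vnorm ?E y \<le> 1"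
          "norm (\<phi> y) = (\<Sum>j<n. norm (\<phi> (indicator (A j))))"
          using functional_variation_le[OF I \<phi> A' A(2)] by metis
        have "norm (\<phi> y) \<le> C * vnorm ?E y" by (rule C(2)[OF y(1)])
        also have "\<dots> \<le> C * 1" by (rule mult_left_mono[OF y(2) C(1)])
        finally show ?thesis
          using y(3) A(1) by (simp add: T_def)
      qed
      then show ?thesis by (rule variation_le(1)) auto
    qed
    ultimately show ?thesis by (simp add: ba_def T_def)
  qed
  have T_eqI: "\<phi> = \<psi>" if "\<phi> \<in> vecs (dual ?E)" "\<psi> \<in> vecs (dual ?E)" "T \<phi> = T \<psi>" for \<phi> \<psi>
  proof (rule functional_eqI[OF I that(1,2)])
    show "\<phi> (indicator A) = \<psi> (indicator A)" if "A \<in> I" for A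
      using fun_cong[OF \<open>T \<phi> = T \<psi>\<close>, of A] that by (simp add: T_def)
  qed
  have T_ex: "\<exists>\<phi>\<in>vecs (dual ?E). T \<phi> = m \<and>
      (\<forall>x\<in>vecs ?E. norm (\<phi> x) \<le> Sup (variation_sums I m) * vnorm ?E x)"
    if m: "m \<in> vecs (ba I)" for m
  proof -
    obtain \<phi> where \<phi>: "\<phi> \<in> vecs (dual ?E)" "\<And>A. A \<in> I \<Longrightarrow> \<phi> (indicator A) = m A"
      "\<And>x. x \<in> vecs ?E \<Longrightarrow> norm (\<phi> x) \<le> Sup (variation_sums I m) * vnorm ?E x"
      using functional_of_ba[OF I m] by metis
    have "T \<phi> = m"
      using \<phi>(2) ba_closed(1)[OF m] by (auto simp: T_def)
    then show ?thesis using \<phi> by blast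
  qed
  show ?thesis
  proof (rule isometrically_isomorphicI[where T = T])
    show "bij_betw T (vecs (dual ?E)) (vecs (ba I))"
      unfolding bij_betw_def inj_on_def using T_eqI T_ex T_mem by blast
    fix \<phi> assume \<phi>: "\<phi> \<in> vecs (dual ?E)"
    let ?V = "Sup (variation_sums I (T \<phi>))" and ?N = "{norm (\<phi> x) |x. x \<in> vecs ?E \<and> vnorm ?E x \<le> 1}"
    have V: "0 \<le> ?V" by (rule variation_nonneg[OF ba_closed(3)[OF T_mem[OF \<phi>]]])
    \<comment> \<open>By injectivity, \<phi> is the functional constructed from
      \<open>T \<phi>\<close> by integration, and it inherits the bound proved for that one.\<close>
    have le: "norm (\<phi> x) \<le> ?V * vnorm ?E x" if "x \<in> vecs ?E" for x
      using T_ex[OF T_mem[OF \<phi>]] T_eqI[OF \<phi>] that by metis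
    have N: "r \<le> ?V" if "r \<in> ?N" for r
    proof -
      obtain x where x: "r = norm (\<phi> x)" "x \<in> vecs ?E" "vnorm ?E x \<le> 1" using \<open>r \<in> ?N\<close> by blast
      have "?V * vnorm ?E x \<le> ?V * 1" using V x(3) by (intro mult_left_mono) auto
      then show ?thesis using le[OF x(2)] x(1) by simp
    qed
    have "?V \<le> Sup ?N"
    proof (rule variation_le(2))
      fix n :: nat and A assume A: "\<And>j. j < n \<Longrightarrow> A j \<in> I" "disjoint_family_on A {..<n}"
      have A': "\<forall>j<n. A j \<in> I" using A(1) by simp
      obtain y where y: "y \<in> vecs ?E" "vnorm ?E y \<le> 1"
        "norm (\<phi> y) = (\<Sum>j<n. norm (\<phi> (indicator (A j))))"
        using functional_variation_le[OF I \<phi> A' A(2)] by metis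
      have "norm (\<phi> y) \<le> Sup ?N"
        using y(1,2) N by (intro cSup_upper bdd_aboveI) auto
      then show "(\<Sum>j<n. norm (T \<phi> (A j))) \<le> Sup ?N"
        using y(3) A(1) by (simp add: T_def)
    qed
    moreover have "Sup ?N \<le> ?V"
    proof (rule cSup_least[OF _ N])
      \<comment> \<open>The empty family already supplies a vector of the unit ball.\<close>
      show "?N \<noteq> {}" using functional_variation_le[OF I \<phi>, of 0] by (auto simp: disjoint_family_on_def)
    qed
    ultimately show "vnorm (ba I) (T \<phi>) = vnorm (dual ?E) \<phi>" by (simp only: ba_simps dual_simps)
  qed (auto simp: T_def fun_eq_iff)
qed

section \<open>The isometries\<close>

text \<open>Each map was built in the direction in which it has a direct formula: functionals and
  measures to their values on a ring or on points, pairs to their sum. The chain runs through some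
  of them backwards, hence the appeals to symmetry.\<close>

theorem theorem3p8:
  fixes I :: "nat set set"
  assumes "ideal_on_omega I"
  shows
    "dual (c0_ideal I :: ('k::{real_normed_field, euclidean_space}, nat \<Rightarrow> 'k) normed_space)
       \<equiv>\<^sub>i ba I \<and>
     (ba I :: ('k, nat set \<Rightarrow> 'k) normed_space)
       \<equiv>\<^sub>i ell1 \<oplus>\<^sub>1 radon_space (subtopology beta_omega (U_ideal I - principal_points)) \<and>
     (ell1 :: ('k, nat \<Rightarrow> 'k) normed_space)
         \<oplus>\<^sub>1 radon_space (subtopology beta_omega (U_ideal I - principal_points))
       \<equiv>\<^sub>i radon_space (discrete_topology (UNIV :: nat set))
         \<oplus>\<^sub>1 radon_space (subtopology beta_omega (U_ideal I - principal_points)) \<and>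
     (radon_space (discrete_topology (UNIV :: nat set)) :: ('k, nat set \<Rightarrow> 'k) normed_space)
         \<oplus>\<^sub>1 radon_space (subtopology beta_omega (U_ideal I - principal_points))
       \<equiv>\<^sub>i ell1 \<oplus>\<^sub>1 ba0 I"
proof -
  note ba = ell1_ba0_isometric_ba[OF assms, where ?'k = 'k]
    and R = radon_isometric_ba0[OF assms, where ?'k = 'k]
    and L = radon_isometric_ell1[where ?'k = 'k]
  have "closed_under_operations ((ell1 :: ('k, _) normed_space) \<oplus>\<^sub>1 ba0 I)"
    using closed_under_operations_ell1[where ?'k = 'k] closed_under_operations_ba0[of I, where ?'a = 'k]
    by (auto simp: closed_under_operations_def simp del: ell1_simps ba0_simps)
  then have "(ba I :: ('k, _) normed_space) \<equiv>\<^sub>i ell1 \<oplus>\<^sub>1 ba0 I"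
    by (rule isometrically_isomorphic_sym[OF ba])
  moreover have "(ell1 :: ('k, _) normed_space) \<oplus>\<^sub>1 ba0 I \<equiv>\<^sub>i ell1 \<oplus>\<^sub>1 radon_space (nonprincipal_part I)"
    by (intro isometrically_isomorphic_direct_sum_1 isometrically_isomorphic_refl
        isometrically_isomorphic_sym[OF R] closed_under_operations_radon)
  ultimately have 2: "(ba I :: ('k, _) normed_space) \<equiv>\<^sub>i ell1 \<oplus>\<^sub>1 radon_space (nonprincipal_part I)"
    by (rule isometrically_isomorphic_trans)
  show ?thesis
    by (intro conjI dual_c0_ideal_isometric_ba[OF assms] 2 isometrically_isomorphic_direct_sum_1
        isometrically_isomorphic_refl isometrically_isomorphic_sym[OF L] closed_under_operations_radon L R)
qed

end
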